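(* Let $B^K_t=\int_0^t K(t,s)\,\mathrm{d}W_s$, $t\in[0,T]$, be a Volterra process whose $L^2$ kernel $K$ satisfies, for some $H\in(0,1)$ and $c\in(0,\infty)$, $\big(\int_{t-\varepsilon}^t K(t,s)^2\,\mathrm{d}s\big)^{1/2}\ge c\,\varepsilon^H$ for all $t\in(0,T]$ and $\varepsilon\in(0,t)$. Let $x_0\in\mathbb{R}$ and let $b\colon[0,T]\times\mathbb{R}\to\mathbb{R}$ be a measurable function such that $b(t,x)$ is piecewise uniformly continuous in the variable $x$, with finitely many discontinuity points $a_1,\dots,a_m\in\mathbb{R}$, $m\in\mathbb{N}$, and such that there is a constant $C$ with $|b(t,x)|\le C(1+|x|)$ for every $x\in\mathbb{R}$, uniformly in $t\in[0,T]$. Then the SDE $$\mathrm{d}X_t=b(t,X_t)\,\mathrm{d}t+\mathrm{d}B^K_t,\quad t\in[0,T],\qquad X_0=x_0,$$ admits a strong solution.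
   Context: $T\in(0,\infty)$ is fixed, $(\Omega,(\mathcal{A}_t)_{t\in[0,T]},\mathbb{P})$ is a filtered probability space, $(W_t)_{t\in[0,T]}$ is a standard one-dimensional Brownian motion on it, and $(\mathcal{A}_t)$ is the augmented filtration generated by $W$, satisfying the usual conditions. An $L^2$ kernel is a function $K\colon[0,T]\times[0,T]\to\mathbb{R}$ with $\int_0^T\int_0^T K(t,s)^2\,\mathrm{d}t\,\mathrm{d}s<\infty$ (the Wiener integrals defining $B^K_t$ are assumed well defined for each $t$). A strong solution is an $(\mathcal{A}_t)$-adapted process $X$ on the given space with $X_t=x_0+\int_0^t b(s,X_s)\,\mathrm{d}s+B^K_t$, $t\in[0,T]$, almost surely. Piecewise uniformly continuous in $x$ with discontinuity points $a_1<\dots<a_m$ means uniformly continuous in $x$ on each of the open intervals $(-\infty,a_1),(a_1,a_2),\dots,(a_m,\infty)$; no one-sided continuity at the $a_i$ is assumed. *)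

theory Defs
  imports "HOL-Probability.Probability"
begin

text \<open>
  Processes on \<open>[0,T]\<close> are functions of type \<open>real \<Rightarrow> 'a \<Rightarrow> real\<close> whose values at times outside
  \<open>{0..T}\<close> are never used.
\<close>

text \<open>
  On a complete space \<open>null_sets M\<close> contains all subsets of null sets, so this is the usual
  augmentation.
\<close>

definition augmented_filtration :: "'a measure \<Rightarrow> (real \<Rightarrow> 'a \<Rightarrow> real) \<Rightarrow> real \<Rightarrow> 'a measure" where
  "augmented_filtration M W t =
     sigma (space M)
       ((\<Union>s\<in>{0..t}. sets (vimage_algebra (space M) (W s) borel)) \<union> null_sets M)"

lemma augmented_filtration_generator_subset:
  "(\<Union>s\<in>{0..t}. sets (vimage_algebra (space M) (W s) borel)) \<union> null_sets M \<subseteq> Pow (space M)"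
  using sets.space_closed[of M] sets.space_closed[of "vimage_algebra (space M) (W _) borel"]
  by (fastforce simp: null_sets_def)

lemma filtration_augmented_filtration: "filtration (space M) (augmented_filtration M W)"
proof
  fix s t :: real
  assume "s \<le> t"
  then show "sets (augmented_filtration M W s) \<subseteq> sets (augmented_filtration M W t)"
    unfolding augmented_filtration_def
      sets_measure_of[OF augmented_filtration_generator_subset]
    by (intro sigma_sets_mono') auto
qed (simp add: augmented_filtration_def space_measure_of[OF augmented_filtration_generator_subset])

definition standard_brownian_motion ::
    "'a measure \<Rightarrow> (real \<Rightarrow> 'a measure) \<Rightarrow> real \<Rightarrow> (real \<Rightarrow> 'a \<Rightarrow> real) \<Rightarrow> bool" where
  "standard_brownian_motion M F T W \<longleftrightarrow>
     (\<forall>t\<in>{0..T}. W t \<in> borel_measurable M \<and> W t \<in> borel_measurable (F t)) \<and>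
     (AE \<omega> in M. W 0 \<omega> = 0) \<and>
     (\<forall>s t. 0 \<le> s \<and> s < t \<and> t \<le> T \<longrightarrow>
        distributed M lborel (\<lambda>\<omega>. W t \<omega> - W s \<omega>) (normal_density 0 (sqrt (t - s))) \<and>
        prob_space.indep_set M (sets (F s))
          (sets (vimage_algebra (space M) (\<lambda>\<omega>. W t \<omega> - W s \<omega>) borel))) \<and>
     (AE \<omega> in M. continuous_on {0..T} (\<lambda>t. W t \<omega>))"

definition step_function :: "nat \<Rightarrow> (nat \<Rightarrow> real) \<Rightarrow> (nat \<Rightarrow> real) \<Rightarrow> real \<Rightarrow> real" where
  "step_function n \<tau> c s = (\<Sum>i<n. c i * indicator {\<tau> i<..\<tau> (Suc i)} s)"

definition step_integral ::
    "(real \<Rightarrow> 'a \<Rightarrow> real) \<Rightarrow> nat \<Rightarrow> (nat \<Rightarrow> real) \<Rightarrow> (nat \<Rightarrow> real) \<Rightarrow> 'a \<Rightarrow> real" where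
  "step_integral W n \<tau> c \<omega> = (\<Sum>i<n. c i * (W (\<tau> (Suc i)) \<omega> - W (\<tau> i) \<omega>))"

text \<open>
  The Wiener integral of \<open>f\<close> over \<open>[a,b]\<close> is the limit in \<open>L\<^sup>2(M)\<close> of the integrals of step
  functions converging to \<open>f\<close> in \<open>L\<^sup>2([a,b])\<close>. It is determined only up to almost sure equality,
  so it is a relation: \<open>I\<close> is a version of the integral.
\<close>

definition is_wiener_integral ::
    "'a measure \<Rightarrow> (real \<Rightarrow> 'a \<Rightarrow> real) \<Rightarrow> real \<Rightarrow> real \<Rightarrow> (real \<Rightarrow> real) \<Rightarrow> ('a \<Rightarrow> real) \<Rightarrow> bool" where
  "is_wiener_integral M W a b f I \<longleftrightarrow>
     I \<in> borel_measurable M \<and>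
     (\<exists>(n :: nat \<Rightarrow> nat) (\<tau> :: nat \<Rightarrow> nat \<Rightarrow> real) (c :: nat \<Rightarrow> nat \<Rightarrow> real).
        (\<forall>k. a \<le> \<tau> k 0 \<and> (\<forall>i<n k. \<tau> k i \<le> \<tau> k (Suc i)) \<and> \<tau> k (n k) \<le> b) \<and>
        (\<lambda>k. \<integral>\<^sup>+s\<in>{a..b}. ennreal ((step_function (n k) (\<tau> k) (c k) s - f s)\<^sup>2) \<partial>lborel)
          \<longlonglongrightarrow> 0 \<and>
        (\<lambda>k. \<integral>\<^sup>+\<omega>. ennreal ((step_integral W (n k) (\<tau> k) (c k) \<omega> - I \<omega>)\<^sup>2) \<partial>M)
          \<longlonglongrightarrow> 0)"

text \<open>
  The last conjunct says that the Wiener integral of \<open>K t\<close> over \<open>[0,t]\<close> exists for every \<open>t\<close>,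
  not only for almost every \<open>t\<close>.
\<close>

definition L2_kernel :: "real \<Rightarrow> (real \<Rightarrow> real \<Rightarrow> real) \<Rightarrow> bool" where
  "L2_kernel T K \<longleftrightarrow>
     (\<lambda>(t, s). K t s)
       \<in> borel_measurable (restrict_space borel {0..T} \<Otimes>\<^sub>M restrict_space borel {0..T}) \<and>
     (\<integral>\<^sup>+s\<in>{0..T}. (\<integral>\<^sup>+t\<in>{0..T}. ennreal ((K t s)\<^sup>2) \<partial>lborel) \<partial>lborel) < \<infinity> \<and>
     (\<forall>t\<in>{0..T}. set_integrable lborel {0..t} (\<lambda>s. (K t s)\<^sup>2))"

text \<open>
  The random variables \<open>B t\<close> are prescribed only up to null sets depending on \<open>t\<close>; as usual for
  processes that enter pathwise integrals over time, \<open>B\<close> is a jointly measurable version.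
\<close>

definition volterra_process ::
    "'a measure \<Rightarrow> (real \<Rightarrow> 'a \<Rightarrow> real) \<Rightarrow> real \<Rightarrow> (real \<Rightarrow> real \<Rightarrow> real) \<Rightarrow>
     (real \<Rightarrow> 'a \<Rightarrow> real) \<Rightarrow> bool" where
  "volterra_process M W T K B \<longleftrightarrow>
     (\<lambda>(t, \<omega>). B t \<omega>) \<in> borel_measurable (restrict_space borel {0..T} \<Otimes>\<^sub>M M) \<and>
     (\<forall>t\<in>{0..T}. is_wiener_integral M W 0 t (K t) (B t))"

text \<open>
  The breakpoints are \<open>a 1 < \<dots> < a m\<close>. For \<open>i = 0\<close> and \<open>i = m\<close> the set below is the unbounded
  interval to the left of \<open>a 1\<close> and to the right of \<open>a m\<close>, respectively (the whole line
  if \<open>m = 0\<close>).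
\<close>

definition piecewise_uniformly_continuous :: "nat \<Rightarrow> (nat \<Rightarrow> real) \<Rightarrow> (real \<Rightarrow> real) \<Rightarrow> bool" where
  "piecewise_uniformly_continuous m a f \<longleftrightarrow>
     strict_mono_on {1..m} a \<and>
     (\<forall>i\<le>m. uniformly_continuous_on
        {x. (1 \<le> i \<longrightarrow> a i < x) \<and> (i < m \<longrightarrow> x < a (Suc i))} f)"

text \<open>
  Strong solution of \<open>dX\<^sub>t = b(t,X\<^sub>t) dt + dB\<^sub>t\<close>, \<open>X\<^sub>0 = x0\<close> on \<open>[0,T]\<close>. Integrability is required
  explicitly because the Lebesgue integral of a non-integrable function is 0 by convention.
\<close>

definition strong_solution ::
    "'a measure \<Rightarrow> (real \<Rightarrow> 'a measure) \<Rightarrow> real \<Rightarrow> real \<Rightarrow> (real \<Rightarrow> real \<Rightarrow> real) \<Rightarrow>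
     (real \<Rightarrow> 'a \<Rightarrow> real) \<Rightarrow> (real \<Rightarrow> 'a \<Rightarrow> real) \<Rightarrow> bool" where
  "strong_solution M F T x0 b B X \<longleftrightarrow>
     (\<forall>t\<in>{0..T}. X t \<in> borel_measurable (F t)) \<and>
     (AE \<omega> in M. \<forall>t\<in>{0..T}.
        set_integrable lborel {0..t} (\<lambda>s. b s (X s \<omega>)) \<and>
        X t \<omega> = x0 + (LBINT s:{0..t}. b s (X s \<omega>)) + B t \<omega>)"

end

theory Submission
  imports Defs
begin

text \<open>
  Write \<open>X = y + B\<close>, so that \<open>y\<close> solves \<open>y' = b(t, y + B\<^sub>t)\<close> path by path. Replacing \<open>b(t, \<cdot>)\<close> by
  its sup-convolutions (with the supremum over rational points only, for measurability), which are
  Lipschitz and decrease to \<open>b(t, \<cdot>)\<close> at continuity points, gives uniquely solvable equations whose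
  adapted solutions decrease to a limit \<open>y\<close> by comparison; the limit is obtained path by path, hence
  is adapted, and no weak limit or uniqueness argument is needed. By dominated convergence, \<open>y\<close>
  solves the original equation provided \<open>X\<close> spends no time at the points \<open>a\<^sub>i\<close>. Given the past
  up to \<open>t - \<epsilon>\<close>, the noise \<open>B\<^sub>t\<close> is Gaussian with standard deviation at least of order \<open>\<epsilon>\<^sup>H\<close>,
  whereas \<open>y\<close> moves only by \<open>O(\<epsilon>)\<close> on average; at the scale \<open>\<eta> = \<epsilon>\<^bsup>(1 + H)/2\<^esup>\<close> both error terms
  \<open>\<eta> / \<epsilon>\<^sup>H\<close> and \<open>\<epsilon> / \<eta>\<close> in the bound for \<open>P(X\<^sub>t = a\<^sub>i)\<close> vanish as \<open>\<epsilon> \<rightarrow> 0\<close>, because \<open>H < 1\<close>.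
\<close>

section \<open>Ordinary differential equations with additive forcing\<close>

text \<open>The argument threatens to be circular: the equation for the limit \<open>y\<close> is
  obtained only once the time spent at the points \<open>a i\<close> is known to be null, and that
  time has to be estimated before \<open>y\<close> is known to solve anything. The way out is that
  the increment bound of the approximations survives the limit, and the hitting estimate uses
  nothing about \<open>y\<close> but this bound, measurability and adaptedness. The kernel is only
  square integrable, so paths of \<open>B\<close> need not be continuous; almost surely they are
  integrable in time. Hence increments of \<open>y\<close> are bounded by the time integral of a
  possibly unbounded majorant, and the order \<epsilon> appears only after averaging over time as
  well as over the probability space. No conditional law is formed. The indicator of a ball of
  radius \<eta> is dominated by a multiple of a Gaussian density of width \<eta>, the Brownian
  increments after time \<open>t - \<epsilon>\<close> are integrated out one by one, each as a
  convolution of Gaussian densities, and the maximum of the resulting density gives the small ball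
  bound.\<close>

lemma set_integrable_Icc_bounded:
  fixes v :: "real \<Rightarrow> real"
  assumes "v \<in> borel_measurable borel" and "\<And>s. s \<in> {a..b} \<Longrightarrow> \<bar>v s\<bar> \<le> D"
  shows "set_integrable lborel {a..b} v"
proof (rule set_integrable_bound)
  show "set_integrable lborel {a..b} (\<lambda>_. D)"
    by (rule borel_integrable_atLeastAtMost') auto
  show "set_borel_measurable lborel {a..b} v"
    using assms(1) unfolding set_borel_measurable_def by measurable
  show "AE x in lborel. x \<in> {a..b} \<longrightarrow> norm (v x) \<le> norm D"
    using assms(2) by (intro AE_I2) force
qed

lemma bounded_on_Icc:
  fixes f :: "real \<Rightarrow> real"
  assumes "continuous_on {a..b} f"
  shows "\<exists>D. \<forall>t\<in>{a..b}. \<bar>f t\<bar> \<le> D"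
  using compact_imp_bounded[OF compact_continuous_image[OF assms compact_Icc]]
  by (auto simp: bounded_iff)

lemma continuous_on_set_integral:
  fixes h :: "real \<Rightarrow> real"
  assumes "set_integrable lborel {0..T} h"
  shows "continuous_on {0..T} (\<lambda>t. LBINT s:{0..t}. h s)"
proof -
  have "integral {0..t} h = (LBINT s:{0..t}. h s)" if "t \<in> {0..T}" for t
    using that by (intro set_borel_integral_eq_integral(2)[symmetric]
      set_integrable_subset[OF assms]) auto
  moreover have "continuous_on {0..T} (\<lambda>t. integral {0..t} h)"
    by (intro indefinite_integral_continuous_1 set_borel_integral_eq_integral(1) assms)
  ultimately show ?thesis
    by (auto intro: continuous_on_eq)
qed

lemma set_integral_Icc_degenerate:
  fixes h :: "real \<Rightarrow> real"
  shows "(LBINT s:{a}. h s) = 0"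
  unfolding set_lebesgue_integral_def
  using AE_lborel_singleton[of a] by (intro integral_eq_zero_AE) (auto elim!: eventually_mono)

lemma set_integral_Icc_combine:
  fixes h :: "real \<Rightarrow> real"
  assumes "set_integrable lborel {a..c} h" and "a \<le> b" and "b \<le> c"
  shows "(LBINT s:{a..c}. h s) = (LBINT s:{a..b}. h s) + (LBINT s:{b..c}. h s)"
proof -
  have "set_integrable lborel {a..b} h" "set_integrable lborel {b..c} h"
    using assms by (auto intro: set_integrable_subset)
  moreover have "{a..c} = {a..b} \<union> {b..c}"
    using assms by auto
  moreover have "AE x in lborel. \<not> (x \<in> {a..b} \<and> x \<in> {b..c})"
    using AE_lborel_singleton[of b] by eventually_elim auto
  ultimately show ?thesis
    by (auto intro!: set_integral_Un_AE)
qed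

text \<open>In the norm sup of \<open>\<bar>v s\<bar> * exp (- 2 * L * s)\<close> the operator
  sending \<open>v\<close> to \<open>L\<close> times its running integral has norm at most 1/2; the
  rate \<open>2 * L\<close> is chosen for this. Both \<open>gronwall\<close> and the convergence of
  the Picard iterates rest on it, without any smallness of \<open>T\<close>.\<close>

lemma exp_weighted_integral_le:
  fixes v :: "real \<Rightarrow> real"
  assumes v: "v \<in> borel_measurable borel" and L: "0 < L" and t: "0 \<le> t"
    and bd: "\<And>s. s \<in> {0..t} \<Longrightarrow> 0 \<le> v s \<and> v s \<le> D * exp (2 * L * s)"
  shows "L * (LBINT s:{0..t}. v s) \<le> D / 2 * exp (2 * L * t)"
proof -
  have D: "0 \<le> D"
    using bd[of 0] t by (auto intro: order_trans)
  have cont: "continuous_on {0..t} (\<lambda>s. D * exp (2 * L * s))"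
    by (intro continuous_intros)
  have "\<bar>v s\<bar> \<le> D * exp (2 * L * t)" if "s \<in> {0..t}" for s
  proof -
    have "D * exp (2 * L * s) \<le> D * exp (2 * L * t)"
      using that D L by (intro mult_left_mono) auto
    with bd[OF that] show ?thesis by linarith
  qed
  then have "(LBINT s:{0..t}. v s) \<le> (LBINT s:{0..t}. D * exp (2 * L * s))"
    using bd cont by (intro set_integral_mono borel_integrable_atLeastAtMost'
      set_integrable_Icc_bounded[OF v]) auto
  also have "\<dots> = D / (2 * L) * exp (2 * L * t) - D / (2 * L) * exp (2 * L * 0)"
  proof -
    have "(LBINT s. (D * exp (2 * L * s)) * indicator {0..t} s) =
        D / (2 * L) * exp (2 * L * t) - D / (2 * L) * exp (2 * L * 0)"
      using L t by (intro integral_FTC_Icc_real) (auto intro!: derivative_eq_intros)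
    then show ?thesis
      unfolding set_lebesgue_integral_def
      by (metis (no_types, lifting) Bochner_Integration.integral_cong mult.commute real_scaleR_def)
  qed
  also have "\<dots> \<le> D / (2 * L) * exp (2 * L * t)"
    using D L by simp
  finally have "L * (LBINT s:{0..t}. v s) \<le> L * (D / (2 * L) * exp (2 * L * t))"
    using L by (intro mult_left_mono) auto
  with L show ?thesis
    by simp
qed

text \<open>
  The exponential weight halves the integral operator, so iterating the hypothesis drives any
  a priori bound \<open>D\<close> down to \<open>2 * A\<close>. For \<open>A = 0\<close> the conclusion is \<open>u t \<le> 0\<close>.
\<close>

lemma gronwall:
  fixes u :: "real \<Rightarrow> real"
  assumes u: "u \<in> borel_measurable borel" and L: "0 < L" and A: "0 \<le> A"
    and D: "\<And>t. t \<in> {0..T} \<Longrightarrow> u t \<le> D"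
    and le: "\<And>t. t \<in> {0..T} \<Longrightarrow> u t \<le> A + L * (LBINT s:{0..t}. max 0 (u s))"
    and t: "t \<in> {0..T}"
  shows "u t \<le> 2 * A * exp (2 * L * t)"
proof -
  define D' where "D' = max 0 D"
  have iter: "u t \<le> (2 * A + D' / 2 ^ k) * exp (2 * L * t)" if "t \<in> {0..T}" for k t
    using that
  proof (induction k arbitrary: t)
    case 0
    have "u t \<le> D'"
      using D[OF 0] unfolding D'_def by simp
    also have "\<dots> \<le> (2 * A + D') * exp (2 * L * t)"
    proof -
      have "D' * 1 \<le> (2 * A + D') * exp (2 * L * t)"
        using A L 0 by (intro mult_mono) (auto simp: D'_def)
      then show ?thesis by simp
    qed
    finally show ?case
      by simp
  next
    case (Suc k)
    let ?D = "2 * A + D' / 2 ^ k"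
    have D0: "0 \<le> ?D"
      using A by (auto simp: D'_def)
    have "L * (LBINT s:{0..t}. max 0 (u s)) \<le> ?D / 2 * exp (2 * L * t)"
      using u L Suc.prems D0
      by (intro exp_weighted_integral_le) (auto intro!: Suc.IH)
    then have "u t \<le> A + ?D / 2 * exp (2 * L * t)"
      using le[OF Suc.prems] by linarith
    \<comment> \<open>The weight is at least 1, so \<open>A\<close> may carry it too. Then
      \<open>2 * A\<close> is the fixed point of the map from \<open>D\<close> to
      \<open>A + D / 2\<close>, and only the excess over it is halved.\<close>
    also have "\<dots> \<le> A * exp (2 * L * t) + ?D / 2 * exp (2 * L * t)"
      using A L Suc.prems by (simp add: mult_le_cancel_left1)
    also have "\<dots> = (2 * A + D' / 2 ^ Suc k) * exp (2 * L * t)"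
      by (simp add: field_simps)
    finally show ?case .
  qed
  have "(\<lambda>k. (2 * A + D' / 2 ^ k) * exp (2 * L * t)) \<longlonglongrightarrow> (2 * A + 0) * exp (2 * L * t)"
    by (intro tendsto_intros LIMSEQ_divide_realpow_zero) auto
  then show ?thesis
    using LIMSEQ_le_const[of _ "(2 * A + 0) * exp (2 * L * t)" "u t"] iter[OF t] by fastforce
qed


text \<open>The one-sided Lipschitz bound is available only while \<open>y\<^sub>1\<close> exceeds
  \<open>y\<^sub>2\<close>. Integrating the difference from the last time at which it is not
  positive, instead of from 0, stays inside that region, and \<open>gronwall\<close> with
  \<open>A = 0\<close> applies to the positive part.\<close>

lemma comparison:
  fixes y\<^sub>1 y\<^sub>2 h\<^sub>1 h\<^sub>2 :: "real \<Rightarrow> real"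
  assumes y: "y\<^sub>1 \<in> borel_measurable borel" "y\<^sub>2 \<in> borel_measurable borel"
    and h: "set_integrable lborel {0..T} h\<^sub>1" "set_integrable lborel {0..T} h\<^sub>2"
    and y1: "\<And>t. t \<in> {0..T} \<Longrightarrow> y\<^sub>1 t = x + (LBINT s:{0..t}. h\<^sub>1 s)"
    and y2: "\<And>t. t \<in> {0..T} \<Longrightarrow> y\<^sub>2 t = x + (LBINT s:{0..t}. h\<^sub>2 s)"
    and L: "0 < L"
    and le: "\<And>s. s \<in> {0..T} \<Longrightarrow> y\<^sub>2 s < y\<^sub>1 s \<Longrightarrow> h\<^sub>1 s - h\<^sub>2 s \<le> L * (y\<^sub>1 s - y\<^sub>2 s)"
    and t: "t \<in> {0..T}"
  shows "y\<^sub>1 t \<le> y\<^sub>2 t"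
proof -
  define w where "w s = y\<^sub>1 s - y\<^sub>2 s" for s
  define k where "k s = h\<^sub>1 s - h\<^sub>2 s" for s
  have k: "set_integrable lborel {0..T} k"
    using h unfolding k_def by auto
  have w_eq: "w t = (LBINT s:{0..t}. k s)" if "t \<in> {0..T}" for t
  proof -
    have "set_integrable lborel {0..t} h\<^sub>1" "set_integrable lborel {0..t} h\<^sub>2"
      using that h by (auto intro: set_integrable_subset)
    then show ?thesis
      using that y1 y2 by (simp add: w_def k_def)
  qed
  have cont: "continuous_on {0..T} w"
    by (rule continuous_on_eq[OF continuous_on_set_integral[OF k]]) (simp add: w_eq)
  have w[measurable]: "w \<in> borel_measurable borel"
    unfolding w_def using y by measurable
  obtain D where D: "\<And>t. t \<in> {0..T} \<Longrightarrow> \<bar>w t\<bar> \<le> D"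
    using bounded_on_Icc[OF cont] by blast
  have "w t \<le> 2 * 0 * exp (2 * L * t)"
  proof (rule gronwall[OF w L order_refl _ _ t])
    show "w t \<le> D" if "t \<in> {0..T}" for t
      using D[OF that] by linarith
    show "w t \<le> 0 + L * (LBINT s:{0..t}. max 0 (w s))" if t: "t \<in> {0..T}" for t
    proof (cases "w t \<le> 0")
      case True
      have "0 \<le> (LBINT s:{0..t}. max 0 (w s))"
        by (auto simp: set_lebesgue_integral_def)
      with True L show ?thesis
        by (auto intro: order_trans)
    next
      case False
      let ?S = "{s \<in> {0..t}. w s \<le> 0}"
      \<comment> \<open>The last time up to \<open>t\<close> with \<open>w \<le> 0\<close>. It is
        attained because \<open>w\<close> is continuous, and it exists because
        \<open>w 0 = 0\<close>.\<close>
      define r where "r = Sup ?S"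
      have "continuous_on {0..t} w"
        using cont t by (auto intro: continuous_on_subset)
      then have "closed ?S"
        using continuous_on_closed_Collect_le[of "{0..t}" w "\<lambda>_. 0"] by simp
      moreover have "0 \<in> ?S"
        using w_eq[of 0] t by (simp add: set_integral_Icc_degenerate)
      moreover have "bdd_above ?S"
        by (auto intro: bdd_aboveI[of _ t])
      ultimately have "r \<in> ?S"
        unfolding r_def by (intro closed_contains_Sup) auto
      then have r: "0 \<le> r" "r \<le> t" "w r \<le> 0"
        by auto
      have pos: "0 < w s" if "s \<in> {r<..t}" for s
      proof (rule ccontr)
        assume "\<not> 0 < w s"
        then have "s \<in> ?S"
          using that r by auto
        then have "s \<le> r"
          unfolding r_def using \<open>bdd_above ?S\<close> by (intro cSup_upper) auto
        with that show False by auto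
      qed
      have int_k: "set_integrable lborel {0..t} k" "set_integrable lborel {r..t} k"
        using r t by (auto intro: set_integrable_subset[OF k])
      have int_w: "set_integrable lborel {0..t} (\<lambda>s. max 0 (w s))"
      proof (rule set_integrable_Icc_bounded)
        show "\<bar>max 0 (w s)\<bar> \<le> D" if "s \<in> {0..t}" for s
          using D[of s] t that by auto
      qed measurable
      have "w t = w r + (LBINT s:{r..t}. k s)"
        using set_integral_Icc_combine[OF int_k(1), of r] r t w_eq by simp
      also have "\<dots> \<le> (LBINT s:{r..t}. k s)"
        using r by simp
      also have "\<dots> \<le> (LBINT s:{r..t}. L * max 0 (w s))"
      proof (rule set_integral_mono_AE)
        show "set_integrable lborel {r..t} (\<lambda>s. L * max 0 (w s))"
          using r by (intro set_integrable_mult_right set_integrable_subset[OF int_w]) auto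
        show "AE s\<in>{r..t} in lborel. k s \<le> L * max 0 (w s)"
          using AE_lborel_singleton[of r]
        proof eventually_elim
          case (elim s)
          show ?case
          proof
            assume "s \<in> {r..t}"
            with elim r t have "s \<in> {r<..t}" "s \<in> {0..T}"
              by auto
            then show "k s \<le> L * max 0 (w s)"
              using pos[of s] le[of s] by (simp add: k_def w_def)
          qed
        qed
      qed (use int_k in auto)
      also have "\<dots> = L * (LBINT s:{r..t}. max 0 (w s))"
        by simp
      also have "\<dots> \<le> L * (LBINT s:{0..t}. max 0 (w s))"
      proof (rule mult_left_mono)
        have "0 \<le> (LBINT s:{0..r}. max 0 (w s))"
          by (auto simp: set_lebesgue_integral_def)
        then show "(LBINT s:{r..t}. max 0 (w s)) \<le> (LBINT s:{0..t}. max 0 (w s))"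
          using set_integral_Icc_combine[OF int_w, of r] r by simp
      qed (use L in simp)
      finally show ?thesis by simp
    qed
  qed
  then show ?thesis
    by (simp add: w_def)
qed

section \<open>Picard iteration, jointly measurable in time and forcing path\<close>

lemma borel_measurable_set_integral_Icc [measurable (raw)]:
  fixes h :: "'w \<Rightarrow> real \<Rightarrow> real"
  assumes [measurable]: "(\<lambda>(w, s). h w s) \<in> borel_measurable (N \<Otimes>\<^sub>M borel)"
    "u \<in> borel_measurable N" "v \<in> borel_measurable N"
  shows "(\<lambda>w. LBINT s:{u w..v w}. h w s) \<in> borel_measurable N"
proof -
  have "(\<lambda>w. LBINT s. (if u w \<le> s \<and> s \<le> v w then h w s else 0)) \<in> borel_measurable N"
    by measurable
  then show ?thesis
    by (rule measurable_cong[THEN iffD1, rotated])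
      (auto simp: set_lebesgue_integral_def indicator_def intro!: Bochner_Integration.integral_cong)
qed

primrec picard :: "(real \<Rightarrow> real \<Rightarrow> real) \<Rightarrow> real \<Rightarrow> (real \<Rightarrow> real) \<Rightarrow> nat \<Rightarrow> real \<Rightarrow> real" where
  "picard g x \<beta> 0 t = x"
| "picard g x \<beta> (Suc k) t = x + (LBINT s:{0..t}. g s (picard g x \<beta> k s + \<beta> s))"

text \<open>Since \<open>lim\<close> is total, the solution is an explicit countable limit of
  functionals of the path. Measurability in the path can thus be proved with no reference to
  convergence, and convergence is treated separately, path by path.\<close>

definition ode_solution :: "(real \<Rightarrow> real \<Rightarrow> real) \<Rightarrow> real \<Rightarrow> (real \<Rightarrow> real) \<Rightarrow> real \<Rightarrow> real" where
  "ode_solution g x \<beta> t = lim (\<lambda>k. picard g x \<beta> k t)"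

lemma borel_measurable_picard:
  assumes [measurable]: "(\<lambda>(s, x). g s x) \<in> borel_measurable (borel \<Otimes>\<^sub>M borel)"
    "(\<lambda>(s, \<omega>). B s \<omega>) \<in> borel_measurable (borel \<Otimes>\<^sub>M N)"
  shows "(\<lambda>(t, \<omega>). picard g x (\<lambda>s. B s \<omega>) k t) \<in> borel_measurable (borel \<Otimes>\<^sub>M N)"
proof (induction k)
  case 0
  show ?case by simp
next
  case (Suc k)
  note [measurable] = this
  show ?case
    unfolding picard.simps by measurable
qed

lemma borel_measurable_ode_solution:
  assumes [measurable]: "(\<lambda>(s, x). g s x) \<in> borel_measurable (borel \<Otimes>\<^sub>M borel)"
    "(\<lambda>(s, \<omega>). B s \<omega>) \<in> borel_measurable (borel \<Otimes>\<^sub>M N)"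
  shows "(\<lambda>(t, \<omega>). ode_solution g x (\<lambda>s. B s \<omega>) t) \<in> borel_measurable (borel \<Otimes>\<^sub>M N)"
proof -
  note [measurable] = borel_measurable_picard[OF assms, of x]
  show ?thesis
    unfolding ode_solution_def case_prod_beta
    by (intro borel_measurable_lim_metric) (auto simp: case_prod_beta'[symmetric])
qed

text \<open>The forcing is merely integrable in time, which is all that paths of the Volterra
  process provide. \<open>C\<close> is strictly positive because it becomes a Gronwall rate. No
  assumption mentions \<open>x\<close>, so the locale predicate does not take it and its facts hold
  for every initial value.\<close>

locale additive_ode =
  fixes T C x :: real and g :: "real \<Rightarrow> real \<Rightarrow> real" and \<beta> :: "real \<Rightarrow> real"
  assumes C_pos: "0 < C"
    and measurable_g [measurable]: "(\<lambda>(s, x). g s x) \<in> borel_measurable (borel \<Otimes>\<^sub>M borel)"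
    and measurable_noise [measurable]: "\<beta> \<in> borel_measurable borel"
    and integrable_noise: "set_integrable lborel {0..T} \<beta>"
    and growth: "\<And>s x. \<bar>g s x\<bar> \<le> C * (1 + \<bar>x\<bar>)"
begin

lemma integrable_drift:
  assumes [measurable]: "u \<in> borel_measurable borel" and D: "\<And>s. s \<in> {0..T} \<Longrightarrow> \<bar>u s\<bar> \<le> D"
  shows "set_integrable lborel {0..T} (\<lambda>s. g s (u s + \<beta> s))"
proof (rule set_integrable_bound)
  show "set_integrable lborel {0..T} (\<lambda>s. C * ((1 + D) + \<bar>\<beta> s\<bar>))"
    by (intro set_integrable_mult_right set_integral_add set_integrable_abs integrable_noise
      borel_integrable_atLeastAtMost') auto
  show "set_borel_measurable lborel {0..T} (\<lambda>s. g s (u s + \<beta> s))"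
    unfolding set_borel_measurable_def by measurable
  have "\<bar>g s (u s + \<beta> s)\<bar> \<le> \<bar>C * ((1 + D) + \<bar>\<beta> s\<bar>)\<bar>" if "s \<in> {0..T}" for s
  proof -
    have "\<bar>g s (u s + \<beta> s)\<bar> \<le> C * (1 + \<bar>u s + \<beta> s\<bar>)"
      by (rule growth)
    also have "\<dots> \<le> C * ((1 + D) + \<bar>\<beta> s\<bar>)"
      using D[OF that] C_pos by (intro mult_left_mono) auto
    finally show ?thesis by linarith
  qed
  then show "AE s in lborel. s \<in> {0..T} \<longrightarrow>
      norm (g s (u s + \<beta> s)) \<le> norm (C * ((1 + D) + \<bar>\<beta> s\<bar>))"
    by auto
qed

lemma integrable_growth: "set_integrable lborel {0..T} (\<lambda>s. C * (1 + \<bar>\<beta> s\<bar>))"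
  by (intro set_integrable_mult_right set_integral_add set_integrable_abs integrable_noise
      borel_integrable_atLeastAtMost') auto

text \<open>Linear growth alone gives a bound by Gronwall. No Lipschitz constant enters it, so it is
  uniform over approximating drifts whose Lipschitz constants blow up. The crude bound
  \<open>D\<close> only licenses \<open>gronwall\<close> and disappears from the conclusion.\<close>

lemma solution_bound:
  assumes [measurable]: "u \<in> borel_measurable borel" and D: "\<And>s. s \<in> {0..T} \<Longrightarrow> \<bar>u s\<bar> \<le> D"
    and eq: "\<And>t. t \<in> {0..T} \<Longrightarrow> u t = x + (LBINT s:{0..t}. g s (u s + \<beta> s))"
    and t: "t \<in> {0..T}"
  shows "\<bar>u t\<bar> \<le> 2 * (\<bar>x\<bar> + (LBINT s:{0..T}. C * (1 + \<bar>\<beta> s\<bar>))) * exp (2 * C * T)"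
    (is "_ \<le> 2 * ?A * _")
proof -
  have nn: "0 \<le> (LBINT s:{a..b}. C * (1 + \<bar>\<beta> s\<bar>))" for a b
    using C_pos by (auto simp: set_lebesgue_integral_def intro!: integral_nonneg_AE)
  have "\<bar>u t\<bar> \<le> 2 * ?A * exp (2 * C * t)"
  proof (rule gronwall[OF _ C_pos _ _ _ t, of "\<lambda>t. \<bar>u t\<bar>"])
    show "(\<lambda>t. \<bar>u t\<bar>) \<in> borel_measurable borel"
      by measurable
    show "0 \<le> ?A"
      using nn by (intro add_nonneg_nonneg) auto
    show "\<bar>u t\<bar> \<le> D" if "t \<in> {0..T}" for t
      using D[OF that] .
    show "\<bar>u t\<bar> \<le> ?A + C * (LBINT s:{0..t}. max 0 \<bar>u s\<bar>)" if t: "t \<in> {0..T}" for t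
    proof -
      have sub: "{0..t} \<subseteq> {0..T}"
        using t by auto
      have int: "set_integrable lborel {0..t} (\<lambda>s. g s (u s + \<beta> s))"
        using set_integrable_subset[OF integrable_drift[OF assms(1) D] _ sub] by simp
      have int\<beta>: "set_integrable lborel {0..t} (\<lambda>s. C * (1 + \<bar>\<beta> s\<bar>))"
        using set_integrable_subset[OF integrable_growth _ sub] by simp
      have intu: "set_integrable lborel {0..t} (\<lambda>s. max 0 \<bar>u s\<bar>)"
        using D sub by (intro set_integrable_Icc_bounded[of _ _ _ D]) auto
      have "\<bar>u t\<bar> \<le> \<bar>x\<bar> + \<bar>LBINT s:{0..t}. g s (u s + \<beta> s)\<bar>"
        using eq[OF t] by linarith
      also have "\<bar>LBINT s:{0..t}. g s (u s + \<beta> s)\<bar> \<le> (LBINT s:{0..t}. \<bar>g s (u s + \<beta> s)\<bar>)"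
        using set_integral_norm_bound[OF int] by simp
      also have "\<dots> \<le> (LBINT s:{0..t}. C * (1 + \<bar>\<beta> s\<bar>) + C * max 0 \<bar>u s\<bar>)"
      proof (intro int\<beta> intu int set_integral_mono set_integral_add set_integrable_mult_right
          set_integrable_abs)
        fix s
        have "\<bar>g s (u s + \<beta> s)\<bar> \<le> C * (1 + \<bar>u s + \<beta> s\<bar>)"
          by (rule growth)
        also have "\<dots> \<le> C * ((1 + \<bar>\<beta> s\<bar>) + max 0 \<bar>u s\<bar>)"
          using C_pos by (intro mult_left_mono) auto
        finally show "\<bar>g s (u s + \<beta> s)\<bar> \<le> C * (1 + \<bar>\<beta> s\<bar>) + C * max 0 \<bar>u s\<bar>"
          by (simp add: algebra_simps)
      qed
      also have "\<dots> = (LBINT s:{0..t}. C * (1 + \<bar>\<beta> s\<bar>)) + C * (LBINT s:{0..t}. max 0 \<bar>u s\<bar>)"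
        using set_integral_add(2)[OF int\<beta> set_integrable_mult_right, OF intu] by simp
      also have "(LBINT s:{0..t}. C * (1 + \<bar>\<beta> s\<bar>)) \<le> (LBINT s:{0..T}. C * (1 + \<bar>\<beta> s\<bar>))"
        using set_integral_Icc_combine[OF integrable_growth, of t] nn[of t T] t by simp
      finally show ?thesis by simp
    qed
  qed
  also have "\<dots> \<le> 2 * ?A * exp (2 * C * T)"
    using t C_pos nn[of 0 T] by (intro mult_left_mono) auto
  finally show ?thesis .
qed

end

locale lipschitz_additive_ode = additive_ode +
  fixes L :: real
  assumes T_nonneg: "0 \<le> T" and L_pos: "0 < L" and lipschitz: "\<And>s x y. \<bar>g s x - g s y\<bar> \<le> L * \<bar>x -
      y\<bar>"
begin

lemma drift_difference:
  assumes [measurable]: "u \<in> borel_measurable borel" "v \<in> borel_measurable borel"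
    and D: "\<And>s. s \<in> {0..T} \<Longrightarrow> \<bar>u s\<bar> \<le> D" and E: "\<And>s. s \<in> {0..T} \<Longrightarrow> \<bar>v s\<bar> \<le> E"
    and t: "t \<in> {0..T}"
  shows "\<bar>(LBINT s:{0..t}. g s (u s + \<beta> s)) - (LBINT s:{0..t}. g s (v s + \<beta> s))\<bar>
    \<le> L * (LBINT s:{0..t}. \<bar>u s - v s\<bar>)"
proof -
  have sub: "{0..t} \<subseteq> {0..T}"
    using t by auto
  have int: "set_integrable lborel {0..t} (\<lambda>s. g s (u s + \<beta> s))"
    "set_integrable lborel {0..t} (\<lambda>s. g s (v s + \<beta> s))"
    using sub by (auto intro: set_integrable_subset[OF integrable_drift] D E)
  have "\<bar>u s - v s\<bar> \<le> D + E" if "s \<in> {0..t}" for s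
    using that t D[of s] E[of s] by auto
  then have intd: "set_integrable lborel {0..t} (\<lambda>s. \<bar>u s - v s\<bar>)"
    by (intro set_integrable_Icc_bounded[of _ _ _ "D + E"]) auto
  have "\<bar>(LBINT s:{0..t}. g s (u s + \<beta> s)) - (LBINT s:{0..t}. g s (v s + \<beta> s))\<bar> =
      \<bar>LBINT s:{0..t}. g s (u s + \<beta> s) - g s (v s + \<beta> s)\<bar>"
    using int by simp
  also have "\<dots> \<le> (LBINT s:{0..t}. \<bar>g s (u s + \<beta> s) - g s (v s + \<beta> s)\<bar>)"
    using set_integral_norm_bound[OF set_integral_diff(1)[OF int]] by simp
  also have "\<dots> \<le> (LBINT s:{0..t}. L * \<bar>u s - v s\<bar>)"
  proof (intro int intd set_integral_mono set_integrable_abs set_integral_diff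
      set_integrable_mult_right)
    show "\<bar>g s (u s + \<beta> s) - g s (v s + \<beta> s)\<bar> \<le> L * \<bar>u s - v s\<bar>" for s
      using lipschitz[of s "u s + \<beta> s" "v s + \<beta> s"] by simp
  qed
  finally show ?thesis by simp
qed

lemma measurable_picard [measurable]: "picard g x \<beta> k \<in> borel_measurable borel"
  by (induction k) auto

lemma picard_bounded: "\<exists>D. \<forall>t\<in>{0..T}. \<bar>picard g x \<beta> k t\<bar> \<le> D"
proof (induction k)
  case 0
  show ?case by auto
next
  case (Suc k)
  then obtain D where "\<And>t. t \<in> {0..T} \<Longrightarrow> \<bar>picard g x \<beta> k t\<bar> \<le> D"
    by blast
  then have "continuous_on {0..T} (picard g x \<beta> (Suc k))"
    unfolding picard.simps
    by (intro continuous_intros continuous_on_set_integral integrable_drift) auto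
  from bounded_on_Icc[OF this] show ?case .
qed

text \<open>Every Picard step gains a factor 1/2 in the weighted norm of
  \<open>exp_weighted_integral_le\<close>; the factor \<open>exp (2 * L * T)\<close> in the witness
  for \<open>E\<close> is the price of returning to the plain supremum.\<close>

lemma picard_increment:
  obtains E where "0 \<le> E"
    and "\<And>k t. t \<in> {0..T} \<Longrightarrow> \<bar>picard g x \<beta> (Suc k) t - picard g x \<beta> k t\<bar> \<le> E / 2 ^ k"
proof -
  from picard_bounded[of 1] obtain D where D: "\<And>t. t \<in> {0..T} \<Longrightarrow> \<bar>picard g x \<beta> 1 t\<bar> \<le> D"
    by blast
  have "0 \<le> D"
    using D[of 0] T_nonneg by auto
  define F where "F = D + \<bar>x\<bar>"
  have F: "0 \<le> F"
    using \<open>0 \<le> D\<close> by (simp add: F_def)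
  have iter: "\<bar>picard g x \<beta> (Suc k) t - picard g x \<beta> k t\<bar> \<le> F / 2 ^ k * exp (2 * L * t)"
    if "t \<in> {0..T}" for k t
    using that
  proof (induction k arbitrary: t)
    case 0
    have "\<bar>picard g x \<beta> 1 t - x\<bar> \<le> F * 1"
      using D[OF 0] unfolding F_def by (simp del: picard.simps)
    also have "\<dots> \<le> F * exp (2 * L * t)"
      using F L_pos 0 by (intro mult_left_mono) auto
    finally show ?case by simp
  next
    case (Suc k)
    obtain D1 D2 where D12: "\<And>t. t \<in> {0..T} \<Longrightarrow> \<bar>picard g x \<beta> (Suc k) t\<bar> \<le> D1"
      "\<And>t. t \<in> {0..T} \<Longrightarrow> \<bar>picard g x \<beta> k t\<bar> \<le> D2"
      using picard_bounded[of "Suc k"] picard_bounded[of k] by blast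
    have "\<bar>picard g x \<beta> (Suc (Suc k)) t - picard g x \<beta> (Suc k) t\<bar>
        \<le> L * (LBINT s:{0..t}. \<bar>picard g x \<beta> (Suc k) s - picard g x \<beta> k s\<bar>)"
      using drift_difference[OF measurable_picard measurable_picard D12 Suc.prems] by simp
    also have "\<dots> \<le> F / 2 ^ k / 2 * exp (2 * L * t)"
    proof (rule exp_weighted_integral_le)
      show "0 \<le> \<bar>picard g x \<beta> (Suc k) s - picard g x \<beta> k s\<bar> \<and>
          \<bar>picard g x \<beta> (Suc k) s - picard g x \<beta> k s\<bar> \<le> F / 2 ^ k * exp (2 * L * s)"
        if "s \<in> {0..t}" for s
        using Suc.IH[of s] Suc.prems that by auto
    qed (use Suc.prems L_pos in auto)
    finally show ?case
      by (simp add: field_simps)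
  qed
  show thesis
  proof (rule that[of "F * exp (2 * L * T)"])
    show "0 \<le> F * exp (2 * L * T)"
      using F by simp
    show "\<bar>picard g x \<beta> (Suc k) t - picard g x \<beta> k t\<bar> \<le> F * exp (2 * L * T) / 2 ^ k"
      if "t \<in> {0..T}" for k t
    proof -
      have "F / 2 ^ k * exp (2 * L * t) \<le> F / 2 ^ k * exp (2 * L * T)"
        using that L_pos F by (intro mult_left_mono) auto
      with iter[OF that, of k] show ?thesis by simp
    qed
  qed
qed

lemma picard_uniform_limit:
  obtains E where "0 \<le> E"
    and "\<And>k t. t \<in> {0..T} \<Longrightarrow> \<bar>ode_solution g x \<beta> t - picard g x \<beta> k t\<bar> \<le> E / 2 ^ k"
proof -
  obtain E where E: "0 \<le> E"
    "\<And>k t. t \<in> {0..T} \<Longrightarrow> \<bar>picard g x \<beta> (Suc k) t - picard g x \<beta> k t\<bar> \<le> E / 2 ^ k"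
    by (rule picard_increment) (rule that)
  \<comment> \<open>The right-hand side is the exact value of the partial geometric sum; with the
    weaker bound \<open>2 * E / 2 ^ k\<close> the induction on \<open>j\<close> would not
    close.\<close>
  have tail: "\<bar>picard g x \<beta> (k + j) t - picard g x \<beta> k t\<bar> \<le> 2 * E / 2 ^ k - 2 * E / 2 ^ (k + j)"
    if t: "t \<in> {0..T}" for k j t
  proof (induction j)
    case 0
    show ?case by simp
  next
    case (Suc j)
    have "2 * E / 2 ^ (k + j) - 2 * E / 2 ^ (k + Suc j) = E / 2 ^ (k + j)"
      by (simp add: field_simps)
    then show ?case
      using Suc E(2)[OF t, of "k + j"] unfolding add_Suc_right by linarith
  qed
  have lim: "(\<lambda>k. picard g x \<beta> k t) \<longlonglongrightarrow> ode_solution g x \<beta> t" if t: "t \<in> {0..T}" for t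
  proof -
    have "summable (\<lambda>k. picard g x \<beta> (Suc k) t - picard g x \<beta> k t)"
    proof (rule summable_comparison_test')
      show "summable (\<lambda>k. E * (1 / 2) ^ k)"
        by (intro summable_mult summable_geometric) auto
      show "norm (picard g x \<beta> (Suc k) t - picard g x \<beta> k t) \<le> E * (1 / 2) ^ k" if "0 \<le> k" for k
        using E(2)[OF t, of k] by (simp add: power_one_over del: picard.simps)
    qed
    then have "convergent (\<lambda>k. picard g x \<beta> k t)"
      unfolding summable_iff_convergent sum_lessThan_telescope[of "\<lambda>k. picard g x \<beta> k t"]
      by (simp add: convergent_diff_const_right_iff)
    then show ?thesis
      unfolding ode_solution_def by (simp add: convergent_LIMSEQ_iff)
  qed
  show thesis
  proof (rule that[of "2 * E"])
    show "\<bar>ode_solution g x \<beta> t - picard g x \<beta> k t\<bar> \<le> 2 * E / 2 ^ k" if t: "t \<in> {0..T}" for k t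
    proof (rule LIMSEQ_le_const2)
      show "(\<lambda>j. \<bar>picard g x \<beta> (k + j) t - picard g x \<beta> k t\<bar>) \<longlonglongrightarrow>
          \<bar>ode_solution g x \<beta> t - picard g x \<beta> k t\<bar>"
        using LIMSEQ_ignore_initial_segment[OF lim[OF t], of k]
        by (intro tendsto_intros) (simp add: add.commute)
      have "\<bar>picard g x \<beta> (k + j) t - picard g x \<beta> k t\<bar> \<le> 2 * E / 2 ^ k" for j
        using order_trans[OF tail[OF t, of k j], of "2 * E / 2 ^ k"] E(1) by simp
      then show "\<exists>N. \<forall>n\<ge>N. \<bar>picard g x \<beta> (k + n) t - picard g x \<beta> k t\<bar> \<le> 2 * E / 2 ^ k"
        by blast
    qed
  qed (use E in auto)
qed

lemma measurable_ode_solution [measurable]: "ode_solution g x \<beta> \<in> borel_measurable borel"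
  unfolding ode_solution_def[abs_def] by (intro borel_measurable_lim_metric measurable_picard)

lemma ode_solution_bounded: "\<exists>D. \<forall>t\<in>{0..T}. \<bar>ode_solution g x \<beta> t\<bar> \<le> D"
proof -
  obtain E where "0 \<le> E"
    and E: "\<And>k t. t \<in> {0..T} \<Longrightarrow> \<bar>ode_solution g x \<beta> t - picard g x \<beta> k t\<bar> \<le> E / 2 ^ k"
    by (rule picard_uniform_limit) (rule that)
  have "\<bar>ode_solution g x \<beta> t\<bar> \<le> E + \<bar>x\<bar>" if "t \<in> {0..T}" for t
  proof -
    have "\<bar>ode_solution g x \<beta> t - x\<bar> \<le> E"
      using E[OF that, of 0] by simp
    then show ?thesis by linarith
  qed
  then show ?thesis by blast
qed

lemma ode_solution_integrable:
  "set_integrable lborel {0..T} (\<lambda>s. g s (ode_solution g x \<beta> s + \<beta> s))"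
  using ode_solution_bounded integrable_drift[OF measurable_ode_solution] by blast

text \<open>Both sides are compared with the iterate \<open>Suc k\<close>: the left one by uniform
  convergence, the right one by the Lipschitz bound under the integral. Together the error is at
  most \<open>(1 + L * T) * E / 2 ^ k\<close>.\<close>

lemma ode_solution:
  assumes t: "t \<in> {0..T}"
  shows "ode_solution g x \<beta> t = x + (LBINT s:{0..t}. g s (ode_solution g x \<beta> s + \<beta> s))"
proof -
  let ?y = "ode_solution g x \<beta>"
  obtain E where E: "0 \<le> E" "\<And>k t. t \<in> {0..T} \<Longrightarrow> \<bar>?y t - picard g x \<beta> k t\<bar> \<le> E / 2 ^ k"
    by (rule picard_uniform_limit) (rule that)
  have "\<bar>?y t - (x + (LBINT s:{0..t}. g s (?y s + \<beta> s)))\<bar> \<le> (1 + L * T) * E / 2 ^ k" for k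
  proof -
    obtain D1 D2 where D12: "\<And>t. t \<in> {0..T} \<Longrightarrow> \<bar>picard g x \<beta> k t\<bar> \<le> D1"
      "\<And>t. t \<in> {0..T} \<Longrightarrow> \<bar>?y t\<bar> \<le> D2"
      using picard_bounded[of k] ode_solution_bounded by blast
    have "\<bar>picard g x \<beta> (Suc k) t - (x + (LBINT s:{0..t}. g s (?y s + \<beta> s)))\<bar>
        \<le> L * (LBINT s:{0..t}. \<bar>picard g x \<beta> k s - ?y s\<bar>)"
      using drift_difference[OF measurable_picard measurable_ode_solution D12 t] by simp
    also have "\<dots> \<le> L * (LBINT s:{0..t}. E / 2 ^ k)"
    proof (intro mult_left_mono set_integral_mono set_integrable_Icc_bounded)
      show "\<bar>picard g x \<beta> k s - ?y s\<bar> \<le> E / 2 ^ k" "\<bar>\<bar>picard g x \<beta> k s - ?y s\<bar>\<bar> \<le> E / 2 ^ k"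
        if "s \<in> {0..t}" for s
        using E(2)[of s k] that t by (auto simp: abs_minus_commute)
    qed (use L_pos in auto)
    also have "\<dots> = L * (t * (E / 2 ^ k))"
      using t by (simp add: set_lebesgue_integral_def)
    also have "\<dots> \<le> L * (T * (E / 2 ^ k))"
      using t L_pos E by (intro mult_left_mono mult_right_mono) auto
    finally have "\<bar>picard g x \<beta> (Suc k) t - (x + (LBINT s:{0..t}. g s (?y s + \<beta> s)))\<bar> \<le> L * T * (E
        / 2 ^ k)"
      by (simp add: mult.assoc)
    moreover have "\<bar>?y t - picard g x \<beta> (Suc k) t\<bar> \<le> E / 2 ^ k"
    proof -
      have "E / 2 ^ Suc k \<le> E / 2 ^ k"
        using E(1) by (intro divide_left_mono) auto
      with E(2)[OF t, of "Suc k"] show ?thesis by linarith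
    qed
    ultimately have "\<bar>?y t - (x + (LBINT s:{0..t}. g s (?y s + \<beta> s)))\<bar> \<le> E / 2 ^ k + L * T * (E /
        2 ^ k)"
      by linarith
    then show ?thesis
      by (simp add: field_simps)
  qed
  moreover have "(\<lambda>k. (1 + L * T) * E / 2 ^ k) \<longlonglongrightarrow> 0"
    by (intro LIMSEQ_divide_realpow_zero) auto
  ultimately have "\<bar>?y t - (x + (LBINT s:{0..t}. g s (?y s + \<beta> s)))\<bar> \<le> 0"
    by (intro LIMSEQ_le_const) auto
  then show ?thesis by simp
qed

lemma ode_solution_bound:
  assumes "t \<in> {0..T}"
  shows "\<bar>ode_solution g x \<beta> t\<bar>
    \<le> 2 * (\<bar>x\<bar> + (LBINT s:{0..T}. C * (1 + \<bar>\<beta> s\<bar>))) * exp (2 * C * T)"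
proof -
  obtain D where "\<And>t. t \<in> {0..T} \<Longrightarrow> \<bar>ode_solution g x \<beta> t\<bar> \<le> D"
    using ode_solution_bounded by blast
  then show ?thesis
    using assms by (intro solution_bound ode_solution) auto
qed

end

text \<open>To fit \<open>comparison\<close>, first replace \<open>g\<^sub>1\<close> by the larger
  \<open>g\<^sub>2\<close> at the point of the first solution, then use that
  \<open>g\<^sub>2\<close> is Lipschitz.\<close>

lemma ode_solution_mono:
  assumes 1: "lipschitz_additive_ode T C g\<^sub>1 \<beta> L\<^sub>1" and 2: "lipschitz_additive_ode T C g\<^sub>2 \<beta> L\<^sub>2"
    and le: "\<And>s x. g\<^sub>1 s x \<le> g\<^sub>2 s x" and t: "t \<in> {0..T}"
  shows "ode_solution g\<^sub>1 x \<beta> t \<le> ode_solution g\<^sub>2 x \<beta> t"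
proof -
  interpret i1: lipschitz_additive_ode T C x g\<^sub>1 \<beta> L\<^sub>1 by (rule 1)
  interpret i2: lipschitz_additive_ode T C x g\<^sub>2 \<beta> L\<^sub>2 by (rule 2)
  show ?thesis
  proof (rule comparison[OF i1.measurable_ode_solution i2.measurable_ode_solution
        i1.ode_solution_integrable i2.ode_solution_integrable i1.ode_solution i2.ode_solution
        i2.L_pos _ t])
    fix s
    let ?y1 = "ode_solution g\<^sub>1 x \<beta> s" and ?y2 = "ode_solution g\<^sub>2 x \<beta> s"
    assume "?y2 < ?y1"
    then show "g\<^sub>1 s (?y1 + \<beta> s) - g\<^sub>2 s (?y2 + \<beta> s) \<le> L\<^sub>2 * (?y1 - ?y2)"
      using le[of s "?y1 + \<beta> s"] i2.lipschitz[of s "?y1 + \<beta> s" "?y2 + \<beta> s"] by simp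
  qed
qed

section \<open>Sup-convolutions and drifts without Lipschitz regularity\<close>

text \<open>The Pasch-Hausdorff envelope: when finite, it is the least \<open>L\<close>-Lipschitz
  function that dominates \<open>f\<close> on \<open>D\<close>. Off \<open>D\<close> it may lie
  below \<open>f\<close> at a discontinuity, so convergence to \<open>f\<close> can be expected at
  continuity points only.\<close>

definition sup_conv :: "real set \<Rightarrow> real \<Rightarrow> (real \<Rightarrow> real) \<Rightarrow> real \<Rightarrow> real" where
  "sup_conv D L f x = (SUP y\<in>D. f y - L * \<bar>x - y\<bar>)"

locale sup_convolution =
  fixes D :: "real set" and f :: "real \<Rightarrow> real" and C :: real
  assumes dense: "\<And>x e. 0 < e \<Longrightarrow> \<exists>y\<in>D. \<bar>x - y\<bar> < e"
    and growth: "\<And>x. \<bar>f x\<bar> \<le> C * (1 + \<bar>x\<bar>)"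
begin

lemma C_nonneg: "0 \<le> C"
  using growth[of 0] by simp

lemma nonempty: "D \<noteq> {}"
  using dense[of 1] by auto

text \<open>The slope \<open>L\<close> of the penalty beats the growth rate \<open>C\<close> with
  surplus \<open>L - C\<close>. For \<open>C \<le> L\<close> this makes the supremum finite; for
  large \<open>L\<close> it makes points \<open>y\<close> far from \<open>x\<close>
  irrelevant.\<close>

lemma penalized_le: "f y - L * \<bar>x - y\<bar> \<le> C * (1 + \<bar>x\<bar>) - (L - C) * \<bar>x - y\<bar>"
proof -
  have "f y \<le> C * (1 + \<bar>y\<bar>)"
    using growth[of y] by linarith
  also have "\<dots> \<le> C * ((1 + \<bar>x\<bar>) + \<bar>x - y\<bar>)"
    using C_nonneg by (intro mult_left_mono) auto
  finally show ?thesis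
    by (simp add: algebra_simps)
qed

lemma penalized_le_growth: "C \<le> L \<Longrightarrow> f y - L * \<bar>x - y\<bar> \<le> C * (1 + \<bar>x\<bar>)"
  by (rule order_trans[OF penalized_le]) simp

lemma bdd_above_penalized: "C \<le> L \<Longrightarrow> bdd_above ((\<lambda>y. f y - L * \<bar>x - y\<bar>) ` D)"
  using penalized_le_growth by (auto intro!: bdd_aboveI[of _ "C * (1 + \<bar>x\<bar>)"])

lemma sup_conv_upper: "C \<le> L \<Longrightarrow> y \<in> D \<Longrightarrow> f y - L * \<bar>x - y\<bar> \<le> sup_conv D L f x"
  unfolding sup_conv_def by (intro cSUP_upper bdd_above_penalized)

lemma sup_conv_least: "(\<And>y. y \<in> D \<Longrightarrow> f y - L * \<bar>x - y\<bar> \<le> u) \<Longrightarrow> sup_conv D L f x \<le> u"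
  unfolding sup_conv_def by (intro cSUP_least nonempty)

text \<open>The constant \<open>C\<close> is inherited unchanged, which keeps
  \<open>solution_bound\<close> uniform over the approximations. For the lower bound
  \<open>x\<close> need not lie in \<open>D\<close>, so a nearby \<open>y\<close> is used with the
  growth bound at \<open>y\<close>; moving back to \<open>x\<close> costs
  \<open>(C + L) * \<bar>x - y\<bar>\<close>, and the extra 1 in the denominator only keeps it
  positive.\<close>

lemma sup_conv_growth:
  assumes "C \<le> L"
  shows "\<bar>sup_conv D L f x\<bar> \<le> C * (1 + \<bar>x\<bar>)"
proof -
  have "- C * (1 + \<bar>x\<bar>) - e \<le> sup_conv D L f x" if e: "0 < e" for e
  proof -
    have *: "0 < C + L + 1"
      using C_nonneg assms by auto
    obtain y where y: "y \<in> D" "\<bar>x - y\<bar> < e / (C + L + 1)"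
      using dense[of "e / (C + L + 1)" x] e * by auto
    have "(C + L) * \<bar>x - y\<bar> \<le> (C + L + 1) * \<bar>x - y\<bar>"
      by (intro mult_right_mono) auto
    also have "\<dots> \<le> e"
      using y(2) * by (simp add: field_simps)
    finally have "C * \<bar>x - y\<bar> + L * \<bar>x - y\<bar> \<le> e"
      by (simp add: algebra_simps)
    moreover have "C * (1 + \<bar>y\<bar>) \<le> C * ((1 + \<bar>x\<bar>) + \<bar>x - y\<bar>)"
      using C_nonneg by (intro mult_left_mono) auto
    then have "C * (1 + \<bar>y\<bar>) \<le> C * (1 + \<bar>x\<bar>) + C * \<bar>x - y\<bar>"
      by (simp add: algebra_simps)
    moreover have "- (C * (1 + \<bar>y\<bar>)) \<le> f y"
      using growth[of y] by linarith
    ultimately show ?thesis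
      using sup_conv_upper[OF assms y(1), of x] by simp
  qed
  then have "- C * (1 + \<bar>x\<bar>) \<le> sup_conv D L f x"
    by (meson diff_le_eq field_le_epsilon)
  moreover have "sup_conv D L f x \<le> C * (1 + \<bar>x\<bar>)"
    by (intro sup_conv_least penalized_le_growth assms)
  ultimately show ?thesis
    by (simp add: abs_le_iff)
qed

lemma sup_conv_lipschitz:
  assumes "C \<le> L"
  shows "\<bar>sup_conv D L f x - sup_conv D L f x'\<bar> \<le> L * \<bar>x - x'\<bar>"
proof -
  have "sup_conv D L f x \<le> sup_conv D L f x' + L * \<bar>x - x'\<bar>" for x x'
  proof (rule sup_conv_least)
    fix y assume y: "y \<in> D"
    have "L * \<bar>x' - y\<bar> \<le> L * (\<bar>x - y\<bar> + \<bar>x - x'\<bar>)"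
      using C_nonneg assms by (intro mult_left_mono) auto
    with sup_conv_upper[OF assms y, of x']
    show "f y - L * \<bar>x - y\<bar> \<le> sup_conv D L f x' + L * \<bar>x - x'\<bar>"
      by (simp add: distrib_left)
  qed
  from this[of x x'] this[of x' x] show ?thesis
    by (auto simp: abs_minus_commute abs_le_iff)
qed

lemma sup_conv_antimono:
  assumes "C \<le> L" and "L \<le> L'"
  shows "sup_conv D L' f x \<le> sup_conv D L f x"
proof (rule sup_conv_least)
  fix y assume "y \<in> D"
  then show "f y - L' * \<bar>x - y\<bar> \<le> sup_conv D L f x"
    using sup_conv_upper[OF assms(1), of y x] mult_right_mono[OF assms(2), of "\<bar>x - y\<bar>"] by simp
qed

text \<open>The argument moves along with the slope, since in the equation the envelope with slope
  \<open>L n\<close> is evaluated at the \<open>n\<close>-th approximate solution and not at the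
  limit.\<close>

lemma sup_conv_tendsto:
  assumes cont: "isCont f x" and x: "X \<longlonglongrightarrow> x" and L: "filterlim L at_top sequentially"
    and CL: "\<And>n. C \<le> L n"
  shows "(\<lambda>n. sup_conv D (L n) f (X n)) \<longlonglongrightarrow> f x"
proof (rule LIMSEQ_I)
  fix r :: real assume "0 < r"
  define e where "e = r / 3"
  have e: "0 < e"
    using \<open>0 < r\<close> by (simp add: e_def)
  obtain d where d: "0 < d" "\<And>y. \<bar>y - x\<bar> < d \<Longrightarrow> \<bar>f y - f x\<bar> < e"
    using cont e unfolding continuous_at_eps_delta dist_real_def by blast
  have "\<forall>\<^sub>F n in sequentially. \<bar>X n - x\<bar> < d / 2"
    using x d(1) by (auto simp: tendsto_iff dist_real_def dest: spec[of _ "d / 2"])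
  \<comment> \<open>The threshold is what results from solving \<open>C * (1 + (\<bar>x\<bar> + d))
    - (L n - C) * (d / 2) \<le> f x\<close> for \<open>L n\<close>: beyond it, points at distance at
    least \<open>d\<close> from \<open>x\<close> cannot raise the supremum above
    \<open>f x\<close>.\<close>
  moreover have "\<forall>\<^sub>F n in sequentially. C + 2 / d * (C * (1 + (\<bar>x\<bar> + d)) - f x) \<le> L n"
    using L by (simp add: filterlim_at_top)
  moreover have "\<forall>\<^sub>F n in sequentially. 1 \<le> L n"
    using L by (simp add: filterlim_at_top)
  ultimately have "\<forall>\<^sub>F n in sequentially. \<bar>sup_conv D (L n) f (X n) - f x\<bar> < r"
  proof eventually_elim
    case (elim n)
    have "sup_conv D (L n) f (X n) \<le> f x + e"
    proof (rule sup_conv_least)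
      fix y assume "y \<in> D"
      show "f y - L n * \<bar>X n - y\<bar> \<le> f x + e"
      proof (cases "\<bar>y - x\<bar> < d")
        case True
        have "0 \<le> L n * \<bar>X n - y\<bar>"
          using elim(3) by simp
        then show ?thesis
          using d(2)[OF True] by linarith
      next
        case False
        have "f y - L n * \<bar>X n - y\<bar> \<le> C * (1 + \<bar>X n\<bar>) - (L n - C) * \<bar>X n - y\<bar>"
          by (rule penalized_le)
        also have "\<dots> \<le> C * (1 + (\<bar>x\<bar> + d)) - (L n - C) * (d / 2)"
          using False elim(1) C_nonneg CL[of n] d(1)
          by (intro diff_mono mult_left_mono) (auto simp: abs_if split: if_splits)
        also have "\<dots> \<le> f x"
          using elim(2) d(1) by (simp add: field_simps)
        finally show ?thesis
          using e by simp
      qed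
    qed
    moreover have "f x - 2 * e \<le> sup_conv D (L n) f (X n)"
    proof -
      \<comment> \<open>\<open>d / 2\<close> keeps \<open>y\<close> within \<open>d\<close> of
        \<open>x\<close>, where \<open>f\<close> is close to \<open>f x\<close>;
        \<open>e / L n\<close> keeps the penalty below \<open>e\<close>.\<close>
      obtain y where y: "y \<in> D" "\<bar>X n - y\<bar> < min (d / 2) (e / L n)"
        using dense[of "min (d / 2) (e / L n)" "X n"] d(1) e elim(3) by auto
      have "\<bar>f y - f x\<bar> < e"
        using y(2) elim(1) by (intro d(2)) (simp add: abs_if field_simps split: if_splits)
      moreover have "L n * \<bar>X n - y\<bar> \<le> e"
        using y(2) elim(3) by (simp add: field_simps)
      ultimately show ?thesis
        using sup_conv_upper[OF CL y(1), of n "X n"] by linarith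
    qed
    ultimately show ?case
      using e unfolding e_def by (simp add: abs_less_iff)
  qed
  then show "\<exists>no. \<forall>n\<ge>no. norm (sup_conv D (L n) f (X n) - f x) < r"
    by (simp add: eventually_sequentially)
qed

end

section \<open>Monotone approximation of an irregular drift\<close>

lemma borel_measurable_sup_conv:
  assumes [measurable]: "(\<lambda>(s, x). f s x) \<in> borel_measurable (borel \<Otimes>\<^sub>M borel)"
    and "countable D" and "C \<le> L" and "\<And>s. sup_convolution D (f s) C"
  shows "(\<lambda>(s, x). sup_conv D L (f s) x) \<in> borel_measurable (borel \<Otimes>\<^sub>M borel)"
  unfolding sup_conv_def case_prod_beta
proof (rule borel_measurable_cSUP[OF \<open>countable D\<close>])
  show "bdd_above ((\<lambda>y. f (fst z) y - L * \<bar>snd z - y\<bar>) ` D)" for z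
    using assms by (intro sup_convolution.bdd_above_penalized)
qed measurable

text \<open>The slopes start at \<open>C\<close> because from there on linear growth guarantees that
  the envelopes are finite. As before, \<open>lim\<close> is total, so measurability needs no
  convergence.\<close>

definition upper_solution ::
    "real \<Rightarrow> real set \<Rightarrow> (real \<Rightarrow> real \<Rightarrow> real) \<Rightarrow> real \<Rightarrow> (real \<Rightarrow> real) \<Rightarrow> real \<Rightarrow> real" where
  "upper_solution C D f x \<beta> t =
     lim (\<lambda>n. ode_solution (\<lambda>s. sup_conv D (C + real n) (f s)) x \<beta> t)"

locale irregular_additive_ode = additive_ode T C x f \<beta>
  for T C x :: real and f :: "real \<Rightarrow> real \<Rightarrow> real" and \<beta> :: "real \<Rightarrow> real" +
  fixes D :: "real set"
  assumes T_nonneg: "0 \<le> T" and countable_D: "countable D"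
    and dense_D: "\<And>x e. 0 < e \<Longrightarrow> \<exists>y\<in>D. \<bar>x - y\<bar> < e"
begin

lemma sup_convolution: "sup_convolution D (f s) C"
  using dense_D growth by unfold_locales

abbreviation "approx n \<equiv> ode_solution (\<lambda>s. sup_conv D (C + real n) (f s)) x \<beta>"

abbreviation "radius \<equiv> 2 * (\<bar>x\<bar> + (LBINT s:{0..T}. C * (1 + \<bar>\<beta> s\<bar>))) * exp (2 * C * T)"

lemma approx_ode:
  "lipschitz_additive_ode T C (\<lambda>s. sup_conv D (C + real n) (f s)) \<beta> (C + real n)"
proof
  show "(\<lambda>(s, x). sup_conv D (C + real n) (f s) x) \<in> borel_measurable (borel \<Otimes>\<^sub>M borel)"
    by (rule borel_measurable_sup_conv[OF measurable_g countable_D _ sup_convolution]) simp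
  show "0 < C + real n"
    using C_pos by simp
qed (use C_pos integrable_noise T_nonneg sup_convolution.sup_conv_growth[OF sup_convolution]
  sup_convolution.sup_conv_lipschitz[OF sup_convolution] in auto)

lemma approx_decseq:
  assumes "t \<in> {0..T}"
  shows "decseq (\<lambda>n. approx n t)"
proof (rule decseq_SucI)
  show "approx (Suc n) t \<le> approx n t" for n
  proof (rule ode_solution_mono[OF approx_ode approx_ode _ assms])
    show "sup_conv D (C + real (Suc n)) (f s) x \<le> sup_conv D (C + real n) (f s) x" for s x
      by (rule sup_convolution.sup_conv_antimono[OF sup_convolution]) auto
  qed
qed

lemma approx_bound: "t \<in> {0..T} \<Longrightarrow> \<bar>approx n t\<bar> \<le> radius"
  by (rule lipschitz_additive_ode.ode_solution_bound[OF approx_ode])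

lemma approx_tendsto:
  assumes t: "t \<in> {0..T}"
  shows "(\<lambda>n. approx n t) \<longlonglongrightarrow> upper_solution C D f x \<beta> t"
proof -
  have "convergent (\<lambda>n. approx n t)"
  proof (rule Bseq_monoseq_convergent)
    show "Bseq (\<lambda>n. approx n t)"
      by (rule BseqI'[of _ radius]) (simp only: real_norm_def approx_bound[OF t])
    show "monoseq (\<lambda>n. approx n t)"
      by (rule decseq_imp_monoseq[OF approx_decseq[OF t]])
  qed
  then show ?thesis
    unfolding upper_solution_def by (simp add: convergent_LIMSEQ_iff)
qed

lemma upper_solution_bound:
  assumes t: "t \<in> {0..T}"
  shows "\<bar>upper_solution C D f x \<beta> t\<bar> \<le> radius"
  by (rule LIMSEQ_le_const2[OF tendsto_rabs[OF approx_tendsto[OF t]]]) (use approx_bound[OF t] in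
      blast)

lemma integrable_majorant: "set_integrable lborel {0..T} (\<lambda>s. C * (1 + (radius + \<bar>\<beta> s\<bar>)))"
  by (intro set_integrable_mult_right set_integral_add set_integrable_abs integrable_noise
      borel_integrable_atLeastAtMost') auto

lemma approx_drift_le:
  assumes s: "s \<in> {0..T}"
  shows "\<bar>sup_conv D (C + real n) (f s) (approx n s + \<beta> s)\<bar> \<le> C * (1 + (radius + \<bar>\<beta> s\<bar>))"
proof -
  have "\<bar>sup_conv D (C + real n) (f s) (approx n s + \<beta> s)\<bar> \<le> C * (1 + \<bar>approx n s + \<beta> s\<bar>)"
    by (rule sup_convolution.sup_conv_growth[OF sup_convolution]) simp
  also have "\<dots> \<le> C * (1 + (radius + \<bar>\<beta> s\<bar>))"
    using approx_bound[OF s, of n] abs_triangle_ineq[of "approx n s" "\<beta> s"] C_pos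
    by (intro mult_left_mono) linarith+
  finally show ?thesis .
qed

text \<open>The bound holds for every approximation with the same majorant and so passes to the
  pointwise limit. No continuity of \<open>f\<close> is involved: the bound is available before the
  limit is known to solve the equation, and the estimate of the time spent at a level depends on
  that.\<close>

lemma upper_solution_increment:
  assumes "0 \<le> r" and "r \<le> t" and "t \<le> T"
  shows "\<bar>upper_solution C D f x \<beta> t - upper_solution C D f x \<beta> r\<bar>
    \<le> (LBINT s:{r..t}. C * (1 + (radius + \<bar>\<beta> s\<bar>)))"
proof -
  have t: "t \<in> {0..T}" and r: "r \<in> {0..T}"
    using assms by auto
  have "\<bar>approx n t - approx n r\<bar> \<le> (LBINT s:{r..t}. C * (1 + (radius + \<bar>\<beta> s\<bar>)))" for n
  proof -
    note sol = lipschitz_additive_ode.ode_solution[OF approx_ode[of n]]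
    let ?h = "\<lambda>s. sup_conv D (C + real n) (f s) (approx n s + \<beta> s)"
    have int: "set_integrable lborel {0..t} ?h" "set_integrable lborel {r..t} ?h"
      by (rule set_integrable_subset[OF lipschitz_additive_ode.ode_solution_integrable[OF
          approx_ode]]; use assms in auto)+
    have maj: "set_integrable lborel {r..t} (\<lambda>s. C * (1 + (radius + \<bar>\<beta> s\<bar>)))"
      using assms by (intro set_integrable_subset[OF integrable_majorant]) auto
    have eq: "approx n t - approx n r = (LBINT s:{r..t}. ?h s)"
    proof -
      have arith: "a = x + p \<Longrightarrow> b = x + q \<Longrightarrow> p = q + c \<Longrightarrow> a - b = c" for a b c p q :: real
        by simp
      show ?thesis
        by (rule arith[OF sol[OF t] sol[OF r] set_integral_Icc_combine[OF int(1) assms(1,2)]])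
    qed
    have "(LBINT s:{r..t}. \<bar>?h s\<bar>) \<le> (LBINT s:{r..t}. C * (1 + (radius + \<bar>\<beta> s\<bar>)))"
    proof (rule set_integral_mono[OF set_integrable_abs[OF int(2)] maj])
      show "\<bar>?h s\<bar> \<le> C * (1 + (radius + \<bar>\<beta> s\<bar>))" if "s \<in> {r..t}" for s
        using that assms by (intro approx_drift_le) simp
    qed
    then show ?thesis
      unfolding eq by (rule order_trans[OF set_integral_norm_bound[OF int(2), unfolded
          real_norm_def]])
  qed
  then have "\<exists>N. \<forall>n\<ge>N. \<bar>approx n t - approx n r\<bar> \<le> (LBINT s:{r..t}. C * (1 + (radius + \<bar>\<beta> s\<bar>)))"
    by simp
  then show ?thesis
    by (rule LIMSEQ_le_const2[OF tendsto_rabs[OF tendsto_diff[OF approx_tendsto[OF t]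
      approx_tendsto[OF r]]]])
qed

lemma measurable_upper_solution [measurable]: "upper_solution C D f x \<beta> \<in> borel_measurable borel"
  unfolding upper_solution_def[abs_def]
proof (rule borel_measurable_lim_metric)
  show "approx n \<in> borel_measurable borel" for n
    by (rule lipschitz_additive_ode.measurable_ode_solution[OF approx_ode])
qed

lemma upper_solution_integrable:
  "set_integrable lborel {0..T} (\<lambda>s. f s (upper_solution C D f x \<beta> s + \<beta> s))"
  by (rule integrable_drift[OF measurable_upper_solution upper_solution_bound])

text \<open>This is where continuity of the drift in \<open>x\<close> enters:
  \<open>sup_conv_tendsto\<close> gives the limit of the integrands at almost every time, and the
  common growth bound dominates them.\<close>

lemma upper_solution_solves:
  assumes ae: "AE s\<in>{0..T} in lborel. isCont (f s) (upper_solution C D f x \<beta> s + \<beta> s)"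
    and t: "t \<in> {0..T}"
  shows "upper_solution C D f x \<beta> t =
    x + (LBINT s:{0..t}. f s (upper_solution C D f x \<beta> s + \<beta> s))"
proof -
  let ?y = "upper_solution C D f x \<beta>"
  let ?h = "\<lambda>n s. sup_conv D (C + real n) (f s) (approx n s + \<beta> s)"
  have "(\<lambda>n. LBINT s:{0..t}. ?h n s) \<longlonglongrightarrow> (LBINT s:{0..t}. f s (?y s + \<beta> s))"
    unfolding set_lebesgue_integral_def
  proof (rule integral_dominated_convergence)
    have "set_borel_measurable lborel {0..t} (?h n)" for n
    proof -
      note [measurable] = lipschitz_additive_ode.measurable_ode_solution[OF approx_ode, of n x]
        borel_measurable_sup_conv[OF measurable_g countable_D _ sup_convolution, of "C + real n"]
      show ?thesis
        unfolding set_borel_measurable_def by measurable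
    qed
    then show "(\<lambda>s. indicator {0..t} s *\<^sub>R ?h n s) \<in> borel_measurable lborel" for n
      by (simp add: set_borel_measurable_def)
    show "(\<lambda>s. indicator {0..t} s *\<^sub>R f s (?y s + \<beta> s)) \<in> borel_measurable lborel"
      by measurable
    show "integrable lborel (\<lambda>s. indicator {0..T} s *\<^sub>R (C * (1 + (radius + \<bar>\<beta> s\<bar>))))"
      using integrable_majorant by (simp add: set_integrable_def)
    show "AE s in lborel. norm (indicator {0..t} s *\<^sub>R ?h n s)
        \<le> indicator {0..T} s *\<^sub>R (C * (1 + (radius + \<bar>\<beta> s\<bar>)))" for n
    proof (rule AE_I2)
      fix s
      show "norm (indicator {0..t} s *\<^sub>R ?h n s)
          \<le> indicator {0..T} s *\<^sub>R (C * (1 + (radius + \<bar>\<beta> s\<bar>)))"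
      proof (cases "s \<in> {0..T}")
        case True
        then have "0 \<le> C * (1 + (radius + \<bar>\<beta> s\<bar>))"
          using approx_drift_le[OF True, of n] by linarith
        then show ?thesis
          using approx_drift_le[OF True, of n] True by (simp add: indicator_def)
      next
        case False
        then have "s \<notin> {0..t}"
          using t by auto
        with False show ?thesis
          by simp
      qed
    qed
    show "AE s in lborel. (\<lambda>n. indicator {0..t} s *\<^sub>R ?h n s)
        \<longlonglongrightarrow> indicator {0..t} s *\<^sub>R f s (?y s + \<beta> s)"
      using ae
    proof eventually_elim
      case (elim s)
      show ?case
      proof (cases "s \<in> {0..t}")
        case True
        then have s: "s \<in> {0..T}"
          using t by auto
        have "(\<lambda>n. ?h n s) \<longlonglongrightarrow> f s (?y s + \<beta> s)"
        proof (rule sup_convolution.sup_conv_tendsto[OF sup_convolution])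
          show "isCont (f s) (?y s + \<beta> s)"
            using elim s by blast
          show "(\<lambda>n. approx n s + \<beta> s) \<longlonglongrightarrow> ?y s + \<beta> s"
            by (intro tendsto_intros approx_tendsto s)
          show "filterlim (\<lambda>n. C + real n) at_top sequentially"
            by (intro filterlim_tendsto_add_at_top[OF tendsto_const] filterlim_real_sequentially)
        qed simp
        then show ?thesis
          by (intro tendsto_intros)
      qed simp
    qed
  qed
  then have "(\<lambda>n. approx n t) \<longlonglongrightarrow> x + (LBINT s:{0..t}. f s (?y s + \<beta> s))"
    by (subst lipschitz_additive_ode.ode_solution[OF approx_ode t]) (intro tendsto_intros)
  then show ?thesis
    using approx_tendsto[OF t] LIMSEQ_unique by blast
qed

end

section \<open>Adaptedness of time integrals\<close>

locale complete_subalgebra = prob_space M for M :: "'a measure" +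
  fixes G :: "'a measure"
  assumes complete: "complete_measure M"
    and subalg: "subalgebra M G"
    and null_sets_subset: "null_sets M \<subseteq> sets G"
begin

sublocale finite_measure_subalgebra M G
  by unfold_locales (rule subalg)

text \<open>Preimages under \<open>U\<close> and \<open>V\<close> differ only inside a null set. By
  completeness every subset of it is again a null set of \<open>M\<close>, hence belongs to
  \<open>G\<close>.\<close>

lemma measurable_AE_eq:
  fixes U V :: "'a \<Rightarrow> 'b::topological_space"
  assumes V: "V \<in> borel_measurable G" and eq: "AE \<omega> in M. U \<omega> = V \<omega>"
  shows "U \<in> borel_measurable G"
proof (rule measurableI)
  have space: "space G = space M"
    using subalg by (simp add: subalgebra_def)
  obtain N where N: "N \<in> null_sets M" "{\<omega> \<in> space M. U \<omega> \<noteq> V \<omega>} \<subseteq> N"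
    using eq unfolding eventually_ae_filter by blast
  fix S :: "'b set" assume S: "S \<in> sets borel"
  have "U -` S \<inter> space M \<inter> N \<in> null_sets M"
    by (rule complete_measure.complete2[OF complete _ N(1)]) simp
  then have "U -` S \<inter> space M \<inter> N \<in> sets G" "N \<in> sets G"
    using null_sets_subset N(1) by auto
  moreover have "V -` S \<inter> space G \<in> sets G"
    by (rule measurable_sets[OF V S])
  moreover have "U \<omega> = V \<omega>" if "\<omega> \<in> space M" "\<omega> \<notin> N" for \<omega>
    using N(2) that by auto
  then have "U -` S \<inter> space G = (V -` S \<inter> space G - N) \<union> (U -` S \<inter> space M \<inter> N)"
    unfolding space by auto
  ultimately show "U -` S \<inter> space G \<in> sets G"
    by auto
qed simp

lemma integral_mult_time_integral:
  fixes h :: "real \<Rightarrow> 'a \<Rightarrow> real" and V :: "'a \<Rightarrow> real"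
  assumes h: "(\<lambda>(s, \<omega>). h s \<omega>) \<in> borel_measurable (borel \<Otimes>\<^sub>M M)"
    and N: "\<And>s \<omega>. \<bar>h s \<omega>\<bar> \<le> N" and V: "integrable M V"
  shows "(\<integral>\<omega>. V \<omega> * (LBINT s:{0..t}. h s \<omega>) \<partial>M) = (LBINT s:{0..t}. \<integral>\<omega>. h s \<omega> * V \<omega> \<partial>M)"
proof -
  interpret P: pair_sigma_finite lborel M ..
  note [measurable] = h
  have [measurable]: "V \<in> borel_measurable M"
    using V by auto
  have m: "(\<lambda>(s, \<omega>). indicator {0..t} s * (h s \<omega> * V \<omega>)) \<in> borel_measurable (lborel \<Otimes>\<^sub>M M)"
    by measurable
  have hs [measurable]: "h s \<in> borel_measurable M" for s
    by measurable
  have hV: "integrable M (\<lambda>\<omega>. h s \<omega> * V \<omega>)" for s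
  proof (rule Bochner_Integration.integrable_bound)
    show "integrable M (\<lambda>\<omega>. N * V \<omega>)"
      using V by simp
    show "AE \<omega> in M. norm (h s \<omega> * V \<omega>) \<le> norm (N * V \<omega>)"
    proof (rule AE_I2)
      fix \<omega>
      have "\<bar>h s \<omega>\<bar> * \<bar>V \<omega>\<bar> \<le> \<bar>N\<bar> * \<bar>V \<omega>\<bar>"
        using N[of s \<omega>] by (intro mult_right_mono) auto
      then show "norm (h s \<omega> * V \<omega>) \<le> norm (N * V \<omega>)"
        by (simp add: abs_mult)
    qed
  qed measurable
  have int: "integrable (lborel \<Otimes>\<^sub>M M) (\<lambda>(s, \<omega>). indicator {0..t} s * (h s \<omega> * V \<omega>))"
  proof (rule P.Fubini_integrable[OF m])
    show "AE s in lborel. integrable M (\<lambda>\<omega>. case (s, \<omega>) of (s, \<omega>) \<Rightarrow> indicator {0..t} s * (h s \<omega> *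
        V \<omega>))"
      using hV by simp
    have "set_integrable lborel {0..t} (\<lambda>s. \<integral>\<omega>. \<bar>h s \<omega> * V \<omega>\<bar> \<partial>M)"
    proof (rule set_integrable_Icc_bounded)
      show "(\<lambda>s. \<integral>\<omega>. \<bar>h s \<omega> * V \<omega>\<bar> \<partial>M) \<in> borel_measurable borel"
        by measurable
      fix s
      have "(\<integral>\<omega>. \<bar>h s \<omega> * V \<omega>\<bar> \<partial>M) \<le> (\<integral>\<omega>. N * \<bar>V \<omega>\<bar> \<partial>M)"
        using V N[of s]
        by (intro integral_mono[OF integrable_abs[OF hV]]) (auto simp: abs_mult intro:
            mult_right_mono)
      then show "\<bar>\<integral>\<omega>. \<bar>h s \<omega> * V \<omega>\<bar> \<partial>M\<bar> \<le> (\<integral>\<omega>. N * \<bar>V \<omega>\<bar> \<partial>M)"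
        by simp
    qed
    then show "integrable lborel (\<lambda>s. \<integral>\<omega>. norm (case (s, \<omega>) of (s, \<omega>) \<Rightarrow> indicator {0..t} s * (h s
        \<omega> * V \<omega>)) \<partial>M)"
      by (simp add: set_integrable_def abs_mult)
  qed
  have "(\<integral>\<omega>. V \<omega> * (LBINT s:{0..t}. h s \<omega>) \<partial>M) =
      (\<integral>\<omega>. \<integral>s. indicator {0..t} s * (h s \<omega> * V \<omega>) \<partial>lborel \<partial>M)"
    unfolding set_lebesgue_integral_def
    by (intro Bochner_Integration.integral_cong refl)
      (simp add: mult.commute mult.left_commute flip: integral_mult_right_zero)
  also have "\<dots> = (\<integral>s. \<integral>\<omega>. indicator {0..t} s * (h s \<omega> * V \<omega>) \<partial>M \<partial>lborel)"
    by (rule P.Fubini_integral[OF int])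
  finally show ?thesis
    by (simp add: set_lebesgue_integral_def)
qed

text \<open>
  A jointly measurable adapted process need not be progressively measurable, but its time
  integral \<open>U\<close> agrees with \<open>E[U | G]\<close>: testing against \<open>Z = sgn (U - E[U | G])\<close>, Fubini allows \<open>Z\<close>
  to be replaced by \<open>E[Z | G]\<close>.
\<close>

lemma measurable_time_integral_bounded:
  fixes h :: "real \<Rightarrow> 'a \<Rightarrow> real"
  assumes h: "(\<lambda>(s, \<omega>). h s \<omega>) \<in> borel_measurable (borel \<Otimes>\<^sub>M M)"
    and N: "\<And>s \<omega>. \<bar>h s \<omega>\<bar> \<le> N"
    and adapted: "\<And>s. s \<in> {0..t} \<Longrightarrow> h s \<in> borel_measurable G"
  shows "(\<lambda>\<omega>. LBINT s:{0..t}. h s \<omega>) \<in> borel_measurable G"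
proof -
  note [measurable] = h
  define U where "U \<omega> = (LBINT s:{0..t}. h s \<omega>)" for \<omega>
  have [measurable]: "U \<in> borel_measurable M"
    unfolding U_def by measurable
  have hs [measurable]: "h s \<in> borel_measurable M" for s
    by measurable
  have U_bd: "\<bar>U \<omega>\<bar> \<le> N * \<bar>t\<bar>" if "\<omega> \<in> space M" for \<omega>
  proof -
    have [measurable]: "(\<lambda>s. h s \<omega>) \<in> borel_measurable borel"
      using that by measurable
    have int: "set_integrable lborel {0..t} (\<lambda>s. h s \<omega>)"
      by (rule set_integrable_Icc_bounded[where D = N]) (use N in auto)
    have "\<bar>U \<omega>\<bar> \<le> (LBINT s:{0..t}. \<bar>h s \<omega>\<bar>)"
      unfolding U_def by (rule set_integral_norm_bound[OF int, unfolded real_norm_def])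
    also have "\<dots> \<le> (LBINT s:{0..t}. N)"
      by (intro set_integral_mono set_integrable_abs int set_integrable_Icc_bounded[where D =
          "\<bar>N\<bar>"]) (use N in auto)
    also have "\<dots> \<le> N * \<bar>t\<bar>"
      using order_trans[OF abs_ge_zero N[of 0 \<omega>]]
      by (auto simp: set_lebesgue_integral_def mult.commute abs_if intro: mult_nonneg_nonpos)
    finally show ?thesis .
  qed
  have intU: "integrable M U"
    using U_bd by (intro integrable_const_bound[of _ "N * \<bar>t\<bar>"]) auto
  have int_multU: "integrable M (\<lambda>\<omega>. Y \<omega> * U \<omega>)" if "integrable M Y" for Y
  proof (rule Bochner_Integration.integrable_bound)
    show "integrable M (\<lambda>\<omega>. (N * \<bar>t\<bar>) * Y \<omega>)"
      using that by simp
    show "AE \<omega> in M. norm (Y \<omega> * U \<omega>) \<le> norm ((N * \<bar>t\<bar>) * Y \<omega>)"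
    proof (rule AE_I2)
      fix \<omega> assume "\<omega> \<in> space M"
      then have "\<bar>Y \<omega>\<bar> * \<bar>U \<omega>\<bar> \<le> \<bar>Y \<omega>\<bar> * \<bar>N * \<bar>t\<bar>\<bar>"
        using U_bd[of \<omega>] by (intro mult_left_mono) auto
      then show "norm (Y \<omega> * U \<omega>) \<le> norm ((N * \<bar>t\<bar>) * Y \<omega>)"
        by (simp add: abs_mult mult.commute)
    qed
  qed (use that in measurable)
  define V where "V = real_cond_exp M G U"
  have intV: "integrable M V" and V_G [measurable]: "V \<in> borel_measurable G" and [measurable]: "V
      \<in> borel_measurable M"
    unfolding V_def using real_cond_exp_int(1)[OF intU] by auto
  define Z where "Z \<omega> = sgn (U \<omega> - V \<omega>)" for \<omega>
  have [measurable]: "Z \<in> borel_measurable M"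
    unfolding Z_def by measurable
  have Z_bd: "\<bar>Z \<omega>\<bar> \<le> 1" for \<omega>
    by (simp add: Z_def sgn_if)
  have intZ: "integrable M Z"
    using Z_bd by (intro integrable_const_bound[of _ 1]) auto
  define Y where "Y = real_cond_exp M G Z"
  have intY: "integrable M Y" and [measurable]: "Y \<in> borel_measurable G"
    unfolding Y_def using real_cond_exp_int(1)[OF intZ] by auto
  have int_multZ: "integrable M (\<lambda>\<omega>. f \<omega> * Z \<omega>)" if "integrable M f" for f
  proof (rule Bochner_Integration.integrable_bound[OF that])
    show "AE \<omega> in M. norm (f \<omega> * Z \<omega>) \<le> norm (f \<omega>)"
      using Z_bd by (intro AE_I2) (auto simp: abs_mult intro: mult_left_le)
  qed (use that in measurable)
  have inth: "integrable M (h s)" for s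
    using N by (intro integrable_const_bound[of _ N]) auto
  have "(\<integral>\<omega>. Z \<omega> * U \<omega> \<partial>M) = (LBINT s:{0..t}. \<integral>\<omega>. h s \<omega> * Z \<omega> \<partial>M)"
    unfolding U_def by (rule integral_mult_time_integral[OF h N intZ])
  also have "\<dots> = (LBINT s:{0..t}. \<integral>\<omega>. h s \<omega> * Y \<omega> \<partial>M)"
    unfolding Y_def
    by (intro set_lebesgue_integral_cong) (auto intro!: real_cond_exp_intg(2)[symmetric] int_multZ
        inth adapted)
  also have "\<dots> = (\<integral>\<omega>. Y \<omega> * U \<omega> \<partial>M)"
    unfolding U_def by (rule integral_mult_time_integral[OF h N intY, symmetric])
  \<comment> \<open>Now the roles are exchanged: \<open>Y\<close> is \<open>G\<close>-measurable, so
    \<open>U\<close> may be replaced by \<open>V\<close>; then \<open>V\<close> is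
    \<open>G\<close>-measurable, so \<open>Y\<close> may be turned back into
    \<open>Z\<close>.\<close>
  also have "\<dots> = (\<integral>\<omega>. Y \<omega> * V \<omega> \<partial>M)"
    unfolding V_def by (rule real_cond_exp_intg(2)[symmetric]) (auto intro: int_multU intY)
  also have "\<dots> = (\<integral>\<omega>. V \<omega> * Y \<omega> \<partial>M)"
    by (simp add: mult.commute)
  also have "\<dots> = (\<integral>\<omega>. V \<omega> * Z \<omega> \<partial>M)"
    unfolding Y_def by (rule real_cond_exp_intg(2)) (auto intro: int_multZ intV)
  finally have eq: "(\<integral>\<omega>. Z \<omega> * U \<omega> \<partial>M) = (\<integral>\<omega>. V \<omega> * Z \<omega> \<partial>M)" .
  have "(\<integral>\<omega>. \<bar>U \<omega> - V \<omega>\<bar> \<partial>M) = (\<integral>\<omega>. Z \<omega> * U \<omega> - V \<omega> * Z \<omega> \<partial>M)"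
    by (intro Bochner_Integration.integral_cong) (auto simp: Z_def sgn_if algebra_simps)
  also have "\<dots> = 0"
    using eq int_multU[OF intZ] int_multZ[OF intV] by simp
  finally have "AE \<omega> in M. \<bar>U \<omega> - V \<omega>\<bar> = 0"
    using intU intV by (subst (asm) integral_nonneg_eq_0_iff_AE) auto
  then have "AE \<omega> in M. U \<omega> = V \<omega>"
    by simp
  then have "U \<in> borel_measurable G"
    by (rule measurable_AE_eq[OF V_G])
  then show ?thesis
    by (simp add: U_def[abs_def])
qed

text \<open>Truncation of \<open>h\<close> at levels plus and minus \<open>n\<close> reduces to the
  bounded case, where Fubini and conditional expectations are available; the truncated integrals
  converge path by path.\<close>

lemma measurable_time_integral:
  fixes h :: "real \<Rightarrow> 'a \<Rightarrow> real"
  assumes h: "(\<lambda>(s, \<omega>). h s \<omega>) \<in> borel_measurable (borel \<Otimes>\<^sub>M M)"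
    and int: "\<And>\<omega>. \<omega> \<in> space M \<Longrightarrow> set_integrable lborel {0..t} (\<lambda>s. h s \<omega>)"
    and adapted: "\<And>s. s \<in> {0..t} \<Longrightarrow> h s \<in> borel_measurable G"
  shows "(\<lambda>\<omega>. LBINT s:{0..t}. h s \<omega>) \<in> borel_measurable G"
proof (rule borel_measurable_LIMSEQ_real)
  note [measurable] = h
  define k where "k n s \<omega> = max (- real n) (min (real n) (h s \<omega>))" for n s \<omega>
  show "(\<lambda>\<omega>. LBINT s:{0..t}. k n s \<omega>) \<in> borel_measurable G" for n
  proof (rule measurable_time_integral_bounded)
    show "(\<lambda>(s, \<omega>). k n s \<omega>) \<in> borel_measurable (borel \<Otimes>\<^sub>M M)"
      unfolding k_def by measurable
    show "\<bar>k n s \<omega>\<bar> \<le> real n" for s \<omega>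
      unfolding k_def by auto
    show "k n s \<in> borel_measurable G" if "s \<in> {0..t}" for s
      unfolding k_def[abs_def] using adapted[OF that] by measurable
  qed
  fix \<omega> assume "\<omega> \<in> space G"
  then have \<omega>: "\<omega> \<in> space M"
    using subalg by (simp add: subalgebra_def)
  have [measurable]: "(\<lambda>s. h s \<omega>) \<in> borel_measurable borel"
    using \<omega> by measurable
  show "(\<lambda>n. LBINT s:{0..t}. k n s \<omega>) \<longlonglongrightarrow> (LBINT s:{0..t}. h s \<omega>)"
    unfolding set_lebesgue_integral_def
  proof (rule integral_dominated_convergence)
    show "integrable lborel (\<lambda>s. indicator {0..t} s *\<^sub>R \<bar>h s \<omega>\<bar>)"
      using set_integrable_abs[OF int[OF \<omega>]] by (simp add: set_integrable_def)
    show "AE s in lborel. (\<lambda>n. indicator {0..t} s *\<^sub>R k n s \<omega>) \<longlonglongrightarrow> indicator {0..t} s *\<^sub>R h s \<omega>"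
    proof (rule AE_I2, rule tendsto_scaleR[OF tendsto_const])
      fix s
      obtain m :: nat where m: "\<bar>h s \<omega>\<bar> \<le> real m"
        using real_arch_simple by blast
      have "\<forall>\<^sub>F n in sequentially. k n s \<omega> = h s \<omega>"
        using eventually_ge_at_top[of m]
      proof eventually_elim
        case (elim n)
        with m have "\<bar>h s \<omega>\<bar> \<le> real n"
          by (meson of_nat_le_iff order_trans)
        then show ?case
          unfolding k_def max_def min_def by (simp add: abs_le_iff)
      qed
      then show "(\<lambda>n. k n s \<omega>) \<longlonglongrightarrow> h s \<omega>"
        by (rule tendsto_eventually)
    qed
    show "AE s in lborel. norm (indicator {0..t} s *\<^sub>R k n s \<omega>) \<le> indicator {0..t} s *\<^sub>R \<bar>h s \<omega>\<bar>"
        for n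
      by (intro AE_I2) (auto simp: k_def indicator_def)
  qed (auto simp: k_def)
qed

end


section \<open>Adaptedness of the approximate solutions and of their limit\<close>

locale adapted_noise = prob_space M for M :: "'a measure" +
  fixes F :: "real \<Rightarrow> 'a measure" and B :: "real \<Rightarrow> 'a \<Rightarrow> real" and T :: real
  assumes complete_subalgebra: "\<And>t. t \<in> {0..T} \<Longrightarrow> complete_subalgebra M (F t)"
    and sets_mono: "\<And>s t. s \<le> t \<Longrightarrow> sets (F s) \<subseteq> sets (F t)"
    and measurable_B [measurable]: "(\<lambda>(s, \<omega>). B s \<omega>) \<in> borel_measurable (borel \<Otimes>\<^sub>M M)"
    and adapted_B: "\<And>t. t \<in> {0..T} \<Longrightarrow> B t \<in> borel_measurable (F t)"
begin

lemma space_F: "t \<in> {0..T} \<Longrightarrow> space (F t) = space M"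
  using complete_subalgebra.subalg[OF complete_subalgebra] by (simp add: subalgebra_def)

lemma measurable_F_mono:
  assumes "f \<in> borel_measurable (F s)" and "s \<in> {0..T}" and "t \<in> {0..T}" and "s \<le> t"
  shows "f \<in> borel_measurable (F t)"
proof (rule measurable_from_subalg[OF _ assms(1)])
  show "subalgebra (F t) (F s)"
    using assms sets_mono by (simp add: subalgebra_def space_F)
qed

text \<open>The integrand at time \<open>s \<le> t\<close> is measurable for \<open>F s\<close>,
  hence for \<open>F t\<close>. The usual appeal to progressive measurability is replaced by
  \<open>measurable_time_integral\<close>.\<close>

lemma adapted_picard:
  assumes g [measurable]: "(\<lambda>(s, x). g s x) \<in> borel_measurable (borel \<Otimes>\<^sub>M borel)"
    and ode: "\<And>\<omega>. \<omega> \<in> space M \<Longrightarrow> lipschitz_additive_ode T C g (\<lambda>s. B s \<omega>) L"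
    and t: "t \<in> {0..T}"
  shows "(\<lambda>\<omega>. picard g x (\<lambda>s. B s \<omega>) k t) \<in> borel_measurable (F t)"
  using t
proof (induction k arbitrary: t)
  case 0
  show ?case by simp
next
  case (Suc k)
  interpret S: complete_subalgebra M "F t"
    by (rule complete_subalgebra) (rule Suc.prems)
  define h where "h s \<omega> = g s (picard g x (\<lambda>s. B s \<omega>) k s + B s \<omega>)" for s \<omega>
  have "(\<lambda>\<omega>. LBINT s:{0..t}. h s \<omega>) \<in> borel_measurable (F t)"
  proof (rule S.measurable_time_integral)
    note [measurable] = borel_measurable_picard[OF g measurable_B, of x k]
    show "(\<lambda>(s, \<omega>). h s \<omega>) \<in> borel_measurable (borel \<Otimes>\<^sub>M M)"
      unfolding h_def by measurable
  next
    fix \<omega> assume "\<omega> \<in> space M"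
    then interpret O: lipschitz_additive_ode T C x g "\<lambda>s. B s \<omega>" L
      by (rule ode)
    obtain D where "\<And>t. t \<in> {0..T} \<Longrightarrow> \<bar>picard g x (\<lambda>s. B s \<omega>) k t\<bar> \<le> D"
      using O.picard_bounded[of k] by blast
    then have "set_integrable lborel {0..T} (\<lambda>s. h s \<omega>)"
      unfolding h_def by (rule O.integrable_drift[OF O.measurable_picard])
    then show "set_integrable lborel {0..t} (\<lambda>s. h s \<omega>)"
      by (rule set_integrable_subset) (use Suc.prems in auto)
  next
    fix s assume "s \<in> {0..t}"
    with Suc.prems have s: "s \<in> {0..T}" "s \<le> t"
      by auto
    note [measurable] = Suc.IH[OF s(1)] adapted_B[OF s(1)]
    have "h s \<in> borel_measurable (F s)"
      unfolding h_def[abs_def] by measurable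
    then show "h s \<in> borel_measurable (F t)"
      by (rule measurable_F_mono[OF _ s(1) Suc.prems s(2)])
  qed
  then show ?case
    unfolding picard.simps h_def by (rule borel_measurable_add[OF borel_measurable_const])
qed

lemma adapted_ode_solution:
  assumes "(\<lambda>(s, x). g s x) \<in> borel_measurable (borel \<Otimes>\<^sub>M borel)"
    and "\<And>\<omega>. \<omega> \<in> space M \<Longrightarrow> lipschitz_additive_ode T C g (\<lambda>s. B s \<omega>) L" and "t \<in> {0..T}"
  shows "(\<lambda>\<omega>. ode_solution g x (\<lambda>s. B s \<omega>) t) \<in> borel_measurable (F t)"
  unfolding ode_solution_def
  by (rule borel_measurable_lim_metric) (rule adapted_picard[OF assms])

lemma adapted_upper_solution:
  assumes f: "(\<lambda>(s, x). f s x) \<in> borel_measurable (borel \<Otimes>\<^sub>M borel)"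
    and ode: "\<And>\<omega>. \<omega> \<in> space M \<Longrightarrow> irregular_additive_ode T C f (\<lambda>s. B s \<omega>) D" and t: "t \<in> {0..T}"
  shows "(\<lambda>\<omega>. upper_solution C D f x (\<lambda>s. B s \<omega>) t) \<in> borel_measurable (F t)"
  unfolding upper_solution_def
proof (rule borel_measurable_lim_metric)
  fix n
  \<comment> \<open>Measurability of the envelopes does not involve the path, but it is recorded in
    a locale for a fixed path; any path serves to extract it.\<close>
  obtain \<omega> where "\<omega> \<in> space M"
    using not_empty by blast
  have "(\<lambda>(s, x). sup_conv D (C + real n) (f s) x) \<in> borel_measurable (borel \<Otimes>\<^sub>M borel)"
    by (rule lipschitz_additive_ode.axioms(1)[THEN additive_ode.measurable_g,
      OF irregular_additive_ode.approx_ode, OF ode, OF \<open>\<omega> \<in> space M\<close>])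
  then show "(\<lambda>\<omega>. ode_solution (\<lambda>s. sup_conv D (C + real n) (f s)) x (\<lambda>s. B s \<omega>) t)
      \<in> borel_measurable (F t)"
    by (rule adapted_ode_solution[OF _ irregular_additive_ode.approx_ode[OF ode] t])
qed

lemma measurable_upper_solution:
  assumes f: "(\<lambda>(s, x). f s x) \<in> borel_measurable (borel \<Otimes>\<^sub>M borel)"
    and ode: "\<And>\<omega>. \<omega> \<in> space M \<Longrightarrow> irregular_additive_ode T C f (\<lambda>s. B s \<omega>) D"
  shows "(\<lambda>(t, \<omega>). upper_solution C D f x (\<lambda>s. B s \<omega>) t) \<in> borel_measurable (borel \<Otimes>\<^sub>M M)"
  unfolding upper_solution_def case_prod_beta
proof (rule borel_measurable_lim_metric)
  fix n
  obtain \<omega> where "\<omega> \<in> space M"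
    using not_empty by blast
  have "(\<lambda>(s, x). sup_conv D (C + real n) (f s) x) \<in> borel_measurable (borel \<Otimes>\<^sub>M borel)"
    by (rule lipschitz_additive_ode.axioms(1)[THEN additive_ode.measurable_g,
      OF irregular_additive_ode.approx_ode, OF ode, OF \<open>\<omega> \<in> space M\<close>])
  from borel_measurable_ode_solution[OF this measurable_B]
  show "(\<lambda>z. ode_solution (\<lambda>s. sup_conv D (C + real n) (f s)) x (\<lambda>s. B s (snd z)) (fst z))
      \<in> borel_measurable (borel \<Otimes>\<^sub>M M)"
    by (simp add: case_prod_beta)
qed

end

section \<open>Gaussian smoothing by Brownian increments\<close>

text \<open>The freezing lemma: by independence the joint law is a product, so \<open>Z\<close> is
  integrated out with \<open>V\<close> held fixed. It takes the place of conditioning on the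
  past.\<close>

lemma (in prob_space) nn_integral_indep_var_density:
  fixes g :: "real \<Rightarrow> real \<Rightarrow> ennreal" and f :: "real \<Rightarrow> real"
  assumes indep: "indep_var borel V borel Z" and Z: "distributed M lborel Z f"
    and g [measurable]: "(\<lambda>(v, z). g v z) \<in> borel_measurable (borel \<Otimes>\<^sub>M borel)"
  shows "(\<integral>\<^sup>+\<omega>. g (V \<omega>) (Z \<omega>) \<partial>M) = (\<integral>\<^sup>+\<omega>. \<integral>\<^sup>+z. f z * g (V \<omega>) z \<partial>lborel \<partial>M)"
proof -
  have V [measurable]: "V \<in> borel_measurable M" and Zm [measurable]: "Z \<in> borel_measurable M"
    using indep_var_rv1[OF indep] indep_var_rv2[OF indep] by auto
  have prod: "distr M borel V \<Otimes>\<^sub>M distr M borel Z = distr M (borel \<Otimes>\<^sub>M borel) (\<lambda>\<omega>. (V \<omega>, Z \<omega>))"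
    using indep unfolding indep_var_distribution_eq by simp
  interpret Z: prob_space "distr M borel Z"
    by (rule prob_space_distr) (rule Zm)
  have "(\<integral>\<^sup>+\<omega>. g (V \<omega>) (Z \<omega>) \<partial>M)
      = (\<integral>\<^sup>+x. (case x of (v, z) \<Rightarrow> g v z) \<partial>distr M (borel \<Otimes>\<^sub>M borel) (\<lambda>\<omega>. (V \<omega>, Z \<omega>)))"
    by (subst nn_integral_distr) auto
  moreover have "\<dots> = (\<integral>\<^sup>+v. \<integral>\<^sup>+z. g v z \<partial>distr M borel Z \<partial>distr M borel V)"
    unfolding prod[symmetric]
    by (subst Z.nn_integral_fst[symmetric]) auto
  moreover have "\<dots> = (\<integral>\<^sup>+\<omega>. \<integral>\<^sup>+z. g (V \<omega>) z \<partial>distr M borel Z \<partial>M)"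
    by (subst nn_integral_distr) auto
  moreover have "(\<integral>\<^sup>+z. g v z \<partial>distr M borel Z) = (\<integral>\<^sup>+z. f z * g v z \<partial>lborel)" for v
    by (subst distributed_nn_integral[OF Z]) (auto simp: nn_integral_distr)
  ultimately show ?thesis
    by simp
qed

lemma nn_integral_normal_density_square:
  assumes "0 < \<sigma>"
  shows "(\<integral>\<^sup>+z. ennreal (normal_density 0 \<sigma> z) * ennreal ((v + z)\<^sup>2) \<partial>lborel) = ennreal (v\<^sup>2 + \<sigma>\<^sup>2)"
proof -
  have "has_bochner_integral lborel (\<lambda>z. v\<^sup>2 * (normal_density 0 \<sigma> z * (z - 0) ^ (2 * 0))
      + 2 * v * (normal_density 0 \<sigma> z * (z - 0) ^ (2 * 0 + 1)) + normal_density 0 \<sigma> z * (z - 0) ^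
          (2 * 1))
     (v\<^sup>2 * (fact (2 * 0) / ((2 / \<sigma>\<^sup>2) ^ 0 * fact 0)) + 2 * v * 0
       + fact (2 * 1) / ((2 / \<sigma>\<^sup>2) ^ 1 * fact 1))"
    by (intro has_bochner_integral_add has_bochner_integral_mult_right normal_moment_even
      normal_moment_odd assms)
  then have "has_bochner_integral lborel (\<lambda>z. normal_density 0 \<sigma> z * (v + z)\<^sup>2) (v\<^sup>2 + \<sigma>\<^sup>2)"
    by (simp add: fact_2 power2_eq_square algebra_simps)
  then have "(\<integral>\<^sup>+z. ennreal (normal_density 0 \<sigma> z * (v + z)\<^sup>2) \<partial>lborel) = ennreal (v\<^sup>2 + \<sigma>\<^sup>2)"
    by (subst nn_integral_eq_integral) (auto simp: has_bochner_integral_iff normal_density_nonneg)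
  then show ?thesis
    by (simp add: ennreal_mult' normal_density_nonneg)
qed

lemma step_function_square:
  assumes "\<And>i. i < n \<Longrightarrow> \<tau> i \<le> \<tau> (Suc i)"
  shows "(step_function n \<tau> c s)\<^sup>2 = (\<Sum>i<n. (c i)\<^sup>2 * indicator {\<tau> i<..\<tau> (Suc i)} s)"
proof -
  \<comment> \<open>The first conjunct strengthens the induction: the next piece lives strictly to
    the right of \<open>\<tau> n\<close>, where the earlier ones vanish, so the square has no cross
    terms.\<close>
  have "(\<tau> n < s \<longrightarrow> step_function n \<tau> c s = 0) \<and>
      (step_function n \<tau> c s)\<^sup>2 = (\<Sum>i<n. (c i)\<^sup>2 * indicator {\<tau> i<..\<tau> (Suc i)} s)"
    using assms
  proof (induction n)
    case 0
    show ?case by (simp add: step_function_def)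
  next
    case (Suc n)
    then have IH: "\<tau> n < s \<Longrightarrow> step_function n \<tau> c s = 0"
      "(step_function n \<tau> c s)\<^sup>2 = (\<Sum>i<n. (c i)\<^sup>2 * indicator {\<tau> i<..\<tau> (Suc i)} s)"
      by auto
    have "\<tau> n \<le> \<tau> (Suc n)"
      using Suc.prems by simp
    with IH show ?case
      by (auto simp: step_function_def indicator_def)
  qed
  then show ?thesis by simp
qed

lemma nn_integral_step_function_square:
  assumes mono: "\<And>i. i < n \<Longrightarrow> \<tau> i \<le> \<tau> (Suc i)" and le: "\<And>i. i \<le> n \<Longrightarrow> \<tau> i \<le> t" and "r \<le> t"
  shows "(\<integral>\<^sup>+s\<in>{r..t}. ennreal ((step_function n \<tau> c s)\<^sup>2) \<partial>lborel)
    = ennreal (\<Sum>i<n. (c i)\<^sup>2 * (max (\<tau> (Suc i)) r - max (\<tau> i) r))"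
proof -
  have piece: "(\<integral>\<^sup>+s. ennreal ((c i)\<^sup>2) * indicator {max (\<tau> i) r<..max (\<tau> (Suc i)) r} s \<partial>lborel)
      = ennreal ((c i)\<^sup>2 * (max (\<tau> (Suc i)) r - max (\<tau> i) r))" if "i < n" for i
  proof -
    have "max (\<tau> i) r \<le> max (\<tau> (Suc i)) r"
      using mono[OF that] by auto
    then show ?thesis
      by (simp add: nn_integral_cmult_indicator ennreal_mult)
  qed
  have "(\<integral>\<^sup>+s\<in>{r..t}. ennreal ((step_function n \<tau> c s)\<^sup>2) \<partial>lborel)
      = (\<integral>\<^sup>+s. (\<Sum>i<n. ennreal ((c i)\<^sup>2) * indicator {max (\<tau> i) r<..max (\<tau> (Suc i)) r} s) \<partial>lborel)"
  proof (rule nn_integral_cong_AE)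
    show "AE s in lborel. ennreal ((step_function n \<tau> c s)\<^sup>2) * indicator {r..t} s
        = (\<Sum>i<n. ennreal ((c i)\<^sup>2) * indicator {max (\<tau> i) r<..max (\<tau> (Suc i)) r} s)"
      \<comment> \<open>The pieces are left-open and the window \<open>{r..t}\<close> is closed, so
        after clipping to the window the two integrands may differ at \<open>r\<close>.\<close>
      using AE_lborel_singleton[of r]
    proof eventually_elim
      case (elim s)
      have "ennreal ((step_function n \<tau> c s)\<^sup>2) * indicator {r..t} s
          = (\<Sum>i<n. ennreal ((c i)\<^sup>2 * indicator {\<tau> i<..\<tau> (Suc i)} s)) * indicator {r..t} s"
        using step_function_square[of n \<tau> c s] mono by simp
      also have "\<dots> = (\<Sum>i<n. ennreal ((c i)\<^sup>2 * indicator {\<tau> i<..\<tau> (Suc i)} s) * indicator {r..t} s)"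
        by (rule sum_distrib_right)
      also have "\<dots> = (\<Sum>i<n. ennreal ((c i)\<^sup>2) * indicator {max (\<tau> i) r<..max (\<tau> (Suc i)) r} s)"
      proof (rule sum.cong)
        fix i assume "i \<in> {..<n}"
        then have "\<tau> (Suc i) \<le> t"
          using le[of "Suc i"] by simp
        with elim show "ennreal ((c i)\<^sup>2 * indicator {\<tau> i<..\<tau> (Suc i)} s) * indicator {r..t} s
            = ennreal ((c i)\<^sup>2) * indicator {max (\<tau> i) r<..max (\<tau> (Suc i)) r} s"
          by (auto simp: indicator_def)
      qed simp
      finally show ?case .
    qed
  qed
  also have "\<dots> = (\<Sum>i<n. \<integral>\<^sup>+s. ennreal ((c i)\<^sup>2) * indicator {max (\<tau> i) r<..max (\<tau> (Suc i)) r} s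
      \<partial>lborel)"
    by (rule nn_integral_sum) simp
  also have "\<dots> = (\<Sum>i<n. ennreal ((c i)\<^sup>2 * (max (\<tau> (Suc i)) r - max (\<tau> i) r)))"
    by (rule sum.cong) (use piece in auto)
  also have "\<dots> = ennreal (\<Sum>i<n. (c i)\<^sup>2 * (max (\<tau> (Suc i)) r - max (\<tau> i) r))"
    using mono by (intro sum_ennreal) (force intro: mult_nonneg_nonneg)
  finally show ?thesis .
qed

section \<open>Brownian increments and integrals of step functions\<close>

locale brownian_motion = prob_space M for M :: "'a measure" +
  fixes F :: "real \<Rightarrow> 'a measure" and T :: real and W :: "real \<Rightarrow> 'a \<Rightarrow> real"
  assumes brownian: "standard_brownian_motion M F T W"
    and subalgebra_F: "\<And>t. t \<in> {0..T} \<Longrightarrow> subalgebra M (F t)"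
    and sets_F_mono: "\<And>s t. s \<le> t \<Longrightarrow> sets (F s) \<subseteq> sets (F t)"
begin

lemma measurable_F_mono:
  assumes "f \<in> borel_measurable (F s)" and "s \<in> {0..T}" and "t \<in> {0..T}" and "s \<le> t"
  shows "f \<in> borel_measurable (F t)"
proof (rule measurable_from_subalg[OF _ assms(1)])
  show "subalgebra (F t) (F s)"
    using assms subalgebra_F[of s] subalgebra_F[of t] sets_F_mono by (simp add: subalgebra_def)
qed

lemma measurable_F_imp:
  "f \<in> borel_measurable (F s) \<Longrightarrow> s \<in> {0..T} \<Longrightarrow> f \<in> borel_measurable M"
  by (rule measurable_from_subalg[OF subalgebra_F])

lemma adapted_W: "s \<in> {0..t} \<Longrightarrow> t \<le> T \<Longrightarrow> W s \<in> borel_measurable (F t)"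
  using brownian measurable_F_mono[of "W s" s t] unfolding standard_brownian_motion_def by auto

lemma adapted_step_integral:
  assumes "\<And>i. i \<le> n \<Longrightarrow> \<tau> i \<in> {0..t}" and "t \<le> T"
  shows "step_integral W n \<tau> c \<in> borel_measurable (F t)"
  unfolding step_integral_def[abs_def] using assms
  by (intro borel_measurable_sum borel_measurable_times borel_measurable_const borel_measurable_diff
    adapted_W) auto

lemma increment_distributed:
  assumes "0 \<le> s" and "s < t" and "t \<le> T"
  shows "distributed M lborel (\<lambda>\<omega>. W t \<omega> - W s \<omega>) (normal_density 0 (sqrt (t - s)))"
  using brownian assms unfolding standard_brownian_motion_def by blast

lemma increment_indep:
  assumes "0 \<le> s" and "s < t" and "t \<le> T" and V: "V \<in> borel_measurable (F s)"
  shows "indep_var borel V borel (\<lambda>\<omega>. W t \<omega> - W s \<omega>)"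
proof -
  let ?Z = "\<lambda>\<omega>. W t \<omega> - W s \<omega>"
  have s: "s \<in> {0..T}"
    using assms by auto
  have space: "space (F s) = space M"
    using subalgebra_F[OF s] by (simp add: subalgebra_def)
  have indep: "indep_set (sets (F s)) (sets (vimage_algebra (space M) ?Z borel))"
    using brownian assms unfolding standard_brownian_motion_def by blast
  have "sigma_sets (space M) {V -` A \<inter> space M | A. A \<in> sets borel} \<subseteq> sets (F s)"
    unfolding space[symmetric] by (rule sets.sigma_sets_subset) (auto intro: measurable_sets[OF V])
  then have "indep_set (sigma_sets (space M) {V -` A \<inter> space M | A. A \<in> sets borel})
      (sigma_sets (space M) {?Z -` A \<inter> space M | A. A \<in> sets borel})"
    using indep unfolding indep_sets2_eq sets_vimage_algebra by blast
  moreover have "?Z \<in> borel_measurable M"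
    using distributed_measurable[OF increment_distributed[OF assms(1-3)]] by simp
  ultimately show ?thesis
    unfolding indep_var_eq using measurable_F_imp[OF V s] by auto
qed

lemma expectation_increment:
  fixes g :: "real \<Rightarrow> real \<Rightarrow> ennreal"
  assumes "0 \<le> s" and "s < t" and "t \<le> T" and "V \<in> borel_measurable (F s)" and "c \<noteq> 0"
    and "(\<lambda>(v, z). g v z) \<in> borel_measurable (borel \<Otimes>\<^sub>M borel)"
  shows "(\<integral>\<^sup>+\<omega>. g (V \<omega>) (c * (W t \<omega> - W s \<omega>)) \<partial>M)
    = (\<integral>\<^sup>+\<omega>. \<integral>\<^sup>+z. normal_density 0 (\<bar>c\<bar> * sqrt (t - s)) z * g (V \<omega>) z \<partial>lborel \<partial>M)"
proof (rule nn_integral_indep_var_density[OF _ _ assms(6)])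
  show "indep_var borel V borel (\<lambda>\<omega>. c * (W t \<omega> - W s \<omega>))"
    using indep_var_compose[OF increment_indep[OF assms(1-4)], of "\<lambda>x. x" borel "\<lambda>x. c * x" borel]
    by (simp add: comp_def)
  show "distributed M lborel (\<lambda>\<omega>. c * (W t \<omega> - W s \<omega>)) (\<lambda>x. ennreal (normal_density 0 (\<bar>c\<bar> * sqrt
      (t - s)) x))"
    using normal_density_affine[OF increment_distributed[OF assms(1-3)] _ \<open>c \<noteq> 0\<close>, of 0] assms(2)
    by simp
qed

lemma expectation_square_increment:
  assumes "0 \<le> s" and "s \<le> t" and "t \<le> T" and V: "V \<in> borel_measurable (F s)"
  shows "(\<integral>\<^sup>+\<omega>. ennreal ((V \<omega> + c * (W t \<omega> - W s \<omega>))\<^sup>2) \<partial>M)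
    = (\<integral>\<^sup>+\<omega>. ennreal ((V \<omega>)\<^sup>2) \<partial>M) + ennreal (c\<^sup>2 * (t - s))"
proof (cases "c = 0 \<or> s = t")
  case False
  then have "s < t" "c \<noteq> 0"
    using assms by auto
  have [measurable]: "V \<in> borel_measurable M"
    using measurable_F_imp[OF V] assms by simp
  have pos: "0 < \<bar>c\<bar> * sqrt (t - s)" and sq: "(\<bar>c\<bar> * sqrt (t - s))\<^sup>2 = c\<^sup>2 * (t - s)"
    using \<open>s < t\<close> \<open>c \<noteq> 0\<close> by (auto simp: power_mult_distrib)
  have "(\<integral>\<^sup>+\<omega>. ennreal ((V \<omega> + c * (W t \<omega> - W s \<omega>))\<^sup>2) \<partial>M)
      = (\<integral>\<^sup>+\<omega>. ennreal ((V \<omega>)\<^sup>2 + c\<^sup>2 * (t - s)) \<partial>M)"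
    using expectation_increment[OF assms(1) \<open>s < t\<close> assms(3) V \<open>c \<noteq> 0\<close>, of "\<lambda>v z. ennreal ((v +
        z)\<^sup>2)"]
      nn_integral_normal_density_square[OF pos] by (simp add: sq)
  also have "\<dots> = (\<integral>\<^sup>+\<omega>. ennreal ((V \<omega>)\<^sup>2) + ennreal (c\<^sup>2 * (t - s)) \<partial>M)"
    using assms by (intro nn_integral_cong) simp
  also have "\<dots> = (\<integral>\<^sup>+\<omega>. ennreal ((V \<omega>)\<^sup>2) \<partial>M) + ennreal (c\<^sup>2 * (t - s))"
    by (subst nn_integral_add) (auto simp: emeasure_space_1)
  finally show ?thesis .
qed auto

text \<open>The test function is itself a Gaussian density, so integrating out an independent
  Gaussian increment is a convolution and merely adds the variances. The proof works with
  \<open>- c\<close>, because the convolution formula has the difference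
  \<open>v - z\<close>.\<close>

lemma expectation_normal_density_increment:
  assumes "0 \<le> s" and "s \<le> t" and "t \<le> T" and V: "V \<in> borel_measurable (F s)" and "0 < \<sigma>"
  shows "(\<integral>\<^sup>+\<omega>. ennreal (normal_density 0 \<sigma> (V \<omega> + c * (W t \<omega> - W s \<omega>))) \<partial>M)
    = (\<integral>\<^sup>+\<omega>. ennreal (normal_density 0 (sqrt (\<sigma>\<^sup>2 + c\<^sup>2 * (t - s))) (V \<omega>)) \<partial>M)"
proof (cases "c = 0 \<or> s = t")
  case True
  then show ?thesis
    using \<open>0 < \<sigma>\<close> by auto
next
  case False
  then have "s < t" "- c \<noteq> 0"
    using assms by auto
  have pos: "0 < \<bar>- c\<bar> * sqrt (t - s)" and sq: "(\<bar>- c\<bar> * sqrt (t - s))\<^sup>2 = c\<^sup>2 * (t - s)"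
    using \<open>s < t\<close> \<open>- c \<noteq> 0\<close> by (auto simp: power_mult_distrib)
  have conv: "(\<integral>\<^sup>+z. ennreal (normal_density 0 (\<bar>- c\<bar> * sqrt (t - s)) z) * ennreal (normal_density
      0 \<sigma> (v - z)) \<partial>lborel)
      = ennreal (normal_density 0 (sqrt (\<sigma>\<^sup>2 + c\<^sup>2 * (t - s))) v)" for v
    using fun_cong[OF conv_normal_density_zero_mean[OF \<open>0 < \<sigma>\<close> pos], of v]
    unfolding sq by (simp add: ennreal_mult'' normal_density_nonneg mult.commute)
  have "(\<integral>\<^sup>+\<omega>. ennreal (normal_density 0 \<sigma> (V \<omega> - (- c) * (W t \<omega> - W s \<omega>))) \<partial>M)
    = (\<integral>\<^sup>+\<omega>. ennreal (normal_density 0 (sqrt (\<sigma>\<^sup>2 + c\<^sup>2 * (t - s))) (V \<omega>)) \<partial>M)"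
    using expectation_increment[OF assms(1) \<open>s < t\<close> assms(3) V \<open>- c \<noteq> 0\<close>,
        of "\<lambda>v z. ennreal (normal_density 0 \<sigma> (v - z))"]
    unfolding conv by simp
  then show ?thesis
    by simp
qed

lemma step_integral_Suc:
  "step_integral W (Suc n) \<tau> c \<omega> = step_integral W n \<tau> c \<omega> + c n * (W (\<tau> (Suc n)) \<omega> - W (\<tau> n) \<omega>)"
  by (simp add: step_integral_def)

lemma partition_mono:
  fixes \<tau> :: "nat \<Rightarrow> real"
  assumes "\<And>i. i < n \<Longrightarrow> \<tau> i \<le> \<tau> (Suc i)" and "i \<le> j" and "j \<le> n"
  shows "\<tau> i \<le> \<tau> j"
  using assms(2,3)
proof (induction j rule: dec_induct)
  case (step j)
  then show ?case
    using assms(1)[of j] by simp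
qed simp

text \<open>The Ito isometry for step functions. The last increment is split off: the earlier ones
  are known at time \<open>\<tau> n\<close>, from which it is independent.\<close>

lemma expectation_step_integral_square:
  assumes mono: "\<And>i. i < n \<Longrightarrow> \<tau> i \<le> \<tau> (Suc i)" and "0 \<le> \<tau> 0" and "\<tau> n \<le> T"
  shows "(\<integral>\<^sup>+\<omega>. ennreal ((step_integral W n \<tau> c \<omega>)\<^sup>2) \<partial>M) = ennreal (\<Sum>i<n. (c i)\<^sup>2 * (\<tau> (Suc i) - \<tau>
      i))"
  using assms
proof (induction n)
  case 0
  show ?case by (simp add: step_integral_def)
next
  case (Suc n)
  have le: "\<tau> i \<le> \<tau> j" if "i \<le> j" "j \<le> Suc n" for i j
    using partition_mono[of "Suc n" \<tau>, OF Suc.prems(1) that] by simp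
  have n: "0 \<le> \<tau> n" "\<tau> n \<le> \<tau> (Suc n)"
    using le[of 0 n] le[of n "Suc n"] Suc.prems by auto
  have "0 \<le> \<tau> i \<and> \<tau> i \<le> \<tau> n" if "i \<le> n" for i
    using le[of 0 i] le[of i n] that Suc.prems(2) by auto
  then have V: "step_integral W n \<tau> c \<in> borel_measurable (F (\<tau> n))"
    using n Suc.prems(3) by (intro adapted_step_integral) auto
  have "(\<integral>\<^sup>+\<omega>. ennreal ((step_integral W (Suc n) \<tau> c \<omega>)\<^sup>2) \<partial>M)
      = ennreal (\<Sum>i<n. (c i)\<^sup>2 * (\<tau> (Suc i) - \<tau> i)) + ennreal ((c n)\<^sup>2 * (\<tau> (Suc n) - \<tau> n))"
    using expectation_square_increment[OF n Suc.prems(3) V, of "c n"] Suc n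
    unfolding step_integral_Suc by simp
  also have "\<dots> = ennreal (\<Sum>i<Suc n. (c i)\<^sup>2 * (\<tau> (Suc i) - \<tau> i))"
    using n Suc.prems(1) by (subst ennreal_plus[symmetric]) (auto intro!: sum_nonneg
        mult_nonneg_nonneg)
  finally show ?case .
qed

text \<open>Increments are absorbed from the last to the first. Each enlarges the variance of the
  density, hence \<sigma> is generalised in the induction; what remains at the end is
  \<open>V\<close>, known at the initial time.\<close>

lemma expectation_normal_density_step_integral:
  assumes mono: "\<And>i. i < n \<Longrightarrow> \<tau> i \<le> \<tau> (Suc i)" and "0 \<le> \<tau> 0" and "\<tau> n \<le> T"
    and V: "V \<in> borel_measurable (F (\<tau> 0))" and "0 < \<sigma>"
  shows "(\<integral>\<^sup>+\<omega>. ennreal (normal_density 0 \<sigma> (V \<omega> + step_integral W n \<tau> c \<omega>)) \<partial>M)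
    = (\<integral>\<^sup>+\<omega>. ennreal (normal_density 0 (sqrt (\<sigma>\<^sup>2 + (\<Sum>i<n. (c i)\<^sup>2 * (\<tau> (Suc i) - \<tau> i)))) (V \<omega>)) \<partial>M)"
  using assms
proof (induction n arbitrary: \<sigma>)
  case 0
  then show ?case by (simp add: step_integral_def)
next
  case (Suc n)
  have le: "\<tau> i \<le> \<tau> j" if "i \<le> j" "j \<le> Suc n" for i j
    using partition_mono[of "Suc n" \<tau>, OF Suc.prems(1) that] by simp
  have n: "0 \<le> \<tau> n" "\<tau> n \<le> \<tau> (Suc n)"
    using le[of 0 n] le[of n "Suc n"] Suc.prems by auto
  have "0 \<le> \<tau> i \<and> \<tau> i \<le> \<tau> n" if "i \<le> n" for i
    using le[of 0 i] le[of i n] that Suc.prems(2) by auto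
  then have "step_integral W n \<tau> c \<in> borel_measurable (F (\<tau> n))"
    using n Suc.prems(3) by (intro adapted_step_integral) auto
  moreover have "V \<in> borel_measurable (F (\<tau> n))"
    using Suc.prems(2,3) le[of 0 n] n by (intro measurable_F_mono[OF Suc.prems(4)]) auto
  ultimately have V: "(\<lambda>\<omega>. V \<omega> + step_integral W n \<tau> c \<omega>) \<in> borel_measurable (F (\<tau> n))"
    by measurable
  define \<sigma>' where "\<sigma>' = sqrt (\<sigma>\<^sup>2 + (c n)\<^sup>2 * (\<tau> (Suc n) - \<tau> n))"
  have pos: "0 < \<sigma>\<^sup>2 + (c n)\<^sup>2 * (\<tau> (Suc n) - \<tau> n)"
    using \<open>0 < \<sigma>\<close> n by (intro add_pos_nonneg) auto
  then have \<sigma>': "0 < \<sigma>'" "\<sigma>'\<^sup>2 = \<sigma>\<^sup>2 + (c n)\<^sup>2 * (\<tau> (Suc n) - \<tau> n)"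
    by (auto simp: \<sigma>'_def)
  have "(\<integral>\<^sup>+\<omega>. ennreal (normal_density 0 \<sigma> (V \<omega> + step_integral W (Suc n) \<tau> c \<omega>)) \<partial>M)
      = (\<integral>\<^sup>+\<omega>. ennreal (normal_density 0 \<sigma>' (V \<omega> + step_integral W n \<tau> c \<omega>)) \<partial>M)"
    using expectation_normal_density_increment[OF n Suc.prems(3) V \<open>0 < \<sigma>\<close>, of "c n"]
    unfolding step_integral_Suc \<sigma>'_def by (simp add: add.assoc)
  also have "\<dots> = (\<integral>\<^sup>+\<omega>. ennreal (normal_density 0
      (sqrt (\<sigma>'\<^sup>2 + (\<Sum>i<n. (c i)\<^sup>2 * (\<tau> (Suc i) - \<tau> i)))) (V \<omega>)) \<partial>M)"
    using Suc.prems n(2) \<sigma>'(1) by (intro Suc.IH) (auto intro: order_trans[OF n(2)])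
  finally show ?case
    unfolding \<sigma>'(2) by (simp add: ac_simps)
qed


lemma normal_density_le: "0 < \<sigma> \<Longrightarrow> normal_density \<mu> \<sigma> x \<le> 1 / \<sigma>"
proof -
  assume \<sigma>: "0 < \<sigma>"
  have "1 * \<sigma>\<^sup>2 \<le> (2 * pi) * \<sigma>\<^sup>2"
    using pi_gt3 by (intro mult_right_mono) auto
  then have "sqrt (\<sigma>\<^sup>2) \<le> sqrt (2 * pi * \<sigma>\<^sup>2)"
    by (intro real_sqrt_le_mono) simp
  then have "\<sigma> \<le> sqrt (2 * pi * \<sigma>\<^sup>2)"
    using \<sigma> by simp
  then have "1 / sqrt (2 * pi * \<sigma>\<^sup>2) * exp (- (x - \<mu>)\<^sup>2 / (2 * \<sigma>\<^sup>2)) \<le> 1 / \<sigma> * 1"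
    using \<sigma> by (intro mult_mono divide_left_mono) auto
  then show ?thesis
    by (simp add: normal_density_def)
qed

text \<open>The step integral is cut at time \<open>r\<close>. The part before \<open>r\<close> is
  known at \<open>r\<close> and joins \<open>V\<close>; the part after \<open>r\<close> turns the
  density into one of variance at least \<open>?v\<close>, whose maximum is at most
  \<open>1 / sqrt ?v\<close> whatever \<open>V\<close> is.\<close>

lemma expectation_normal_density_le:
  assumes mono: "\<And>i. i < n \<Longrightarrow> \<tau> i \<le> \<tau> (Suc i)" and \<tau>: "0 \<le> \<tau> 0" "\<tau> n \<le> T"
    and r: "r \<in> {0..T}" and V: "V \<in> borel_measurable (F r)" and "0 < \<sigma>"
    and pos: "0 < (\<Sum>i<n. (c i)\<^sup>2 * (max (\<tau> (Suc i)) r - max (\<tau> i) r))" (is "0 < ?v")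
  shows "(\<integral>\<^sup>+\<omega>. ennreal (normal_density 0 \<sigma> (V \<omega> + step_integral W n \<tau> c \<omega>)) \<partial>M) \<le> ennreal (1 /
      sqrt ?v)"
proof -
  have le: "\<tau> i \<le> \<tau> j" if "i \<le> j" "j \<le> n" for i j
    using partition_mono[of n \<tau>, OF mono that] by simp
  have range: "0 \<le> \<tau> i \<and> \<tau> i \<le> T" if "i \<le> n" for i
    using le[of 0 i] le[of i n] that \<tau> by auto
  define lo where "lo i = min (\<tau> i) r" for i
  define hi where "hi i = max (\<tau> i) r" for i
  \<comment> \<open>\<open>lo i\<close> and \<open>hi i\<close> are \<open>\<tau> i\<close> and
    \<open>r\<close> in some order. Subtracting this identity for consecutive indices cuts every
    increment at \<open>r\<close> without a case distinction on the position of
    \<open>r\<close>.\<close>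
  have *: "W (\<tau> i) \<omega> + W r \<omega> = W (lo i) \<omega> + W (hi i) \<omega>" for i \<omega>
    by (auto simp: lo_def hi_def min_def max_def)
  have "W (\<tau> (Suc i)) \<omega> - W (\<tau> i) \<omega> = (W (lo (Suc i)) \<omega> - W (lo i) \<omega>) + (W (hi (Suc i)) \<omega> - W (hi
      i) \<omega>)"
    for i \<omega>
    using *[of i \<omega>] *[of "Suc i" \<omega>] by linarith
  then have split: "step_integral W n \<tau> c \<omega> = step_integral W n lo c \<omega> + step_integral W n hi c \<omega>"
      for \<omega>
    by (simp add: step_integral_def distrib_left sum.distrib)
  have hi: "hi i \<le> hi (Suc i)" if "i < n" for i
    using mono[OF that] by (auto simp: hi_def)
  have hi_range: "0 \<le> hi 0" "hi 0 \<le> T" "r \<le> hi 0" "hi n \<le> T"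
    using range[of 0] range[of n] r by (auto simp: hi_def)
  have "step_integral W n lo c \<in> borel_measurable (F r)"
    using range r by (intro adapted_step_integral) (auto simp: lo_def)
  then have Vr: "(\<lambda>\<omega>. V \<omega> + step_integral W n lo c \<omega>) \<in> borel_measurable (F r)"
    using V by measurable
  have V': "(\<lambda>\<omega>. V \<omega> + step_integral W n lo c \<omega>) \<in> borel_measurable (F (hi 0))"
    by (rule measurable_F_mono[OF Vr r]) (use hi_range in auto)
  have v: "(\<Sum>i<n. (c i)\<^sup>2 * (hi (Suc i) - hi i)) = ?v"
    by (simp add: hi_def)
  have "(\<integral>\<^sup>+\<omega>. ennreal (normal_density 0 \<sigma> (V \<omega> + step_integral W n \<tau> c \<omega>)) \<partial>M)
      = (\<integral>\<^sup>+\<omega>. ennreal (normal_density 0 (sqrt (\<sigma>\<^sup>2 + ?v)) (V \<omega> + step_integral W n lo c \<omega>)) \<partial>M)"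
    using expectation_normal_density_step_integral[OF hi hi_range(1,4) V' \<open>0 < \<sigma>\<close>, of c]
    unfolding split v by (simp add: add.assoc)
  also have "\<dots> \<le> (\<integral>\<^sup>+\<omega>. ennreal (1 / sqrt ?v) \<partial>M)"
  proof (intro nn_integral_mono ennreal_leI)
    fix \<omega>
    have "normal_density 0 (sqrt (\<sigma>\<^sup>2 + ?v)) (V \<omega> + step_integral W n lo c \<omega>) \<le> 1 / sqrt (\<sigma>\<^sup>2 + ?v)"
      using pos by (intro normal_density_le) (auto intro: add_nonneg_pos)
    also have "\<dots> \<le> 1 / sqrt ?v"
      using pos by (intro divide_left_mono mult_pos_pos real_sqrt_gt_zero add_nonneg_pos) auto
    finally show "normal_density 0 (sqrt (\<sigma>\<^sup>2 + ?v)) (V \<omega> + step_integral W n lo c \<omega>) \<le> 1 / sqrt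
        ?v" .
  qed
  also have "\<dots> = ennreal (1 / sqrt ?v)"
    by (simp add: emeasure_space_1)
  finally show ?thesis .
qed

end

section \<open>Convergence in mean square\<close>

lemma L2_convergence_AE_subseq:
  fixes X :: "nat \<Rightarrow> 'a \<Rightarrow> real"
  assumes [measurable]: "\<And>k. X k \<in> borel_measurable M" "I \<in> borel_measurable M"
    and lim: "(\<lambda>k. \<integral>\<^sup>+\<omega>. ennreal ((X k \<omega> - I \<omega>)\<^sup>2) \<partial>M) \<longlonglongrightarrow> 0"
  obtains r where "strict_mono r" and "AE \<omega> in M. (\<lambda>k. X (r k) \<omega>) \<longlonglongrightarrow> I \<omega>"
proof -
  \<comment> \<open>The extraction of an almost surely convergent subsequence from L1 convergence
    wants every member integrable, whereas mean-square convergence makes the errors finite only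
    eventually; the first \<open>N\<close> members are dropped.\<close>
  have "\<forall>\<^sub>F k in sequentially. (\<integral>\<^sup>+\<omega>. ennreal ((X k \<omega> - I \<omega>)\<^sup>2) \<partial>M) < 1"
    by (rule order_tendstoD(2)[OF lim]) simp
  then obtain N where N: "\<And>k. N \<le> k \<Longrightarrow> (\<integral>\<^sup>+\<omega>. ennreal ((X k \<omega> - I \<omega>)\<^sup>2) \<partial>M) < 1"
    by (auto simp: eventually_sequentially)
  define u where "u k \<omega> = (X (k + N) \<omega> - I \<omega>)\<^sup>2" for k \<omega>
  have int: "integrable M (u k)" for k
  proof (rule integrableI_bounded)
    show "u k \<in> borel_measurable M"
      unfolding u_def by measurable
    have "(\<integral>\<^sup>+\<omega>. ennreal (norm (u k \<omega>)) \<partial>M) < 1"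
      using N[of "k + N"] by (simp add: u_def)
    then show "(\<integral>\<^sup>+\<omega>. ennreal (norm (u k \<omega>)) \<partial>M) < \<infinity>"
      by (rule order.strict_trans) simp
  qed
  have "(\<lambda>k. enn2real (\<integral>\<^sup>+\<omega>. ennreal ((X (k + N) \<omega> - I \<omega>)\<^sup>2) \<partial>M)) \<longlonglongrightarrow> 0"
    using LIMSEQ_ignore_initial_segment[OF lim, of N] by (intro tendsto_enn2real) auto
  then have "(\<lambda>k. \<integral>\<omega>. norm (u k \<omega>) \<partial>M) \<longlonglongrightarrow> 0"
    by (subst integral_eq_nn_integral) (auto simp: u_def)
  then obtain r :: "nat \<Rightarrow> nat" where r: "strict_mono r" "AE \<omega> in M. (\<lambda>k. u (r k) \<omega>) \<longlonglongrightarrow> 0"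
    using tendsto_L1_AE_subseq[of M u, OF int] by auto
  show thesis
  proof (rule that[of "\<lambda>k. r k + N"])
    show "strict_mono (\<lambda>k. r k + N)"
      using r(1) by (simp add: strict_mono_def)
    show "AE \<omega> in M. (\<lambda>k. X (r k + N) \<omega>) \<longlonglongrightarrow> I \<omega>"
      using r(2)
    proof eventually_elim
      case (elim \<omega>)
      then have "(\<lambda>k. sqrt (u (r k) \<omega>)) \<longlonglongrightarrow> sqrt 0"
        by (intro tendsto_intros)
      then have "(\<lambda>k. X (r k + N) \<omega> - I \<omega>) \<longlonglongrightarrow> 0"
        by (simp add: u_def tendsto_rabs_zero_iff)
      then show ?case
        by (simp add: LIM_zero_iff)
    qed
  qed
qed

lemma ennreal_square_add_le:
  "ennreal ((x :: real)\<^sup>2) \<le> 2 * ennreal (y\<^sup>2) + 2 * ennreal ((y - x)\<^sup>2)"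
proof -
  \<comment> \<open>This square is exactly the difference of the two sides.\<close>
  have "0 \<le> (x - 2 * y)\<^sup>2"
    by simp
  then have "x\<^sup>2 \<le> 2 * y\<^sup>2 + 2 * (y - x)\<^sup>2"
    by (simp add: power2_eq_square algebra_simps)
  then have "ennreal (x\<^sup>2) \<le> ennreal (2 * y\<^sup>2 + 2 * (y - x)\<^sup>2)"
    by (rule ennreal_leI)
  then show ?thesis
    by (simp add: ennreal_mult')
qed

lemma set_nn_integral_square_add_le:
  fixes f g :: "'a \<Rightarrow> real"
  assumes [measurable]: "f \<in> borel_measurable M" "g \<in> borel_measurable M" "A \<in> sets M"
  shows "(\<integral>\<^sup>+s\<in>A. ennreal ((f s)\<^sup>2) \<partial>M)
    \<le> 2 * (\<integral>\<^sup>+s\<in>A. ennreal ((g s)\<^sup>2) \<partial>M) + 2 * (\<integral>\<^sup>+s\<in>A. ennreal ((g s - f s)\<^sup>2) \<partial>M)"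
proof -
  have "(\<integral>\<^sup>+s\<in>A. ennreal ((f s)\<^sup>2) \<partial>M)
      \<le> (\<integral>\<^sup>+s. 2 * (ennreal ((g s)\<^sup>2) * indicator A s) + 2 * (ennreal ((g s - f s)\<^sup>2) * indicator A
          s) \<partial>M)"
    using ennreal_square_add_le by (intro nn_integral_mono) (auto simp: indicator_def)
  also have "\<dots> = 2 * (\<integral>\<^sup>+s\<in>A. ennreal ((g s)\<^sup>2) \<partial>M) + 2 * (\<integral>\<^sup>+s\<in>A. ennreal ((g s - f s)\<^sup>2) \<partial>M)"
    by (simp add: nn_integral_add nn_integral_cmult)
  finally show ?thesis .
qed

section \<open>Wiener integrals\<close>

text \<open>The constant is 9 = 3 * 3: one factor bounds the square root of 2 pi, the other bounds
  the exponential, whose exponent is at most 1 on the ball.\<close>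

lemma normal_density_ge_on_ball:
  assumes "0 < \<eta>" and "\<bar>u\<bar> \<le> \<eta>"
  shows "1 \<le> 9 * \<eta> * normal_density 0 \<eta> u"
proof -
  have "u\<^sup>2 \<le> \<eta>\<^sup>2"
    using power_mono[OF assms(2), of 2] by simp
  then have "u\<^sup>2 / (2 * \<eta>\<^sup>2) \<le> 1"
    using assms(1) order_trans[of "u\<^sup>2" "\<eta>\<^sup>2" "2 * \<eta>\<^sup>2"] by (simp add: divide_le_eq)
  then have "exp (u\<^sup>2 / (2 * \<eta>\<^sup>2)) \<le> exp 1"
    by simp
  then have e: "exp (u\<^sup>2 / (2 * \<eta>\<^sup>2)) \<le> 3"
    using exp_le by linarith
  have "2 * pi * \<eta>\<^sup>2 \<le> (3 * \<eta>)\<^sup>2"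
    using pi_less_4 mult_right_mono[of "2 * pi" 9 "\<eta>\<^sup>2"] by (simp add: power_mult_distrib)
  then have "sqrt (2 * pi * \<eta>\<^sup>2) \<le> 3 * \<eta>"
    using assms(1) by (intro real_le_lsqrt) auto
  then have "sqrt (2 * pi * \<eta>\<^sup>2) * exp (u\<^sup>2 / (2 * \<eta>\<^sup>2)) \<le> (3 * \<eta>) * 3"
    using e assms(1) by (intro mult_mono) auto
  moreover have "0 < sqrt (2 * pi * \<eta>\<^sup>2)"
    using assms(1) by simp
  ultimately show ?thesis
    unfolding normal_density_def using assms(1)
    by (simp add: exp_minus field_simps)
qed

lemma borel_measurable_step_function: "step_function n \<tau> c \<in> borel_measurable borel"
  unfolding step_function_def[abs_def] by measurable

context brownian_motion
begin

lemma wiener_integral_approx: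
  assumes I: "is_wiener_integral M W 0 t f I" and t: "t \<in> {0..T}"
  obtains n \<tau> c where
    "\<And>k i. i < n k \<Longrightarrow> \<tau> k i \<le> \<tau> k (Suc i)" "\<And>k i. i \<le> n k \<Longrightarrow> \<tau> k i \<in> {0..t}"
    "\<And>k. step_integral W (n k) (\<tau> k) (c k) \<in> borel_measurable (F t)"
    "(\<lambda>k. \<integral>\<^sup>+s\<in>{0..t}. ennreal ((step_function (n k) (\<tau> k) (c k) s - f s)\<^sup>2) \<partial>lborel) \<longlonglongrightarrow> 0"
    "(\<lambda>k. \<integral>\<^sup>+\<omega>. ennreal ((step_integral W (n k) (\<tau> k) (c k) \<omega> - I \<omega>)\<^sup>2) \<partial>M) \<longlonglongrightarrow> 0"
proof -
  from I obtain n :: "nat \<Rightarrow> nat" and \<tau> c :: "nat \<Rightarrow> nat \<Rightarrow> real" where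
    \<tau>: "\<And>k. 0 \<le> \<tau> k 0 \<and> (\<forall>i<n k. \<tau> k i \<le> \<tau> k (Suc i)) \<and> \<tau> k (n k) \<le> t" and
    lim: "(\<lambda>k. \<integral>\<^sup>+s\<in>{0..t}. ennreal ((step_function (n k) (\<tau> k) (c k) s - f s)\<^sup>2) \<partial>lborel) \<longlonglongrightarrow> 0"
    "(\<lambda>k. \<integral>\<^sup>+\<omega>. ennreal ((step_integral W (n k) (\<tau> k) (c k) \<omega> - I \<omega>)\<^sup>2) \<partial>M) \<longlonglongrightarrow> 0"
    unfolding is_wiener_integral_def by auto
  have mono: "\<tau> k i \<le> \<tau> k j" if "i \<le> j" "j \<le> n k" for i j k
    using partition_mono[of "n k" "\<tau> k", OF _ that] \<tau> by auto
  have range: "\<tau> k i \<in> {0..t}" if "i \<le> n k" for k i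
    using mono[of 0 i k] mono[of i "n k" k] \<tau>[of k] that by auto
  show thesis
  proof (rule that[of n \<tau> c])
    show "\<And>k i. i < n k \<Longrightarrow> \<tau> k i \<le> \<tau> k (Suc i)"
      using \<tau> by auto
    show "step_integral W (n k) (\<tau> k) (c k) \<in> borel_measurable (F t)" for k
      using range t by (intro adapted_step_integral) auto
  qed (fact range lim)+
qed

lemma wiener_integral_measurable:
  assumes "is_wiener_integral M W a t f I"
  shows "I \<in> borel_measurable M"
  using assms unfolding is_wiener_integral_def by simp

text \<open>A subsequence of the adapted step integrals converges almost surely, so \<open>I\<close>
  agrees with an adapted variable off a null set. Null sets of \<open>M\<close> in
  \<open>F t\<close> then make the given version adapted.\<close>

lemma wiener_integral_adapted:
  assumes I: "is_wiener_integral M W 0 t f I" and t: "t \<in> {0..T}" and "complete_subalgebra M (F t)"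
  shows "I \<in> borel_measurable (F t)"
proof -
  interpret S: complete_subalgebra M "F t"
    by fact
  obtain n \<tau> c where S: "\<And>k. step_integral W (n k) (\<tau> k) (c k) \<in> borel_measurable (F t)"
    "(\<lambda>k. \<integral>\<^sup>+\<omega>. ennreal ((step_integral W (n k) (\<tau> k) (c k) \<omega> - I \<omega>)\<^sup>2) \<partial>M) \<longlonglongrightarrow> 0"
    by (rule wiener_integral_approx[OF I t]) (rule that)
  obtain r where ae: "AE \<omega> in M. (\<lambda>k. step_integral W (n (r k)) (\<tau> (r k)) (c (r k)) \<omega>) \<longlonglongrightarrow> I \<omega>"
    by (rule L2_convergence_AE_subseq[OF measurable_F_imp[OF S(1) t] wiener_integral_measurable[OF
        I] S(2)])
      (rule that)
  show ?thesis
  proof (rule S.measurable_AE_eq)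
    show "(\<lambda>\<omega>. lim (\<lambda>k. step_integral W (n (r k)) (\<tau> (r k)) (c (r k)) \<omega>)) \<in> borel_measurable (F t)"
      by (rule borel_measurable_lim_metric) (rule S(1))
    show "AE \<omega> in M. I \<omega> = lim (\<lambda>k. step_integral W (n (r k)) (\<tau> (r k)) (c (r k)) \<omega>)"
      using ae by eventually_elim (rule limI[symmetric])
  qed
qed

text \<open>The isometry would give the factor 1. The factor 4 comes from two applications of
  \<open>ennreal_square_add_le\<close>, to the random variables and to the integrands, and suffices
  because finiteness is what is wanted.\<close>

lemma wiener_integral_second_moment:
  assumes I: "is_wiener_integral M W 0 t f I" and t: "t \<in> {0..T}" and f: "set_borel_measurable
      borel {0..t} f"
  shows "(\<integral>\<^sup>+\<omega>. ennreal ((I \<omega>)\<^sup>2) \<partial>M) \<le> 4 * (\<integral>\<^sup>+s\<in>{0..t}. ennreal ((f s)\<^sup>2) \<partial>lborel)"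
    (is "_ \<le> 4 * ?q")
proof -
  obtain n \<tau> c where \<tau>: "\<And>k i. i < n k \<Longrightarrow> \<tau> k i \<le> \<tau> k (Suc i)" "\<And>k i. i \<le> n k \<Longrightarrow> \<tau> k i \<in> {0..t}"
    and S: "\<And>k. step_integral W (n k) (\<tau> k) (c k) \<in> borel_measurable (F t)"
    and lim: "(\<lambda>k. \<integral>\<^sup>+s\<in>{0..t}. ennreal ((step_function (n k) (\<tau> k) (c k) s - f s)\<^sup>2) \<partial>lborel) \<longlonglongrightarrow> 0"
      (is "(\<lambda>k. ?e k) \<longlonglongrightarrow> 0")
    "(\<lambda>k. \<integral>\<^sup>+\<omega>. ennreal ((step_integral W (n k) (\<tau> k) (c k) \<omega> - I \<omega>)\<^sup>2) \<partial>M) \<longlonglongrightarrow> 0"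
      (is "(\<lambda>k. ?d k) \<longlonglongrightarrow> 0")
    by (rule wiener_integral_approx[OF I t]) (rule that)
  let ?S = "\<lambda>k. step_integral W (n k) (\<tau> k) (c k)" and ?s = "\<lambda>k. step_function (n k) (\<tau> k) (c k)"
  define f' where "f' s = indicator {0..t} s * f s" for s
  have [measurable]: "f' \<in> borel_measurable borel" "\<And>k. ?s k \<in> borel_measurable borel"
    using f by (simp_all add: f'_def[abs_def] set_borel_measurable_def
        borel_measurable_step_function)
  have f'_eq: "(\<integral>\<^sup>+s\<in>{0..t}. ennreal ((f' s)\<^sup>2) \<partial>lborel) = ?q"
    "(\<integral>\<^sup>+s\<in>{0..t}. ennreal ((f' s - ?s k s)\<^sup>2) \<partial>lborel) = ?e k" for k
    by (auto intro!: nn_integral_cong simp: f'_def indicator_def power2_commute)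
  have [measurable]: "I \<in> borel_measurable M" "\<And>k. ?S k \<in> borel_measurable M"
    using wiener_integral_measurable[OF I] measurable_F_imp[OF S t] by auto
  have "(\<integral>\<^sup>+\<omega>. ennreal ((I \<omega>)\<^sup>2) \<partial>M) \<le> 4 * ?q + 4 * ?e k + 2 * ?d k" for k
  proof -
    have "(\<integral>\<^sup>+\<omega>. ennreal ((?S k \<omega>)\<^sup>2) \<partial>M) = (\<integral>\<^sup>+s\<in>{0..t}. ennreal ((?s k s)\<^sup>2) \<partial>lborel)"
    proof -
      have \<tau>0: "0 \<le> \<tau> k 0" and \<tau>n: "\<tau> k (n k) \<le> T" and t0: "0 \<le> t"
        using \<tau>(2)[of 0 k] \<tau>(2)[of "n k" k] t by auto
      have "(\<integral>\<^sup>+s\<in>{0..t}. ennreal ((?s k s)\<^sup>2) \<partial>lborel)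
          = ennreal (\<Sum>i<n k. (c k i)\<^sup>2 * (max (\<tau> k (Suc i)) 0 - max (\<tau> k i) 0))"
        by (rule nn_integral_step_function_square) (use \<tau>[of _ k] t0 in auto)
      also have "(\<Sum>i<n k. (c k i)\<^sup>2 * (max (\<tau> k (Suc i)) 0 - max (\<tau> k i) 0))
          = (\<Sum>i<n k. (c k i)\<^sup>2 * (\<tau> k (Suc i) - \<tau> k i))"
        using \<tau>(2)[of _ k] by (intro sum.cong) (auto simp: max_absorb1)
      finally show ?thesis
        using expectation_step_integral_square[OF \<tau>(1) \<tau>0 \<tau>n, of "c k"] by simp
    qed
    also have "\<dots> \<le> 2 * ?q + 2 * ?e k"
      using set_nn_integral_square_add_le[of "?s k" lborel f' "{0..t}"] unfolding f'_eq by simp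
    finally have "2 * (\<integral>\<^sup>+\<omega>. ennreal ((?S k \<omega>)\<^sup>2) \<partial>M) \<le> 2 * (2 * ?q + 2 * ?e k)"
      by (rule mult_left_mono) simp
    also have "\<dots> = 4 * ?q + 4 * ?e k"
      by (simp add: distrib_left flip: mult.assoc)
    finally have "2 * (\<integral>\<^sup>+\<omega>. ennreal ((?S k \<omega>)\<^sup>2) \<partial>M) \<le> 4 * ?q + 4 * ?e k" .
    moreover have "(\<integral>\<^sup>+\<omega>. ennreal ((I \<omega>)\<^sup>2) \<partial>M) \<le> 2 * (\<integral>\<^sup>+\<omega>. ennreal ((?S k \<omega>)\<^sup>2) \<partial>M) + 2 * ?d k"
    proof -
      have "(\<integral>\<^sup>+\<omega>. ennreal ((I \<omega>)\<^sup>2) \<partial>M)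
          \<le> (\<integral>\<^sup>+\<omega>. 2 * ennreal ((?S k \<omega>)\<^sup>2) + 2 * ennreal ((?S k \<omega> - I \<omega>)\<^sup>2) \<partial>M)"
        by (intro nn_integral_mono ennreal_square_add_le)
      then show ?thesis
        by (simp add: nn_integral_add nn_integral_cmult)
    qed
    ultimately show ?thesis
      by (meson add_mono order_refl order_trans)
  qed
  moreover have "(\<lambda>k. 4 * ?q + 4 * ?e k + 2 * ?d k) \<longlonglongrightarrow> 4 * ?q + 4 * 0 + 2 * 0"
    by (intro tendsto_add tendsto_const ennreal_tendsto_cmult lim) auto
  ultimately show ?thesis
    by (intro LIMSEQ_le_const) auto
qed

text \<open>Once a step function is within \<open>q / 4\<close> of \<open>f\<close> in mean square,
  \<open>q \<le> 2 * v + 2 * (q / 4)\<close> forces its variance \<open>v\<close> on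
  \<open>{r..t}\<close> to be at least \<open>q / 4\<close>, which yields the 2 in the bound. The
  bound passes to \<open>I\<close> along an almost surely convergent subsequence, dominated by
  \<open>1 / \<sigma>\<close>. It is free of \<sigma>, so the width of the density may later
  shrink.\<close>

lemma wiener_integral_normal_density_le:
  assumes I: "is_wiener_integral M W 0 t f I" and t: "t \<in> {0..T}" and r: "0 \<le> r" "r \<le> t"
    and f: "set_borel_measurable borel {0..t} f"
    and q: "ennreal q \<le> (\<integral>\<^sup>+s\<in>{r..t}. ennreal ((f s)\<^sup>2) \<partial>lborel)" "0 < q"
    and V: "V \<in> borel_measurable (F r)" and "0 < \<sigma>"
  shows "(\<integral>\<^sup>+\<omega>. ennreal (normal_density 0 \<sigma> (V \<omega> + I \<omega>)) \<partial>M) \<le> ennreal (2 / sqrt q)"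
proof -
  obtain n \<tau> c where \<tau>: "\<And>k i. i < n k \<Longrightarrow> \<tau> k i \<le> \<tau> k (Suc i)" "\<And>k i. i \<le> n k \<Longrightarrow> \<tau> k i \<in> {0..t}"
    and S: "\<And>k. step_integral W (n k) (\<tau> k) (c k) \<in> borel_measurable (F t)"
    and lim: "(\<lambda>k. \<integral>\<^sup>+s\<in>{0..t}. ennreal ((step_function (n k) (\<tau> k) (c k) s - f s)\<^sup>2) \<partial>lborel) \<longlonglongrightarrow> 0"
      (is "(\<lambda>k. ?e k) \<longlonglongrightarrow> 0")
    "(\<lambda>k. \<integral>\<^sup>+\<omega>. ennreal ((step_integral W (n k) (\<tau> k) (c k) \<omega> - I \<omega>)\<^sup>2) \<partial>M) \<longlonglongrightarrow> 0"
    by (rule wiener_integral_approx[OF I t]) (rule that)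
  let ?S = "\<lambda>k. step_integral W (n k) (\<tau> k) (c k)" and ?s = "\<lambda>k. step_function (n k) (\<tau> k) (c k)"
  let ?v = "\<lambda>k. \<Sum>i<n k. (c k i)\<^sup>2 * (max (\<tau> k (Suc i)) r - max (\<tau> k i) r)"
  have rT: "r \<in> {0..T}"
    using r t by auto
  define f' where "f' s = indicator {0..t} s * f s" for s
  have [measurable]: "f' \<in> borel_measurable borel" "\<And>k. ?s k \<in> borel_measurable borel"
    using f by (simp_all add: f'_def[abs_def] set_borel_measurable_def
        borel_measurable_step_function)
  have [measurable]: "I \<in> borel_measurable M" "\<And>k. ?S k \<in> borel_measurable M" "V \<in>
      borel_measurable M"
    using wiener_integral_measurable[OF I] measurable_F_imp[OF S t] measurable_F_imp[OF V rT] by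
        auto
  have "\<forall>\<^sub>F k in sequentially. ?e k < ennreal (q / 4)"
    using q(2) by (intro order_tendstoD(2)[OF lim(1)]) simp
  then have "\<forall>\<^sub>F k in sequentially. q / 4 \<le> ?v k"
  proof eventually_elim
    case (elim k)
    have "ennreal q \<le> (\<integral>\<^sup>+s\<in>{r..t}. ennreal ((f' s)\<^sup>2) \<partial>lborel)"
      using q(1) r by (auto intro!: nn_integral_mono elim!: order_trans simp: f'_def indicator_def)
    also have "\<dots> \<le> 2 * (\<integral>\<^sup>+s\<in>{r..t}. ennreal ((?s k s)\<^sup>2) \<partial>lborel)
        + 2 * (\<integral>\<^sup>+s\<in>{r..t}. ennreal ((?s k s - f' s)\<^sup>2) \<partial>lborel)"
      by (rule set_nn_integral_square_add_le) auto
    also have "\<dots> \<le> 2 * ennreal (?v k) + 2 * ennreal (q / 4)"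
    proof (intro add_mono mult_left_mono)
      show "(\<integral>\<^sup>+s\<in>{r..t}. ennreal ((?s k s)\<^sup>2) \<partial>lborel) \<le> ennreal (?v k)"
        using \<tau>(2)[of _ k] r by (subst nn_integral_step_function_square) (auto simp: \<tau>(1))
      have "(\<integral>\<^sup>+s\<in>{r..t}. ennreal ((?s k s - f' s)\<^sup>2) \<partial>lborel) \<le> ?e k"
        using r by (intro nn_integral_mono) (auto simp: f'_def indicator_def)
      then show "(\<integral>\<^sup>+s\<in>{r..t}. ennreal ((?s k s - f' s)\<^sup>2) \<partial>lborel) \<le> ennreal (q / 4)"
        using elim by simp
    qed auto
    also have "\<dots> = ennreal (2 * ?v k + q / 2)"
    proof -
      have "0 \<le> ?v k"
        using \<tau>(1)[of _ k] by (intro sum_nonneg mult_nonneg_nonneg) (auto simp: max.coboundedI1)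
      moreover have "2 * ennreal y = ennreal (2 * y)" for y
        by (simp add: ennreal_mult')
      ultimately show ?thesis
        using q(2) by (simp flip: ennreal_plus)
    qed
    finally have "q \<le> 2 * ?v k + q / 2"
      using q(2) by (subst (asm) ennreal_le_iff2) auto
    then show ?case
      by simp
  qed
  then have bound: "\<forall>\<^sub>F k in sequentially.
      (\<integral>\<^sup>+\<omega>. ennreal (normal_density 0 \<sigma> (V \<omega> + ?S k \<omega>)) \<partial>M) \<le> ennreal (2 / sqrt q)"
  proof eventually_elim
    case (elim k)
    have v: "0 < ?v k"
      using elim q(2) by linarith
    have "(\<integral>\<^sup>+\<omega>. ennreal (normal_density 0 \<sigma> (V \<omega> + ?S k \<omega>)) \<partial>M) \<le> ennreal (1 / sqrt (?v k))"
      using \<tau>(2)[of 0 k] \<tau>(2)[of "n k" k] t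
      by (intro expectation_normal_density_le[OF \<tau>(1) _ _ rT V \<open>0 < \<sigma>\<close> v]) auto
    also have "\<dots> \<le> ennreal (2 / sqrt q)"
    proof (rule ennreal_leI)
      have "sqrt (q / 4) \<le> sqrt (?v k)"
        using elim by (rule real_sqrt_le_mono)
      then have "1 / sqrt (?v k) \<le> 1 / sqrt (q / 4)"
        using q(2) v by (intro divide_left_mono) auto
      then show "1 / sqrt (?v k) \<le> 2 / sqrt q"
        by (simp add: real_sqrt_divide)
    qed
    finally show ?case .
  qed
  obtain \<rho> where \<rho>: "strict_mono \<rho>" and ae: "AE \<omega> in M. (\<lambda>k. ?S (\<rho> k) \<omega>) \<longlonglongrightarrow> I \<omega>"
    by (rule L2_convergence_AE_subseq[OF _ _ lim(2)]) (auto intro: that)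
  have conv: "(\<lambda>k. \<integral>\<^sup>+\<omega>. ennreal (normal_density 0 \<sigma> (V \<omega> + ?S (\<rho> k) \<omega>)) \<partial>M)
      \<longlonglongrightarrow> (\<integral>\<^sup>+\<omega>. ennreal (normal_density 0 \<sigma> (V \<omega> + I \<omega>)) \<partial>M)"
  proof (rule nn_integral_dominated_convergence)
    show "AE \<omega> in M. ennreal (normal_density 0 \<sigma> (V \<omega> + ?S (\<rho> k) \<omega>)) \<le> ennreal (1 / \<sigma>)" for k
      using normal_density_le[OF \<open>0 < \<sigma>\<close>] by (intro AE_I2 ennreal_leI)
    show "(\<integral>\<^sup>+\<omega>. ennreal (1 / \<sigma>) \<partial>M) < \<infinity>"
      by (simp add: emeasure_space_1)
    show "AE \<omega> in M. (\<lambda>k. ennreal (normal_density 0 \<sigma> (V \<omega> + ?S (\<rho> k) \<omega>)))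
        \<longlonglongrightarrow> ennreal (normal_density 0 \<sigma> (V \<omega> + I \<omega>))"
      using ae
    proof eventually_elim
      case (elim \<omega>)
      then show ?case
        unfolding normal_density_def using \<open>0 < \<sigma>\<close> by (intro tendsto_ennrealI tendsto_intros) auto
    qed
  qed auto
  show ?thesis
  proof (rule tendsto_upperbound[OF conv])
    show "\<forall>\<^sub>F k in sequentially.
        (\<integral>\<^sup>+\<omega>. ennreal (normal_density 0 \<sigma> (V \<omega> + ?S (\<rho> k) \<omega>)) \<partial>M) \<le> ennreal (2 / sqrt q)"
      using bound \<rho> by (rule eventually_subseq[rotated])
  qed simp
qed

text \<open>The indicator of the ball is dominated by \<open>9 * \<eta>\<close> times the density of
  width \<eta>; 18 is 9 times the 2 of the preceding bound.\<close>

lemma wiener_integral_small_ball: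
  assumes I: "is_wiener_integral M W 0 t f I" and t: "t \<in> {0..T}" and r: "0 \<le> r" "r \<le> t"
    and f: "set_borel_measurable borel {0..t} f"
    and q: "ennreal q \<le> (\<integral>\<^sup>+s\<in>{r..t}. ennreal ((f s)\<^sup>2) \<partial>lborel)" "0 < q"
    and V: "V \<in> borel_measurable (F r)" and \<eta>: "0 < \<eta>"
  shows "emeasure M {\<omega> \<in> space M. \<bar>V \<omega> + I \<omega>\<bar> \<le> \<eta>} \<le> ennreal (18 * \<eta> / sqrt q)"
proof -
  have [measurable]: "I \<in> borel_measurable M" "V \<in> borel_measurable M"
    using wiener_integral_measurable[OF I] measurable_F_imp[OF V] r t by auto
  have "emeasure M {\<omega> \<in> space M. \<bar>V \<omega> + I \<omega>\<bar> \<le> \<eta>}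
      = (\<integral>\<^sup>+\<omega>. indicator {\<omega> \<in> space M. \<bar>V \<omega> + I \<omega>\<bar> \<le> \<eta>} \<omega> \<partial>M)"
    by simp
  also have "\<dots> \<le> (\<integral>\<^sup>+\<omega>. ennreal (9 * \<eta>) * ennreal (normal_density 0 \<eta> (V \<omega> + I \<omega>)) \<partial>M)"
    using normal_density_ge_on_ball[OF \<eta>] \<eta>
    by (intro nn_integral_mono) (auto simp: indicator_def normal_density_nonneg simp flip:
        ennreal_mult' ennreal_1 intro!: ennreal_leI)
  also have "\<dots> = ennreal (9 * \<eta>) * (\<integral>\<^sup>+\<omega>. ennreal (normal_density 0 \<eta> (V \<omega> + I \<omega>)) \<partial>M)"
    by (rule nn_integral_cmult) measurable
  also have "\<dots> \<le> ennreal (9 * \<eta>) * ennreal (2 / sqrt q)"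
    by (intro mult_left_mono wiener_integral_normal_density_le[OF I t r f q V \<eta>]) simp
  also have "\<dots> = ennreal (18 * \<eta> / sqrt q)"
    using \<eta> q(2) by (subst ennreal_mult'[symmetric]) auto
  finally show ?thesis .
qed

end

section \<open>Time spent at a level\<close>

context brownian_motion
begin

text \<open>By Fubini: a fixed \<open>s\<close> lies in the window of \<open>t\<close> exactly for
  \<open>t\<close> in \<open>{s..s + \<epsilon>}\<close>, a set of length \<epsilon>. The condition
  \<open>\<epsilon> < \<delta>\<close> keeps all windows inside \<open>{0..T}\<close>.\<close>

lemma sliding_window_integral:
  fixes G :: "real \<Rightarrow> ennreal"
  assumes [measurable]: "G \<in> borel_measurable borel" and "0 < \<delta>" and \<epsilon>: "0 < \<epsilon>" "\<epsilon> < \<delta>"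
  shows "(\<integral>\<^sup>+t\<in>{\<delta>..T}. (\<integral>\<^sup>+s\<in>{t - \<epsilon>..t}. G s \<partial>lborel) \<partial>lborel) \<le> ennreal \<epsilon> * (\<integral>\<^sup>+s\<in>{0..T}. G s
      \<partial>lborel)"
proof -
  have "(\<integral>\<^sup>+t\<in>{\<delta>..T}. (\<integral>\<^sup>+s\<in>{t - \<epsilon>..t}. G s \<partial>lborel) \<partial>lborel)
      \<le> (\<integral>\<^sup>+t. \<integral>\<^sup>+s. G s * (if 0 \<le> s \<and> s \<le> T then 1 else 0) * (if s \<le> t \<and> t \<le> s + \<epsilon> then 1 else 0)
          \<partial>lborel \<partial>lborel)"
  proof (rule nn_integral_mono)
    fix t
    have "(\<integral>\<^sup>+s\<in>{t - \<epsilon>..t}. G s \<partial>lborel) * indicator {\<delta>..T} t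
        = (\<integral>\<^sup>+s. G s * indicator {t - \<epsilon>..t} s * indicator {\<delta>..T} t \<partial>lborel)"
      by (rule nn_integral_multc[symmetric]) measurable
    also have "\<dots> \<le> (\<integral>\<^sup>+s. G s * (if 0 \<le> s \<and> s \<le> T then 1 else 0) * (if s \<le> t \<and> t \<le> s + \<epsilon> then 1
        else 0) \<partial>lborel)"
      using assms by (intro nn_integral_mono) (auto simp: indicator_def)
    finally show "(\<integral>\<^sup>+s\<in>{t - \<epsilon>..t}. G s \<partial>lborel) * indicator {\<delta>..T} t
        \<le> (\<integral>\<^sup>+s. G s * (if 0 \<le> s \<and> s \<le> T then 1 else 0) * (if s \<le> t \<and> t \<le> s + \<epsilon> then 1 else 0)
            \<partial>lborel)" .
  qed
  also have "\<dots> = (\<integral>\<^sup>+s. \<integral>\<^sup>+t. G s * (if 0 \<le> s \<and> s \<le> T then 1 else 0) * (if s \<le> t \<and> t \<le> s + \<epsilon> then 1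
      else 0) \<partial>lborel \<partial>lborel)"
    by (rule lborel_pair.Fubini') measurable
  also have "\<dots> = (\<integral>\<^sup>+s. ennreal \<epsilon> * (G s * indicator {0..T} s) \<partial>lborel)"
  proof (rule nn_integral_cong)
    fix s
    have "(\<integral>\<^sup>+t. G s * (if 0 \<le> s \<and> s \<le> T then 1 else 0) * (if s \<le> t \<and> t \<le> s + \<epsilon> then 1 else 0)
        \<partial>lborel)
        = (\<integral>\<^sup>+t. G s * indicator {0..T} s * indicator {s..s + \<epsilon>} t \<partial>lborel)"
      by (intro nn_integral_cong) (auto simp: indicator_def)
    also have "\<dots> = ennreal \<epsilon> * (G s * indicator {0..T} s)"
      using \<epsilon> by (subst nn_integral_cmult_indicator) (auto simp: mult.commute)
    finally show "(\<integral>\<^sup>+t. G s * (if 0 \<le> s \<and> s \<le> T then 1 else 0) * (if s \<le> t \<and> t \<le> s + \<epsilon> then 1 else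
        0) \<partial>lborel)
        = ennreal \<epsilon> * (G s * indicator {0..T} s)" .
  qed
  also have "\<dots> = ennreal \<epsilon> * (\<integral>\<^sup>+s\<in>{0..T}. G s \<partial>lborel)"
    by (rule nn_integral_cmult) measurable
  finally show ?thesis .
qed

text \<open>On the event \<open>y t + B t = a\<close>, the distance of
  \<open>y (t - \<epsilon>) + B t\<close> from \<open>a\<close> equals the increment of
  \<open>y\<close>. Either it is at most \<eta>, a small ball event with
  \<open>y (t - \<epsilon>) - a\<close> known at time \<open>t - \<epsilon>\<close>, or the
  increment exceeds \<eta>, which Markov's inequality controls.\<close>

lemma hitting_probability_le:
  fixes y B :: "real \<Rightarrow> 'a \<Rightarrow> real" and g :: "real \<Rightarrow> 'a \<Rightarrow> ennreal"
  assumes t: "t \<in> {0<..T}" and \<epsilon>: "0 < \<epsilon>" "\<epsilon> < t" and \<eta>: "0 < \<eta>"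
    and K: "set_borel_measurable borel {0..t} (K t)"
    and q: "ennreal q \<le> (\<integral>\<^sup>+s\<in>{t - \<epsilon>..t}. ennreal ((K t s)\<^sup>2) \<partial>lborel)" "0 < q"
    and I: "is_wiener_integral M W 0 t (K t) (B t)"
    and y: "y (t - \<epsilon>) \<in> borel_measurable (F (t - \<epsilon>))" "y t \<in> borel_measurable M"
    and g: "(\<lambda>(s, \<omega>). g s \<omega>) \<in> borel_measurable (borel \<Otimes>\<^sub>M M)"
    and increment: "\<And>\<omega>. \<omega> \<in> space M \<Longrightarrow> ennreal \<bar>y t \<omega> - y (t - \<epsilon>) \<omega>\<bar> \<le> (\<integral>\<^sup>+s\<in>{t - \<epsilon>..t}. g s \<omega>
        \<partial>lborel)"
  shows "emeasure M {\<omega> \<in> space M. y t \<omega> + B t \<omega> = a}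
    \<le> ennreal (18 * \<eta> / sqrt q) + ennreal (1 / \<eta>) * (\<integral>\<^sup>+s\<in>{t - \<epsilon>..t}. (\<integral>\<^sup>+\<omega>. g s \<omega> \<partial>M) \<partial>lborel)"
proof -
  interpret P: pair_sigma_finite lborel M ..
  note [measurable] = g y(2) wiener_integral_measurable[OF I]
  have r: "t - \<epsilon> \<in> {0..T}"
    using t \<epsilon> by auto
  note [measurable] = measurable_F_imp[OF y(1) r]
  let ?R = "\<lambda>\<omega>. \<integral>\<^sup>+s\<in>{t - \<epsilon>..t}. g s \<omega> \<partial>lborel"
  have R [measurable]: "?R \<in> borel_measurable M"
    by measurable
  have "emeasure M {\<omega> \<in> space M. y t \<omega> + B t \<omega> = a}
      \<le> emeasure M ({\<omega> \<in> space M. \<bar>(y (t - \<epsilon>) \<omega> - a) + B t \<omega>\<bar> \<le> \<eta>} \<union> {\<omega> \<in> space M. 1 \<le> ennreal (1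
          / \<eta>) * ?R \<omega>})"
  proof (rule emeasure_mono)
    show "{\<omega> \<in> space M. y t \<omega> + B t \<omega> = a}
        \<subseteq> {\<omega> \<in> space M. \<bar>(y (t - \<epsilon>) \<omega> - a) + B t \<omega>\<bar> \<le> \<eta>} \<union> {\<omega> \<in> space M. 1 \<le> ennreal (1 / \<eta>) * ?R
            \<omega>}"
    proof
      fix \<omega> assume "\<omega> \<in> {\<omega> \<in> space M. y t \<omega> + B t \<omega> = a}"
      then have \<omega>: "\<omega> \<in> space M" and eq: "y t \<omega> + B t \<omega> = a"
        by auto
      have "\<bar>(y (t - \<epsilon>) \<omega> - a) + B t \<omega>\<bar> = \<bar>y t \<omega> - y (t - \<epsilon>) \<omega>\<bar>"
        using eq by (simp add: abs_if)
      moreover have "1 \<le> ennreal (1 / \<eta>) * ?R \<omega>" if "\<not> \<bar>y t \<omega> - y (t - \<epsilon>) \<omega>\<bar> \<le> \<eta>"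
      proof -
        have "1 = ennreal (1 / \<eta>) * ennreal \<eta>"
          using \<eta> by (simp flip: ennreal_mult')
        also have "\<dots> \<le> ennreal (1 / \<eta>) * ?R \<omega>"
          using that by (intro mult_left_mono order_trans[OF _ increment[OF \<omega>]] ennreal_leI) auto
        finally show ?thesis .
      qed
      ultimately show "\<omega> \<in> {\<omega> \<in> space M. \<bar>(y (t - \<epsilon>) \<omega> - a) + B t \<omega>\<bar> \<le> \<eta>} \<union> {\<omega> \<in> space M. 1 \<le>
          ennreal (1 / \<eta>) * ?R \<omega>}"
        using \<omega> by auto
    qed
  qed measurable
  also have "\<dots> \<le> emeasure M {\<omega> \<in> space M. \<bar>(y (t - \<epsilon>) \<omega> - a) + B t \<omega>\<bar> \<le> \<eta>}
      + emeasure M {\<omega> \<in> space M. 1 \<le> ennreal (1 / \<eta>) * ?R \<omega>}"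
    by (rule emeasure_subadditive) measurable
  also have "\<dots> \<le> ennreal (18 * \<eta> / sqrt q) + ennreal (1 / \<eta>) * (\<integral>\<^sup>+\<omega>. ?R \<omega> \<partial>M)"
  proof (rule add_mono)
    show "emeasure M {\<omega> \<in> space M. \<bar>(y (t - \<epsilon>) \<omega> - a) + B t \<omega>\<bar> \<le> \<eta>} \<le> ennreal (18 * \<eta> / sqrt q)"
    proof (rule wiener_integral_small_ball[OF I _ _ _ K q _ \<eta>])
      show "(\<lambda>\<omega>. y (t - \<epsilon>) \<omega> - a) \<in> borel_measurable (F (t - \<epsilon>))"
        using y(1) by measurable
    qed (use t \<epsilon> in auto)
    show "emeasure M {\<omega> \<in> space M. 1 \<le> ennreal (1 / \<eta>) * ?R \<omega>} \<le> ennreal (1 / \<eta>) * (\<integral>\<^sup>+\<omega>. ?R \<omega> \<partial>M)"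
    proof -
      have "(\<lambda>\<omega>. ?R \<omega> * indicator (space M) \<omega>) \<in> borel_measurable M"
        using R by measurable
      then have "emeasure M {\<omega> \<in> space M. 1 \<le> ennreal (1 / \<eta>) * ?R \<omega>}
          \<le> ennreal (1 / \<eta>) * (\<integral>\<^sup>+\<omega>. ?R \<omega> * indicator (space M) \<omega> \<partial>M)"
        by (rule nn_integral_Markov_inequality) simp
      also have "(\<integral>\<^sup>+\<omega>. ?R \<omega> * indicator (space M) \<omega> \<partial>M) = (\<integral>\<^sup>+\<omega>. ?R \<omega> \<partial>M)"
        by (intro nn_integral_cong) simp
      finally show ?thesis .
    qed
  qed
  also have "(\<integral>\<^sup>+\<omega>. ?R \<omega> \<partial>M) = (\<integral>\<^sup>+s. \<integral>\<^sup>+\<omega>. g s \<omega> * indicator {t - \<epsilon>..t} s \<partial>M \<partial>lborel)"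
    by (rule P.Fubini') measurable
  also have "\<dots> = (\<integral>\<^sup>+s\<in>{t - \<epsilon>..t}. (\<integral>\<^sup>+\<omega>. g s \<omega> \<partial>M) \<partial>lborel)"
    by (intro nn_integral_cong nn_integral_multc) measurable
  finally show ?thesis .
qed

text \<open>For a single \<open>t\<close> the mean of \<open>g\<close> over the window need not be
  of order \<epsilon>, since only its integral over \<open>{0..T}\<close> is known to be finite. The
  hitting bound is therefore integrated over \<open>t \<ge> \<delta>\<close> before \<epsilon> tends
  to 0, and Fubini then turns "almost every \<open>t\<close>, almost surely" into the order needed
  path by path.\<close>

lemma AE_not_at_level:
  fixes y B :: "real \<Rightarrow> 'a \<Rightarrow> real" and g :: "real \<Rightarrow> 'a \<Rightarrow> ennreal"
  assumes H: "0 < H" "H < 1" and c: "0 < c"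
    and K: "\<And>t. t \<in> {0..T} \<Longrightarrow> set_borel_measurable borel {0..t} (K t)"
    and nondet: "\<And>t \<epsilon>. t \<in> {0<..T} \<Longrightarrow> \<epsilon> \<in> {0<..<t} \<Longrightarrow>
      ennreal ((c * \<epsilon> powr H)\<^sup>2) \<le> (\<integral>\<^sup>+s\<in>{t - \<epsilon>..t}. ennreal ((K t s)\<^sup>2) \<partial>lborel)"
    and B: "(\<lambda>(t, \<omega>). B t \<omega>) \<in> borel_measurable (borel \<Otimes>\<^sub>M M)"
    and I: "\<And>t. t \<in> {0..T} \<Longrightarrow> is_wiener_integral M W 0 t (K t) (B t)"
    and y: "(\<lambda>(t, \<omega>). y t \<omega>) \<in> borel_measurable (borel \<Otimes>\<^sub>M M)"
    and adapted: "\<And>t. t \<in> {0..T} \<Longrightarrow> y t \<in> borel_measurable (F t)"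
    and g: "(\<lambda>(s, \<omega>). g s \<omega>) \<in> borel_measurable (borel \<Otimes>\<^sub>M M)"
    and increment: "\<And>r t \<omega>. 0 \<le> r \<Longrightarrow> r \<le> t \<Longrightarrow> t \<le> T \<Longrightarrow> \<omega> \<in> space M \<Longrightarrow>
      ennreal \<bar>y t \<omega> - y r \<omega>\<bar> \<le> (\<integral>\<^sup>+s\<in>{r..t}. g s \<omega> \<partial>lborel)"
    and fin: "(\<integral>\<^sup>+s\<in>{0..T}. (\<integral>\<^sup>+\<omega>. g s \<omega> \<partial>M) \<partial>lborel) < \<infinity>"
  shows "AE \<omega> in M. AE t in lborel. t \<in> {0..T} \<longrightarrow> y t \<omega> + B t \<omega> \<noteq> a"
proof -
  interpret P: pair_sigma_finite lborel M ..
  note [measurable] = B y g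
  have yt [measurable]: "y t \<in> borel_measurable M" "B t \<in> borel_measurable M" for t
    by measurable
  define p where "p t = emeasure M {\<omega> \<in> space M. y t \<omega> + B t \<omega> = a}" for t
  define G where "G s = (\<integral>\<^sup>+\<omega>. g s \<omega> \<partial>M)" for s
  have G [measurable]: "G \<in> borel_measurable borel"
    unfolding G_def by measurable
  have "{\<omega> \<in> space M. y t \<omega> + B t \<omega> = a} = Pair t -` {z \<in> space (borel \<Otimes>\<^sub>M M). y (fst z) (snd z) +
      B (fst z) (snd z) = a}" for t
    by (auto simp: space_pair_measure)
  moreover have "{z \<in> space (lborel \<Otimes>\<^sub>M M). y (fst z) (snd z) + B (fst z) (snd z) = a} \<in> sets
      (lborel \<Otimes>\<^sub>M M)"
    by measurable
  ultimately have p [measurable]: "p \<in> borel_measurable borel"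
    unfolding p_def[abs_def]
    using measurable_emeasure_Pair[of "{z \<in> space (lborel \<Otimes>\<^sub>M M). y (fst z) (snd z) + B (fst z)
        (snd z) = a}" lborel]
    by (simp add: space_pair_measure)
  define \<gamma> where "\<gamma> = enn2real (\<integral>\<^sup>+s\<in>{0..T}. G s \<partial>lborel)"
  have \<gamma>: "(\<integral>\<^sup>+s\<in>{0..T}. G s \<partial>lborel) = ennreal \<gamma>"
    unfolding \<gamma>_def using fin by (simp add: G_def)
  have \<gamma>0: "0 \<le> \<gamma>"
    by (simp add: \<gamma>_def)
  \<comment> \<open>With the exponent of \<eta> halfway between \<open>H\<close> and 1, both error
    terms equal \<open>\<epsilon> powr \<kappa>\<close>.\<close>
  define \<kappa> where "\<kappa> = (1 - H) / 2"
  have \<kappa>: "0 < \<kappa>"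
    using H by (simp add: \<kappa>_def)
  have ae\<delta>: "AE t in lborel. t \<in> {\<delta>..T} \<longrightarrow> p t = 0" if \<delta>: "0 < \<delta>" for \<delta>
  proof -
    have bound: "(\<integral>\<^sup>+t\<in>{\<delta>..T}. p t \<partial>lborel) \<le> ennreal ((18 * \<bar>T\<bar> / c + \<gamma>) * \<epsilon> powr \<kappa>)"
      if \<epsilon>: "0 < \<epsilon>" "\<epsilon> < \<delta>" for \<epsilon>
    proof -
      define \<eta> where "\<eta> = \<epsilon> powr ((1 + H) / 2)"
      have \<eta>: "0 < \<eta>"
        using \<epsilon> by (simp add: \<eta>_def)
      have \<eta>1: "\<eta> / \<epsilon> powr H = \<epsilon> powr \<kappa>"
        unfolding \<eta>_def \<kappa>_def powr_diff[symmetric] by (simp add: field_simps)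
      have "\<epsilon> / \<eta> = \<epsilon> powr (1 - (1 + H) / 2)"
        unfolding \<eta>_def powr_diff using \<epsilon> by simp
      then have \<eta>2: "\<epsilon> / \<eta> = \<epsilon> powr \<kappa>"
        unfolding \<kappa>_def by (simp add: field_simps)
      let ?b = "18 * \<eta> / (c * \<epsilon> powr H)"
      have "(\<integral>\<^sup>+t\<in>{\<delta>..T}. p t \<partial>lborel)
          \<le> (\<integral>\<^sup>+t. ennreal ?b * indicator {\<delta>..T} t
            + ennreal (1 / \<eta>) * ((\<integral>\<^sup>+s\<in>{t - \<epsilon>..t}. G s \<partial>lborel) * indicator {\<delta>..T} t) \<partial>lborel)"
      proof (rule nn_integral_mono)
        fix t
        show "p t * indicator {\<delta>..T} t \<le> ennreal ?b * indicator {\<delta>..T} t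
            + ennreal (1 / \<eta>) * ((\<integral>\<^sup>+s\<in>{t - \<epsilon>..t}. G s \<partial>lborel) * indicator {\<delta>..T} t)"
        proof (cases "t \<in> {\<delta>..T}")
          case True
          then have t: "t \<in> {0<..T}" "t \<in> {0..T}" "\<epsilon> < t" "t - \<epsilon> \<in> {0..T}" "\<epsilon> \<in> {0<..<t}"
            using \<delta> \<epsilon> by auto
          have pos: "0 < c * \<epsilon> powr H"
            using c \<epsilon> by simp
          have "p t \<le> ennreal (18 * \<eta> / sqrt ((c * \<epsilon> powr H)\<^sup>2))
              + ennreal (1 / \<eta>) * (\<integral>\<^sup>+s\<in>{t - \<epsilon>..t}. (\<integral>\<^sup>+\<omega>. g s \<omega> \<partial>M) \<partial>lborel)"
            unfolding p_def
          proof (rule hitting_probability_le[where t = t and K = K and \<epsilon> = \<epsilon> and y = y and B = B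
              and g = g, OF t(1) \<epsilon>(1) t(3) \<eta> K[OF t(2)]
                nondet[OF t(1) t(5)] _ I[OF t(2)] adapted[OF t(4)] yt(1)[of t] g])
            show "0 < (c * \<epsilon> powr H)\<^sup>2"
              using pos by (rule zero_less_power)
            show "ennreal \<bar>y t \<omega> - y (t - \<epsilon>) \<omega>\<bar> \<le> (\<integral>\<^sup>+s\<in>{t - \<epsilon>..t}. g s \<omega> \<partial>lborel)"
              if "\<omega> \<in> space M" for \<omega>
              using t \<epsilon> that by (intro increment) auto
          qed
          then show ?thesis
            using True pos by (simp add: G_def)
        qed simp
      qed
      also have "\<dots> = (\<integral>\<^sup>+t. ennreal ?b * indicator {\<delta>..T} t \<partial>lborel)
          + ennreal (1 / \<eta>) * (\<integral>\<^sup>+t\<in>{\<delta>..T}. (\<integral>\<^sup>+s\<in>{t - \<epsilon>..t}. G s \<partial>lborel) \<partial>lborel)"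
      proof -
        have [measurable]: "(\<lambda>t. \<integral>\<^sup>+s\<in>{t - \<epsilon>..t}. G s \<partial>lborel) \<in> borel_measurable borel"
        proof -
          have "(\<lambda>t. \<integral>\<^sup>+s. G s * (if t - \<epsilon> \<le> s \<and> s \<le> t then 1 else 0) \<partial>lborel) \<in> borel_measurable
              borel"
            by measurable
          then show ?thesis
            by (rule measurable_cong[THEN iffD1, rotated]) (auto intro!: nn_integral_cong simp:
                indicator_def)
        qed
        show ?thesis
          by (subst nn_integral_add) (simp_all add: nn_integral_cmult)
      qed
      also have "\<dots> \<le> ennreal (?b * \<bar>T\<bar>) + ennreal (1 / \<eta>) * (ennreal \<epsilon> * ennreal \<gamma>)"
      proof (intro add_mono mult_left_mono)
        have "emeasure lborel {\<delta>..T} \<le> ennreal \<bar>T\<bar>"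
          using \<delta> by (cases "\<delta> \<le> T") (auto intro!: ennreal_leI)
        then have "ennreal ?b * emeasure lborel {\<delta>..T} \<le> ennreal ?b * ennreal \<bar>T\<bar>"
          by (rule mult_left_mono) simp
        then show "(\<integral>\<^sup>+t. ennreal ?b * indicator {\<delta>..T} t \<partial>lborel) \<le> ennreal (?b * \<bar>T\<bar>)"
          by (subst nn_integral_cmult_indicator, simp, subst ennreal_mult'') auto
        show "(\<integral>\<^sup>+t\<in>{\<delta>..T}. (\<integral>\<^sup>+s\<in>{t - \<epsilon>..t}. G s \<partial>lborel) \<partial>lborel) \<le> ennreal \<epsilon> * ennreal \<gamma>"
          using sliding_window_integral[OF G \<delta> \<epsilon>] unfolding \<gamma> .
      qed simp
      also have "\<dots> = ennreal (?b * \<bar>T\<bar> + \<epsilon> / \<eta> * \<gamma>)"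
        using \<eta> \<epsilon> c \<gamma>0 by (simp flip: ennreal_mult' ennreal_plus)
      also have "?b * \<bar>T\<bar> + \<epsilon> / \<eta> * \<gamma> = (18 * \<bar>T\<bar> / c) * (\<eta> / \<epsilon> powr H) + \<epsilon> / \<eta> * \<gamma>"
        by (simp add: field_simps)
      also have "\<dots> = (18 * \<bar>T\<bar> / c + \<gamma>) * \<epsilon> powr \<kappa>"
        unfolding \<eta>1 \<eta>2 by (simp add: algebra_simps)
      finally show ?thesis .
    qed
    \<comment> \<open>The sequence \<open>\<delta> / (n + 2)\<close> stays strictly below \<delta>
      for every \<open>n\<close>, as \<open>bound\<close> demands.\<close>
    have "(\<lambda>n. ennreal ((18 * \<bar>T\<bar> / c + \<gamma>) * (\<delta> / real (n + 2)) powr \<kappa>)) \<longlonglongrightarrow> ennreal ((18 * \<bar>T\<bar> / c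
        + \<gamma>) * 0)"
    proof (intro tendsto_ennrealI tendsto_mult tendsto_const tendsto_zero_powrI)
      show "(\<lambda>n. \<delta> / real (n + 2)) \<longlonglongrightarrow> 0"
        by (intro LIMSEQ_ignore_initial_segment[of "\<lambda>n. \<delta> / real n"] lim_const_over_n)
    qed (use \<kappa> \<delta> in auto)
    moreover have "(\<integral>\<^sup>+t\<in>{\<delta>..T}. p t \<partial>lborel) \<le> ennreal ((18 * \<bar>T\<bar> / c + \<gamma>) * (\<delta> / real (n + 2))
        powr \<kappa>)" for n
      using \<delta> by (intro bound) (auto simp: field_simps intro: add_strict_increasing)
    ultimately have "(\<integral>\<^sup>+t\<in>{\<delta>..T}. p t \<partial>lborel) \<le> ennreal ((18 * \<bar>T\<bar> / c + \<gamma>) * 0)"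
      by (intro LIMSEQ_le_const) auto
    then have "(\<integral>\<^sup>+t\<in>{\<delta>..T}. p t \<partial>lborel) = 0"
      by simp
    then have "AE t in lborel. p t * indicator {\<delta>..T} t = 0"
      by (subst (asm) nn_integral_0_iff_AE) auto
    then show ?thesis
      by eventually_elim (auto simp: indicator_def)
  qed
  \<comment> \<open>The null set depends on \<delta>, so \<delta> runs through a sequence tending to
    0; together these intervals miss only the time 0.\<close>
  have "AE t in lborel. \<forall>n::nat. t \<in> {1 / real (Suc n)..T} \<longrightarrow> p t = 0"
    unfolding AE_all_countable by (intro allI ae\<delta>) simp
  then have "AE t in lborel. AE \<omega> in M. t \<in> {0..T} \<longrightarrow> y t \<omega> + B t \<omega> \<noteq> a"
    using AE_lborel_singleton[of 0]
  proof eventually_elim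
    case (elim t)
    show ?case
    proof (cases "t \<in> {0..T}")
      case True
      with elim obtain n :: nat where "1 / real (Suc n) < t"
        using reals_Archimedean[of t] by (auto simp: inverse_eq_divide)
      then have "t \<in> {1 / real (Suc n)..T}"
        using True by simp
      with elim(1) have "p t = 0"
        by blast
      then have "AE \<omega> in M. \<not> (y t \<omega> + B t \<omega> = a)"
        unfolding p_def by (subst AE_iff_measurable) auto
      then show ?thesis
        by auto
    qed auto
  qed
  moreover have "{z \<in> space (lborel \<Otimes>\<^sub>M M). fst z \<in> {0..T} \<longrightarrow> y (fst z) (snd z) + B (fst z) (snd z)
      \<noteq> a}
      \<in> sets (lborel \<Otimes>\<^sub>M M)"
    by measurable
  ultimately show ?thesis
    by (rule P.AE_commute[THEN iffD1, rotated])
qed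

end

section \<open>Existence of strong solutions\<close>

text \<open>Coefficients and noise are given on \<open>{0..T}\<close> only, whereas the locales
  above ask for measurability and growth on the whole time axis. Composing with \<open>clamp\<close>
  freezes them outside the interval and changes nothing inside.\<close>

definition clamp :: "real \<Rightarrow> real \<Rightarrow> real" where
  "clamp T t = max 0 (min T t)"

lemma clamp_in: "0 \<le> T \<Longrightarrow> clamp T t \<in> {0..T}"
  by (simp add: clamp_def)

lemma clamp_id: "t \<in> {0..T} \<Longrightarrow> clamp T t = t"
  by (simp add: clamp_def)

lemma measurable_clamp:
  assumes "0 \<le> T"
  shows "clamp T \<in> measurable borel (restrict_space borel {0..T})"
  unfolding clamp_def[abs_def] using assms by (intro measurable_restrict_space2) auto

lemma measurable_clamp_pair:
  assumes "0 \<le> T" and f: "(\<lambda>(t, x). f t x) \<in> borel_measurable (restrict_space borel {0..T} \<Otimes>\<^sub>M N)"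
  shows "(\<lambda>(t, x). f (clamp T t) x) \<in> borel_measurable (borel \<Otimes>\<^sub>M N)"
proof -
  note [measurable] = measurable_clamp[OF assms(1)]
  have "(\<lambda>(t, x). (clamp T t, x)) \<in> measurable (borel \<Otimes>\<^sub>M N) (restrict_space borel {0..T} \<Otimes>\<^sub>M N)"
    by measurable
  from measurable_compose[OF this f] show ?thesis
    by (simp add: case_prod_beta)
qed

lemma piecewise_uniformly_continuous_isCont:
  assumes f: "piecewise_uniformly_continuous m a f" and x: "x \<notin> a ` {1..m}"
  shows "isCont f x"
proof -
  \<comment> \<open>The maximum is the index of the last breakpoint below \<open>x\<close>; the
    inserted 0 stands for "none", in accordance with the piece of index 0 being the leftmost
    one.\<close>
  let ?J = "insert 0 {j \<in> {1..m}. a j < x}"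
  define i where "i = Max ?J"
  let ?S = "{x. (1 \<le> i \<longrightarrow> a i < x) \<and> (i < m \<longrightarrow> x < a (Suc i))}"
  have "i \<in> ?J"
    unfolding i_def by (intro Max_in) auto
  then have "i \<le> m" "1 \<le> i \<longrightarrow> a i < x"
    by auto
  moreover have "x < a (Suc i)" if "i < m"
  proof -
    have "Suc i \<notin> ?J"
      using Max_ge[of ?J "Suc i"] unfolding i_def[symmetric] by auto
    then have "\<not> a (Suc i) < x"
      using that by simp
    moreover have "x \<noteq> a (Suc i)"
      using x that by auto
    ultimately show ?thesis
      by simp
  qed
  ultimately have x_in: "x \<in> ?S" and "i \<le> m"
    by auto
  then have cont: "continuous_on ?S f"
    using f by (intro uniformly_continuous_imp_continuous) (simp add:
        piecewise_uniformly_continuous_def)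
  have "open ?S"
  proof -
    have "?S = (if 1 \<le> i then {a i<..} else UNIV) \<inter> (if i < m then {..<a (Suc i)} else UNIV)"
      by auto
    then show ?thesis
      by (simp add: open_Int)
  qed
  then show ?thesis
    using continuous_on_eq_continuous_at[of ?S f] cont x_in by auto
qed

lemma is_wiener_integral_cong_AE:
  assumes I: "is_wiener_integral M W a b f I" and J: "J \<in> borel_measurable M" and eq: "AE \<omega> in M.
      I \<omega> = J \<omega>"
  shows "is_wiener_integral M W a b f J"
proof -
  have "(\<integral>\<^sup>+\<omega>. ennreal ((step_integral W n \<tau> c \<omega> - I \<omega>)\<^sup>2) \<partial>M)
      = (\<integral>\<^sup>+\<omega>. ennreal ((step_integral W n \<tau> c \<omega> - J \<omega>)\<^sup>2) \<partial>M)" for n \<tau> c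
    using eq by (intro nn_integral_cong_AE) (auto elim!: eventually_mono)
  then show ?thesis
    using I J unfolding is_wiener_integral_def by simp
qed

lemma complete_subalgebra_augmented_filtration:
  assumes "prob_space M" and "complete_measure M" and "standard_brownian_motion M
      (augmented_filtration M W) T W"
    and t: "t \<in> {0..T}"
  shows "complete_subalgebra M (augmented_filtration M W t)"
proof -
  interpret prob_space M by fact
  let ?G = "(\<Union>s\<in>{0..t}. sets (vimage_algebra (space M) (W s) borel)) \<union> null_sets M"
  have sets: "sets (augmented_filtration M W t) = sigma_sets (space M) ?G"
    unfolding augmented_filtration_def by (rule sets_measure_of[OF
        augmented_filtration_generator_subset])
  have W: "W s \<in> borel_measurable M" if "s \<in> {0..t}" for s
    using assms(3) that t unfolding standard_brownian_motion_def by auto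
  have V: "sets (vimage_algebra (space M) (W s) borel) \<subseteq> sets M" if "s \<in> {0..t}" for s
    unfolding sets_vimage_algebra
    by (rule sets.sigma_sets_subset) (auto intro: measurable_sets[OF W[OF that]])
  have G: "?G \<subseteq> sets M"
    by (rule Un_least[OF UN_least[OF V]]) (auto simp: null_sets_def)
  show ?thesis
  proof (intro complete_subalgebra.intro complete_subalgebra_axioms.intro)
    show "prob_space M" "complete_measure M" by fact+
    show "subalgebra M (augmented_filtration M W t)"
      unfolding subalgebra_def
    proof
      show "space (augmented_filtration M W t) = space M"
        unfolding augmented_filtration_def by (rule space_measure_of[OF
            augmented_filtration_generator_subset])
      show "sets (augmented_filtration M W t) \<subseteq> sets M"
        unfolding sets by (rule sets.sigma_sets_subset[OF G])
    qed
    show "null_sets M \<subseteq> sets (augmented_filtration M W t)"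
      unfolding sets by (auto intro: sigma_sets.Basic)
  qed
qed

section \<open>Kernel and paths of the Volterra process\<close>

lemma measurable_clamped_kernel:
  assumes T: "0 \<le> T" and K: "L2_kernel T K"
  shows "(\<lambda>(t, s). K (clamp T t) (clamp T s)) \<in> borel_measurable (borel \<Otimes>\<^sub>M borel)"
proof -
  note [measurable] = measurable_clamp[OF T]
  have "(\<lambda>(t, s). (clamp T t, clamp T s))
      \<in> measurable (borel \<Otimes>\<^sub>M borel) (restrict_space borel {0..T} \<Otimes>\<^sub>M restrict_space borel {0..T})"
    by measurable
  moreover have "(\<lambda>(t, s). K t s) \<in> borel_measurable (restrict_space borel {0..T} \<Otimes>\<^sub>M
      restrict_space borel {0..T})"
    using K by (simp add: L2_kernel_def)
  ultimately have "(\<lambda>z. (\<lambda>(t, s). K t s) ((\<lambda>(t, s). (clamp T t, clamp T s)) z)) \<in> borel_measurable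
      (borel \<Otimes>\<^sub>M borel)"
    by (rule measurable_compose)
  then show ?thesis
    by (simp add: case_prod_beta)
qed

lemma measurable_kernel_section:
  assumes t: "t \<in> {0..T}" and K: "L2_kernel T K"
  shows "set_borel_measurable borel {0..t} (K t)"
proof -
  have T: "0 \<le> T"
    using t by simp
  note [measurable] = measurable_clamped_kernel[OF T K]
  have "(\<lambda>s. indicator {0..t} s *\<^sub>R K (clamp T t) (clamp T s)) \<in> borel_measurable borel"
    by measurable
  then show ?thesis
    unfolding set_borel_measurable_def
    by (rule measurable_cong[THEN iffD1, rotated]) (use t in \<open>auto simp: indicator_def clamp_id\<close>)
qed

text \<open>Square integrability of the kernel, transferred by the second moment bound at each time
  and Fubini. Almost every path is thus square integrable in time, the only path regularity the
  proof extracts from \<open>B\<close>.\<close>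

lemma (in brownian_motion) volterra_second_moment:
  fixes B :: "real \<Rightarrow> 'a \<Rightarrow> real"
  assumes T: "0 \<le> T" and K: "L2_kernel T K" and B: "volterra_process M W T K B"
  shows "(\<integral>\<^sup>+\<omega>. (\<integral>\<^sup>+t\<in>{0..T}. ennreal ((B (clamp T t) \<omega>)\<^sup>2) \<partial>lborel) \<partial>M) < \<infinity>"
proof -
  interpret P: pair_sigma_finite lborel M ..
  let ?B = "\<lambda>t. B (clamp T t)" and ?K = "\<lambda>t s. K (clamp T t) (clamp T s)"
  have [measurable]: "(\<lambda>(t, \<omega>). ?B t \<omega>) \<in> borel_measurable (borel \<Otimes>\<^sub>M M)"
    using B by (intro measurable_clamp_pair[OF T]) (simp add: volterra_process_def)
  note [measurable] = measurable_clamped_kernel[OF T K]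
  have "(\<integral>\<^sup>+\<omega>. (\<integral>\<^sup>+t\<in>{0..T}. ennreal ((?B t \<omega>)\<^sup>2) \<partial>lborel) \<partial>M)
      = (\<integral>\<^sup>+t. \<integral>\<^sup>+\<omega>. ennreal ((?B t \<omega>)\<^sup>2) * indicator {0..T} t \<partial>M \<partial>lborel)"
    by (rule P.Fubini') measurable
  also have "\<dots> \<le> (\<integral>\<^sup>+t. 4 * (\<integral>\<^sup>+s. ennreal ((?K t s)\<^sup>2) * indicator {0..T} s * indicator {0..T} t
      \<partial>lborel) \<partial>lborel)"
  proof (rule nn_integral_mono)
    fix t
    show "(\<integral>\<^sup>+\<omega>. ennreal ((?B t \<omega>)\<^sup>2) * indicator {0..T} t \<partial>M)
        \<le> 4 * (\<integral>\<^sup>+s. ennreal ((?K t s)\<^sup>2) * indicator {0..T} s * indicator {0..T} t \<partial>lborel)"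
    proof (cases "t \<in> {0..T}")
      case True
      then have "(\<integral>\<^sup>+\<omega>. ennreal ((B t \<omega>)\<^sup>2) \<partial>M) \<le> 4 * (\<integral>\<^sup>+s\<in>{0..t}. ennreal ((K t s)\<^sup>2) \<partial>lborel)"
        using B by (intro wiener_integral_second_moment measurable_kernel_section[OF _ K])
          (auto simp: volterra_process_def)
      also have "\<dots> \<le> 4 * (\<integral>\<^sup>+s. ennreal ((?K t s)\<^sup>2) * indicator {0..T} s * indicator {0..T} t
          \<partial>lborel)"
        using True by (intro mult_left_mono nn_integral_mono) (auto simp: indicator_def clamp_id)
      finally show ?thesis
        using True by (simp add: clamp_id)
    qed simp
  qed
  also have "\<dots> = 4 * (\<integral>\<^sup>+t. \<integral>\<^sup>+s. ennreal ((?K t s)\<^sup>2) * indicator {0..T} s * indicator {0..T} t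
      \<partial>lborel \<partial>lborel)"
    by (rule nn_integral_cmult) measurable
  also have "(\<integral>\<^sup>+t. \<integral>\<^sup>+s. ennreal ((?K t s)\<^sup>2) * indicator {0..T} s * indicator {0..T} t \<partial>lborel
      \<partial>lborel)
      = (\<integral>\<^sup>+s. \<integral>\<^sup>+t. ennreal ((?K t s)\<^sup>2) * indicator {0..T} s * indicator {0..T} t \<partial>lborel \<partial>lborel)"
    by (rule lborel_pair.Fubini') measurable
  also have "\<dots> = (\<integral>\<^sup>+s\<in>{0..T}. (\<integral>\<^sup>+t\<in>{0..T}. ennreal ((K t s)\<^sup>2) \<partial>lborel) \<partial>lborel)"
  proof (rule nn_integral_cong)
    fix s
    show "(\<integral>\<^sup>+t. ennreal ((?K t s)\<^sup>2) * indicator {0..T} s * indicator {0..T} t \<partial>lborel)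
        = (\<integral>\<^sup>+t\<in>{0..T}. ennreal ((K t s)\<^sup>2) \<partial>lborel) * indicator {0..T} s"
      by (cases "s \<in> {0..T}") (auto intro!: nn_integral_cong simp: indicator_def clamp_id)
  qed
  also have "4 * \<dots> < \<infinity>"
    using K unfolding L2_kernel_def by (simp add: ennreal_mult_less_top)
  finally show ?thesis .
qed


text \<open>Integrability of \<open>(K t s)\<^sup>2\<close> in \<open>s\<close> for every
  \<open>t\<close> lets the Bochner integral of the hypothesis be read as a nonnegative integral,
  the form used by the Gaussian estimates.\<close>

lemma L2_kernel_nondeterminism:
  assumes K: "L2_kernel T K" and t: "t \<in> {0<..T}" and \<epsilon>: "\<epsilon> \<in> {0<..<t}"
    and le: "u \<le> sqrt (LBINT s:{t - \<epsilon>..t}. (K t s)\<^sup>2)" and "0 \<le> u"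
  shows "ennreal (u\<^sup>2) \<le> (\<integral>\<^sup>+s\<in>{t - \<epsilon>..t}. ennreal ((K t s)\<^sup>2) \<partial>lborel)"
proof -
  have "set_integrable lborel {0..t} (\<lambda>s. (K t s)\<^sup>2)"
    using K t by (simp add: L2_kernel_def)
  then have int: "set_integrable lborel {t - \<epsilon>..t} (\<lambda>s. (K t s)\<^sup>2)"
    by (rule set_integrable_subset) (use \<epsilon> in auto)
  have "0 \<le> (LBINT s:{t - \<epsilon>..t}. (K t s)\<^sup>2)"
    by (simp add: set_lebesgue_integral_def)
  then have "u\<^sup>2 \<le> (LBINT s:{t - \<epsilon>..t}. (K t s)\<^sup>2)"
    using power_mono[OF le \<open>0 \<le> u\<close>, of 2] by simp
  then have "ennreal (u\<^sup>2) \<le> ennreal (LBINT s:{t - \<epsilon>..t}. (K t s)\<^sup>2)"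
    by (rule ennreal_leI)
  also have "\<dots> = (\<integral>\<^sup>+s. ennreal (indicator {t - \<epsilon>..t} s *\<^sub>R (K t s)\<^sup>2) \<partial>lborel)"
    using int unfolding set_lebesgue_integral_def set_integrable_def
    by (intro nn_integral_eq_integral[symmetric]) auto
  also have "\<dots> = (\<integral>\<^sup>+s\<in>{t - \<epsilon>..t}. ennreal ((K t s)\<^sup>2) \<partial>lborel)"
    by (intro nn_integral_cong) (auto simp: indicator_def)
  finally show ?thesis .
qed

lemma nn_integral_Icc_eq_set_integral:
  fixes h :: "real \<Rightarrow> real"
  assumes "set_integrable lborel {a..b} h" and "\<And>s. 0 \<le> h s"
  shows "(\<integral>\<^sup>+s\<in>{a..b}. ennreal (h s) \<partial>lborel) = ennreal (LBINT s:{a..b}. h s)"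
proof -
  have "(\<integral>\<^sup>+s\<in>{a..b}. ennreal (h s) \<partial>lborel) = (\<integral>\<^sup>+s. ennreal (indicator {a..b} s *\<^sub>R h s) \<partial>lborel)"
    by (intro nn_integral_cong) (auto simp: indicator_def)
  also have "\<dots> = ennreal (LBINT s:{a..b}. h s)"
    using assms unfolding set_lebesgue_integral_def set_integrable_def
    by (intro nn_integral_eq_integral) auto
  finally show ?thesis .
qed

theorem theorem1p1:
  fixes M :: "'a measure" and W B :: "real \<Rightarrow> 'a \<Rightarrow> real"
    and K b :: "real \<Rightarrow> real \<Rightarrow> real" and a :: "nat \<Rightarrow> real" and m :: nat
    and T H c C x0 :: real
  assumes "0 < T"
    and "prob_space M" and "complete_measure M"
    and "standard_brownian_motion M (augmented_filtration M W) T W"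
    and "L2_kernel T K"
    and "volterra_process M W T K B"
    and "0 < H" and "H < 1" and "0 < c"
    and "\<And>t \<epsilon>. t \<in> {0<..T} \<Longrightarrow> \<epsilon> \<in> {0<..<t} \<Longrightarrow>
           sqrt (LBINT s:{t - \<epsilon>..t}. (K t s)\<^sup>2) \<ge> c * \<epsilon> powr H"
    and "(\<lambda>(t, x). b t x) \<in> borel_measurable (restrict_space borel {0..T} \<Otimes>\<^sub>M borel)"
    and "\<And>t. t \<in> {0..T} \<Longrightarrow> piecewise_uniformly_continuous m a (b t)"
    and "\<And>t x. t \<in> {0..T} \<Longrightarrow> \<bar>b t x\<bar> \<le> C * (1 + \<bar>x\<bar>)"
  shows "\<exists>X. strong_solution M (augmented_filtration M W) T x0 b B X"
proof -
  let ?F = "augmented_filtration M W"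
  have T: "0 \<le> T"
    using \<open>0 < T\<close> by simp
  have cs: "complete_subalgebra M (?F t)" if "t \<in> {0..T}" for t
    by (rule complete_subalgebra_augmented_filtration[OF assms(2-4) that])
  have F_mono: "sets (?F s) \<subseteq> sets (?F t)" if "s \<le> t" for s t
    using filtration_augmented_filtration[of M W] that by (simp add: filtration_def)
  interpret prob_space M by fact
  interpret brownian_motion M ?F T W
    using assms(4) complete_subalgebra.subalg[OF cs] F_mono by unfold_locales
  interpret P: pair_sigma_finite lborel M ..

  define f where "f s x = b (clamp T s) x" for s x
  \<comment> \<open>\<open>C\<close> may be 0, while the Gronwall rate has to be positive.\<close>
  define C' where "C' = C + 1"
  have C0: "0 \<le> C"
    using assms(13)[of 0 0] T by simp
  then have C': "0 < C'"
    by (simp add: C'_def)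
  have f [measurable]: "(\<lambda>(s, x). f s x) \<in> borel_measurable (borel \<Otimes>\<^sub>M borel)"
    unfolding f_def by (rule measurable_clamp_pair[OF T assms(11)])
  have growth: "\<bar>f s x\<bar> \<le> C' * (1 + \<bar>x\<bar>)" for s x
  proof -
    have "\<bar>f s x\<bar> \<le> C * (1 + \<bar>x\<bar>)"
      unfolding f_def by (rule assms(13)[OF clamp_in[OF T]])
    also have "\<dots> \<le> C' * (1 + \<bar>x\<bar>)"
      by (rule mult_right_mono) (auto simp: C'_def)
    finally show ?thesis .
  qed

  define N where "N t \<omega> = B (clamp T t) \<omega>" for t \<omega>
  have N [measurable]: "(\<lambda>(t, \<omega>). N t \<omega>) \<in> borel_measurable (borel \<Otimes>\<^sub>M M)"
    unfolding N_def using assms(6) by (intro measurable_clamp_pair[OF T]) (simp add: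
        volterra_process_def)
  define Q where "Q \<omega> = (\<integral>\<^sup>+t\<in>{0..T}. ennreal ((N t \<omega>)\<^sup>2) \<partial>lborel)" for \<omega>
  have Q [measurable]: "Q \<in> borel_measurable M"
    unfolding Q_def by measurable
  have Q_fin: "(\<integral>\<^sup>+\<omega>. Q \<omega> \<partial>M) < \<infinity>"
    unfolding Q_def N_def by (rule volterra_second_moment[OF T assms(5,6)])
  \<comment> \<open>The bad paths are replaced by 0, so that the deterministic theory applies to
    every \<omega> in the space. \<open>Q\<close> depends on the path up to time \<open>T\<close>;
    \<open>Z\<close> is nevertheless adapted, because it differs from \<open>B\<close> on a null set
    only.\<close>
  define Z where "Z t \<omega> = (if Q \<omega> < \<infinity> then N t \<omega> else 0)" for t \<omega>
  have Z [measurable]: "(\<lambda>(t, \<omega>). Z t \<omega>) \<in> borel_measurable (borel \<Otimes>\<^sub>M M)"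
    unfolding Z_def by measurable
  have "AE \<omega> in M. Q \<omega> \<noteq> \<infinity>"
    using Q_fin by (intro nn_integral_PInf_AE Q) auto
  \<comment> \<open>The exceptional set comes from \<open>Q\<close> and does not depend on
    \<open>t\<close>; a strong solution needs one null set for all times.\<close>
  then have ZB: "AE \<omega> in M. \<forall>t\<in>{0..T}. Z t \<omega> = B t \<omega>"
    by eventually_elim (auto simp: Z_def N_def clamp_id less_top)
  have ZB_t: "AE \<omega> in M. Z t \<omega> = B t \<omega>" if "t \<in> {0..T}" for t
    using ZB by eventually_elim (use that in auto)
  have Zt: "Z t \<in> borel_measurable M" for t
    by measurable
  have wiener: "is_wiener_integral M W 0 t (K t) (B t)" if "t \<in> {0..T}" for t
    using assms(6) that by (simp add: volterra_process_def)
  have wienerZ: "is_wiener_integral M W 0 t (K t) (Z t)" if "t \<in> {0..T}" for t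
  proof (rule is_wiener_integral_cong_AE[OF wiener[OF that] Zt])
    show "AE \<omega> in M. B t \<omega> = Z t \<omega>"
      using ZB_t[OF that] by eventually_elim simp
  qed
  interpret noise: adapted_noise M ?F Z T
  proof (intro adapted_noise.intro adapted_noise_axioms.intro)
    show "Z t \<in> borel_measurable (?F t)" if "t \<in> {0..T}" for t
      by (rule wiener_integral_adapted[OF wienerZ[OF that] that cs[OF that]])
  qed (fact prob_space_axioms cs F_mono Z)+

  have Z_meas: "(\<lambda>s. Z s \<omega>) \<in> borel_measurable borel" if "\<omega> \<in> space M" for \<omega>
    using that by measurable
  have Z_sq: "(\<integral>\<^sup>+s\<in>{0..T}. ennreal \<bar>Z s \<omega>\<bar> \<partial>lborel) \<le> ennreal T + (if Q \<omega> < \<infinity> then Q \<omega> else 0)"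
    if \<omega>: "\<omega> \<in> space M" for \<omega>
  proof -
    note [measurable] = Z_meas[OF \<omega>]
    have "(\<integral>\<^sup>+s\<in>{0..T}. ennreal \<bar>Z s \<omega>\<bar> \<partial>lborel)
        \<le> (\<integral>\<^sup>+s. indicator {0..T} s + ennreal ((Z s \<omega>)\<^sup>2) * indicator {0..T} s \<partial>lborel)"
    proof (rule nn_integral_mono)
      fix s
      \<comment> \<open>Expanding the square gives \<open>2 * \<bar>Z s \<omega>\<bar> \<le> 1 + (Z
        s \<omega>)\<^sup>2\<close>.\<close>
      have "0 \<le> (1 - \<bar>Z s \<omega>\<bar>)\<^sup>2" "0 \<le> \<bar>Z s \<omega>\<bar>"
        by auto
      then have "\<bar>Z s \<omega>\<bar> \<le> 1 + (Z s \<omega>)\<^sup>2"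
        by (simp add: power2_diff)
      then have "ennreal \<bar>Z s \<omega>\<bar> \<le> 1 + ennreal ((Z s \<omega>)\<^sup>2)"
        using ennreal_leI[of "\<bar>Z s \<omega>\<bar>" "1 + (Z s \<omega>)\<^sup>2"] by simp
      then show "ennreal \<bar>Z s \<omega>\<bar> * indicator {0..T} s
          \<le> indicator {0..T} s + ennreal ((Z s \<omega>)\<^sup>2) * indicator {0..T} s"
        by (auto simp: indicator_def)
    qed
    also have "\<dots> = emeasure lborel {0..T} + (\<integral>\<^sup>+s\<in>{0..T}. ennreal ((Z s \<omega>)\<^sup>2) \<partial>lborel)"
      by (subst nn_integral_add) auto
    also have "(\<integral>\<^sup>+s\<in>{0..T}. ennreal ((Z s \<omega>)\<^sup>2) \<partial>lborel) = (if Q \<omega> < \<infinity> then Q \<omega> else 0)"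
      by (simp add: Z_def Q_def)
    finally show ?thesis
      using T by simp
  qed
  have Z_int: "set_integrable lborel {0..T} (\<lambda>s. Z s \<omega>)" if \<omega>: "\<omega> \<in> space M" for \<omega>
    unfolding set_integrable_def
  proof (rule integrableI_bounded)
    note [measurable] = Z_meas[OF \<omega>]
    show "(\<lambda>s. indicator {0..T} s *\<^sub>R Z s \<omega>) \<in> borel_measurable lborel"
      by measurable
    have "(\<integral>\<^sup>+s. ennreal (norm (indicator {0..T} s *\<^sub>R Z s \<omega>)) \<partial>lborel) = (\<integral>\<^sup>+s\<in>{0..T}. ennreal \<bar>Z s
        \<omega>\<bar> \<partial>lborel)"
      by (intro nn_integral_cong) (auto simp: indicator_def)
    also have "\<dots> < \<infinity>"
      using Z_sq[OF \<omega>] by (rule order.strict_trans1) auto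
    finally show "(\<integral>\<^sup>+s. ennreal (norm (indicator {0..T} s *\<^sub>R Z s \<omega>)) \<partial>lborel) < \<infinity>" .
  qed
  have ode: "irregular_additive_ode T C' f (\<lambda>s. Z s \<omega>) \<rat>" if \<omega>: "\<omega> \<in> space M" for \<omega>
  proof
    show "\<exists>y\<in>\<rat>. \<bar>x - y\<bar> < e" if e: "0 < e" for x e :: real
    proof -
      obtain r where "r \<in> \<rat>" "x < r" "r < x + e"
        using Rats_dense_in_real[of x "x + e"] e by auto
      then show ?thesis
        by (intro bexI[of _ r]) auto
    qed
  qed (use C' f Z_meas[OF \<omega>] Z_int[OF \<omega>] growth T countable_rat in auto)

  define y where "y t \<omega> = upper_solution C' \<rat> f x0 (\<lambda>s. Z s \<omega>) t" for t \<omega>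
  have y: "(\<lambda>(t, \<omega>). y t \<omega>) \<in> borel_measurable (borel \<Otimes>\<^sub>M M)"
    unfolding y_def by (rule noise.measurable_upper_solution[OF f ode])
  have y_adapted: "y t \<in> borel_measurable (?F t)" if "t \<in> {0..T}" for t
    unfolding y_def[abs_def] by (rule noise.adapted_upper_solution[OF f ode that])
  \<comment> \<open>The a priori radius of the path, now as a random variable; \<open>g\<close> is
    the resulting majorant of the drift along \<open>y + Z\<close>.\<close>
  define \<rho> where "\<rho> \<omega> = 2 * (\<bar>x0\<bar> + (LBINT s:{0..T}. C' * (1 + \<bar>Z s \<omega>\<bar>))) * exp (2 * C' * T)" for \<omega>
  define g where "g s \<omega> = ennreal (C' * (1 + (\<rho> \<omega> + \<bar>Z s \<omega>\<bar>)))" for s \<omega>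
  have \<rho> [measurable]: "\<rho> \<in> borel_measurable M"
    unfolding \<rho>_def by measurable
  have g [measurable]: "(\<lambda>(s, \<omega>). g s \<omega>) \<in> borel_measurable (borel \<Otimes>\<^sub>M M)"
    unfolding g_def by measurable
  have "0 \<le> (LBINT s:{0..T}. C' * (1 + \<bar>Z s \<omega>\<bar>))" for \<omega>
    using C' unfolding set_lebesgue_integral_def by (intro Bochner_Integration.integral_nonneg) auto
  then have \<rho>_nonneg: "0 \<le> \<rho> \<omega>" for \<omega>
    unfolding \<rho>_def by simp
  have maj: "set_integrable lborel {0..T} (\<lambda>s. C' * (1 + (\<rho> \<omega> + \<bar>Z s \<omega>\<bar>)))" if "\<omega> \<in> space M" for \<omega>
    unfolding \<rho>_def by (rule irregular_additive_ode.integrable_majorant[OF ode[OF that]])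
  have maj_nonneg: "0 \<le> C' * (1 + (\<rho> \<omega> + \<bar>Z s \<omega>\<bar>))" for s \<omega>
    using C' \<rho>_nonneg[of \<omega>] by simp
  have increment: "ennreal \<bar>y t \<omega> - y r \<omega>\<bar> \<le> (\<integral>\<^sup>+s\<in>{r..t}. g s \<omega> \<partial>lborel)"
    if "0 \<le> r" "r \<le> t" "t \<le> T" and \<omega>: "\<omega> \<in> space M" for r t \<omega>
  proof -
    have int: "set_integrable lborel {r..t} (\<lambda>s. C' * (1 + (\<rho> \<omega> + \<bar>Z s \<omega>\<bar>)))"
      by (rule set_integrable_subset[OF maj[OF \<omega>]]) (use that in auto)
    have "\<bar>y t \<omega> - y r \<omega>\<bar> \<le> (LBINT s:{r..t}. C' * (1 + (\<rho> \<omega> + \<bar>Z s \<omega>\<bar>)))"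
      unfolding y_def \<rho>_def
      by (rule irregular_additive_ode.upper_solution_increment[OF ode[OF \<omega>] that(1-3)])
    then show ?thesis
      unfolding g_def nn_integral_Icc_eq_set_integral[OF int maj_nonneg] by (rule ennreal_leI)
  qed
  have fin: "(\<integral>\<^sup>+s\<in>{0..T}. (\<integral>\<^sup>+\<omega>. g s \<omega> \<partial>M) \<partial>lborel) < \<infinity>"
  proof -
    define q where "q \<omega> = (LBINT s:{0..T}. \<bar>Z s \<omega>\<bar>)" for \<omega>
    have [measurable]: "q \<in> borel_measurable M"
      unfolding q_def by measurable
    have q_nonneg: "0 \<le> q \<omega>" for \<omega>
      unfolding q_def set_lebesgue_integral_def by (intro Bochner_Integration.integral_nonneg) auto
    have "(\<integral>\<^sup>+\<omega>. ennreal (q \<omega>) \<partial>M) \<le> (\<integral>\<^sup>+\<omega>. ennreal T + Q \<omega> \<partial>M)"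
    proof (rule nn_integral_mono)
      fix \<omega> assume \<omega>: "\<omega> \<in> space M"
      have "ennreal (q \<omega>) = (\<integral>\<^sup>+s\<in>{0..T}. ennreal \<bar>Z s \<omega>\<bar> \<partial>lborel)"
        unfolding q_def
        by (rule nn_integral_Icc_eq_set_integral[OF set_integrable_abs[OF Z_int[OF \<omega>]],
            symmetric]) simp
      also have "\<dots> \<le> ennreal T + (if Q \<omega> < \<infinity> then Q \<omega> else 0)"
        by (rule Z_sq[OF \<omega>])
      also have "\<dots> \<le> ennreal T + Q \<omega>"
        by (intro add_left_mono) auto
      finally show "ennreal (q \<omega>) \<le> ennreal T + Q \<omega>" .
    qed
    also have "\<dots> = ennreal T + (\<integral>\<^sup>+\<omega>. Q \<omega> \<partial>M)"
      by (subst nn_integral_add) (auto simp: emeasure_space_1)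
    also have "\<dots> < \<infinity>"
      using Q_fin by simp
    finally have q_fin: "(\<integral>\<^sup>+\<omega>. ennreal (q \<omega>) \<partial>M) < \<infinity>" .
    \<comment> \<open>\<open>\<rho> \<omega>\<close> is affine in \<open>q \<omega>\<close>, and so
      is the time integral of the majorant; \<open>A\<close> and \<open>E\<close> are its
      coefficients. The expectation is then finite because that of \<open>q\<close> is at most
      \<open>T\<close> plus that of \<open>Q\<close>.\<close>
    define A where "A = C' * T * (1 + 2 * (\<bar>x0\<bar> + C' * T) * exp (2 * C' * T))"
    define E where "E = C' * T * 2 * C' * exp (2 * C' * T) + C'"
    have A0: "0 \<le> A" and E0: "0 \<le> E"
      using C' T unfolding A_def E_def by (auto intro!: mult_nonneg_nonneg add_nonneg_nonneg)
    have inner: "(\<integral>\<^sup>+s\<in>{0..T}. g s \<omega> \<partial>lborel) = ennreal (A + E * q \<omega>)" if \<omega>: "\<omega> \<in> space M" for \<omega>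
    proof -
      have int: "set_integrable lborel {0..T} (\<lambda>s. \<bar>Z s \<omega>\<bar>)"
        by (rule set_integrable_abs[OF Z_int[OF \<omega>]])
      have const: "set_integrable lborel {0..T} (\<lambda>s. k)" "(LBINT s:{0..T}. k) = T * k" for k :: real
        using T by (auto simp: set_lebesgue_integral_def intro: borel_integrable_atLeastAtMost')
      have affine: "(LBINT s:{0..T}. C' * (k + \<bar>Z s \<omega>\<bar>)) = C' * (T * k + q \<omega>)" for k
        using set_integral_add(2)[OF const(1)[of k] int] const(2)[of k] by (simp add: q_def)
      have "(LBINT s:{0..T}. C' * (1 + (\<rho> \<omega> + \<bar>Z s \<omega>\<bar>))) = C' * (T * (1 + \<rho> \<omega>) + q \<omega>)"
        using affine[of "1 + \<rho> \<omega>"] by (simp add: add.assoc)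
      also have "\<dots> = A + E * q \<omega>"
      proof -
        have \<rho>_eq: "\<rho> \<omega> = 2 * (\<bar>x0\<bar> + C' * (T * 1 + q \<omega>)) * exp (2 * C' * T)"
          unfolding \<rho>_def affine ..
        show ?thesis
          unfolding \<rho>_eq A_def E_def by (simp add: algebra_simps)
      qed
      finally have "(LBINT s:{0..T}. C' * (1 + (\<rho> \<omega> + \<bar>Z s \<omega>\<bar>))) = A + E * q \<omega>" .
      then show ?thesis
        unfolding g_def nn_integral_Icc_eq_set_integral[OF maj[OF \<omega>] maj_nonneg] by simp
    qed
    have "(\<integral>\<^sup>+s\<in>{0..T}. (\<integral>\<^sup>+\<omega>. g s \<omega> \<partial>M) \<partial>lborel) = (\<integral>\<^sup>+s. \<integral>\<^sup>+\<omega>. g s \<omega> * indicator {0..T} s \<partial>M \<partial>lborel)"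
      by (intro nn_integral_cong nn_integral_multc[symmetric]) measurable
    also have "\<dots> = (\<integral>\<^sup>+\<omega>. (\<integral>\<^sup>+s\<in>{0..T}. g s \<omega> \<partial>lborel) \<partial>M)"
      by (rule P.Fubini'[symmetric]) measurable
    also have "\<dots> = (\<integral>\<^sup>+\<omega>. ennreal (A + E * q \<omega>) \<partial>M)"
      by (intro nn_integral_cong inner)
    also have "\<dots> = (\<integral>\<^sup>+\<omega>. ennreal A + ennreal E * ennreal (q \<omega>) \<partial>M)"
      using A0 E0 q_nonneg by (intro nn_integral_cong) (simp add: ennreal_mult')
    also have "\<dots> = ennreal A + ennreal E * (\<integral>\<^sup>+\<omega>. ennreal (q \<omega>) \<partial>M)"
      by (subst nn_integral_add) (auto simp: nn_integral_cmult emeasure_space_1)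
    also have "\<dots> < \<infinity>"
      using q_fin by (simp add: ennreal_mult_less_top)
    finally show ?thesis .
  qed

  have "AE \<omega> in M. AE t in lborel. t \<in> {0..T} \<longrightarrow> y t \<omega> + Z t \<omega> \<noteq> a i" for i
  proof (rule AE_not_at_level[where K = K and g = g, OF \<open>0 < H\<close> \<open>H < 1\<close> \<open>0 < c\<close> _ _ Z wienerZ y
      y_adapted g increment fin])
    show "set_borel_measurable borel {0..t} (K t)" if "t \<in> {0..T}" for t
      by (rule measurable_kernel_section[OF that assms(5)])
    show "ennreal ((c * \<epsilon> powr H)\<^sup>2) \<le> (\<integral>\<^sup>+s\<in>{t - \<epsilon>..t}. ennreal ((K t s)\<^sup>2) \<partial>lborel)"
      if "t \<in> {0<..T}" "\<epsilon> \<in> {0<..<t}" for t \<epsilon>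
      using \<open>0 < c\<close> by (intro L2_kernel_nondeterminism[OF assms(5) that assms(10)[OF that]]) simp
  qed
  then have "AE \<omega> in M. \<forall>i. AE t in lborel. t \<in> {0..T} \<longrightarrow> y t \<omega> + Z t \<omega> \<noteq> a i"
    by (simp add: AE_all_countable)
  then have solves: "AE \<omega> in M. \<forall>t\<in>{0..T}. y t \<omega> = x0 + (LBINT s:{0..t}. f s (y s \<omega> + Z s \<omega>))"
    using AE_space
  proof eventually_elim
    case (elim \<omega>)
    have "AE t in lborel. \<forall>i. t \<in> {0..T} \<longrightarrow> y t \<omega> + Z t \<omega> \<noteq> a i"
      unfolding AE_all_countable by (rule elim(1))
    then have "AE s\<in>{0..T} in lborel. isCont (f s) (upper_solution C' \<rat> f x0 (\<lambda>s. Z s \<omega>) s + Z s \<omega>)"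
    proof eventually_elim
      case (elim s)
      show ?case
      proof
        assume s: "s \<in> {0..T}"
        have "y s \<omega> + Z s \<omega> \<notin> a ` {1..m}"
          using elim s by auto
        then have "isCont (b s) (y s \<omega> + Z s \<omega>)"
          by (rule piecewise_uniformly_continuous_isCont[OF assms(12)[OF s]])
        then show "isCont (f s) (upper_solution C' \<rat> f x0 (\<lambda>s. Z s \<omega>) s + Z s \<omega>)"
          by (simp add: f_def[abs_def] clamp_id[OF s] y_def)
      qed
    qed
    from irregular_additive_ode.upper_solution_solves[OF ode[OF elim(2)] this]
    show ?case
      unfolding y_def by blast
  qed

  \<comment> \<open>Built with \<open>Z\<close>, the noise that drives \<open>y\<close>. Replacing
    \<open>Z\<close> by \<open>B\<close> in the equation costs the null set of
    \<open>ZB\<close>.\<close>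
  define X where "X t \<omega> = y t \<omega> + Z t \<omega>" for t \<omega>
  have "strong_solution M ?F T x0 b B X"
    unfolding strong_solution_def
  proof
    show "\<forall>t\<in>{0..T}. X t \<in> borel_measurable (?F t)"
      unfolding X_def[abs_def] using y_adapted noise.adapted_B by (auto intro!:
          borel_measurable_add)
    show "AE \<omega> in M. \<forall>t\<in>{0..T}. set_integrable lborel {0..t} (\<lambda>s. b s (X s \<omega>)) \<and>
        X t \<omega> = x0 + (LBINT s:{0..t}. b s (X s \<omega>)) + B t \<omega>"
      using solves ZB AE_space
    proof eventually_elim
      case (elim \<omega>)
      show ?case
      proof
        fix t assume t: "t \<in> {0..T}"
        have eq: "f s (y s \<omega> + Z s \<omega>) = b s (X s \<omega>)" if "s \<in> {0..t}" for s
          using that t clamp_id[of s T] by (simp add: f_def X_def)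
        have "set_integrable lborel {0..T} (\<lambda>s. f s (y s \<omega> + Z s \<omega>))"
          unfolding y_def by (rule irregular_additive_ode.upper_solution_integrable[OF ode[OF
              elim(3)]])
        then have "set_integrable lborel {0..t} (\<lambda>s. f s (y s \<omega> + Z s \<omega>))"
          by (rule set_integrable_subset) (use t in auto)
        moreover have "set_integrable lborel {0..t} (\<lambda>s. f s (y s \<omega> + Z s \<omega>))
            \<longleftrightarrow> set_integrable lborel {0..t} (\<lambda>s. b s (X s \<omega>))"
          by (rule set_integrable_cong) (use eq in auto)
        moreover have "(LBINT s:{0..t}. f s (y s \<omega> + Z s \<omega>)) = (LBINT s:{0..t}. b s (X s \<omega>))"
          by (rule set_lebesgue_integral_cong) (use eq in auto)
        moreover have "X t \<omega> = y t \<omega> + B t \<omega>"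
          using elim(2) t by (simp add: X_def)
        ultimately show "set_integrable lborel {0..t} (\<lambda>s. b s (X s \<omega>)) \<and>
            X t \<omega> = x0 + (LBINT s:{0..t}. b s (X s \<omega>)) + B t \<omega>"
          using elim(1) t by simp
      qed
    qed
  qed
  then show ?thesis
    by blast
qed

end
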